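(* Let $s\geq2$ with $s\equiv1\pmod{q-1}$, and let $s=\sum_{i=0}^rs_iq^i$ be the expansion of $s$ in base $q$. Let $d$ be an integer such that $q^d>s$ and let $\mathfrak{p}$ be a prime of $A$ of degree $d$. Then $$\mathbb{B}_s\equiv\frac{(-1)^s\,BC_{q^d-s}\,\prod_{i=0}^rl_{d-i-1}^{\,s_iq^i}}{\Pi(q^d-s)}\pmod{\mathfrak{p}},$$ where the congruence is understood in the localization $A_{(\mathfrak{p})}$ of $A$ at $\mathfrak{p}$.
   Context: Let $q$ be a prime power, $A=\mathbb{F}_q[\theta]$, $K=\mathbb{F}_q(\theta)$, $K_\infty=\mathbb{F}_q((\theta^{-1}))$, $\mathbb{C}_\infty$ the completion of an algebraic closure of $K_\infty$. A prime of $A$ is a monic irreducible polynomial. Fix a $(q-1)$-th root $(-\theta)^{1/(q-1)}\in\mathbb{C}_\infty$; set $\widetilde{\pi}=\theta(-\theta)^{1/(q-1)}\prod_{i\ge1}(1-\theta^{1-q^i})^{-1}$ and $\omega(t)=(-\theta)^{1/(q-1)}\prod_{i\ge 0}(1-t/\theta^{q^i})^{-1}$. Set $d_0=l_0=1$, $d_n=\prod_{i=0}^{n-1}(\theta^{q^n}-\theta^{q^i})$ and $l_n=(-1)^n\prod_{i=1}^n(\theta^{q^i}-\theta)$ for $n\ge1$. For $n\ge 0$ with base-$q$ expansion $n=\sum n_iq^i$, $0\le n_i\le q-1$, the Carlitz factorial is $\Pi(n)=\prod_id_i^{n_i}$. Carlitz's exponential is $\exp(z)=\sum_{n\ge0}z^{q^n}/d_n$,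 and the Bernoulli-Carlitz fractions $BC_n\in K$ are defined by $z/\exp(z)=\sum_{n\ge0}\frac{BC_n}{\Pi(n)}z^n$; equivalently, for $n>0$, $n\equiv0\pmod{q-1}$, $\sum_{a\in A\text{ monic}}a^{-n}=BC_n\widetilde{\pi}^n/\Pi(n)$. $A^+(d)$ is the set of monic polynomials of degree $d$, and $\chi_{t_i}:A\to\mathbb{F}_q[t_1,\ldots,t_s]$ is the $\mathbb{F}_q$-algebra homomorphism with $\chi_{t_i}(\theta)=t_i$. For $s\geq 2$, $s\equiv1\pmod{q-1}$, let $$V_{1,s}(t_1,\ldots,t_s)=\widetilde{\pi}^{-1}\Big(\sum_{d\ge0}\sum_{a\in A^+(d)}\chi_{t_1}(a)\cdots\chi_{t_s}(a)a^{-1}\Big)\omega(t_1)\cdots\omega(t_s),$$ which, as a formal series, is a polynomial in $A[t_1,\ldots,t_s]$. Define $$\mathbb{B}_s=\Pi(s)^{-1}V_{1,s}(\theta,\ldots,\theta)\in K.$$ *)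

theory Defs
  imports
    "HOL-Analysis.Analysis"
    "HOL-Algebra.Algebraic_Closure_Type"
    "HOL-Computational_Algebra.Computational_Algebra"
    "HOL-Library.Poly_Mapping"
    "HOL-Number_Theory.Cong"
begin

text \<open>
  The type \<open>'a\<close> is the finite field with \<open>q = CARD('a)\<close> elements, \<open>'a poly\<close> is \<open>A\<close> with
  \<open>\<theta> = [:0, 1:]\<close>, and \<open>'a poly fract\<close> is \<open>K\<close>. The field of formal Laurent series in \<open>1/\<theta>\<close> is
  \<open>'a fls\<close>, where the formal variable \<open>fls_X\<close> plays the role of \<open>1/\<theta>\<close>.
\<close>

section \<open>Carlitz's arithmetic over \<open>A\<close> and \<open>K\<close>\<close>

abbreviation theta :: "'a::finite_field poly" where
  "theta \<equiv> [:0, 1:]"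

definition carlitz_d :: "nat \<Rightarrow> 'a::finite_field poly" where
  "carlitz_d n = (\<Prod>i<n. theta ^ (CARD('a) ^ n) - theta ^ (CARD('a) ^ i))"

definition carlitz_l :: "nat \<Rightarrow> 'a::finite_field poly" where
  "carlitz_l n = (-1) ^ n * (\<Prod>i=1..n. theta ^ (CARD('a) ^ i) - theta)"

text \<open>The \<open>i\<close>-th base-\<open>q\<close> digit of \<open>n\<close> is \<open>n div q ^ i mod q\<close>, which vanishes for \<open>i > n\<close>.\<close>

definition carlitz_factorial :: "nat \<Rightarrow> 'a::finite_field poly" where
  "carlitz_factorial n = (\<Prod>i\<le>n. carlitz_d i ^ (n div CARD('a) ^ i mod CARD('a)))"

definition carlitz_exp :: "'a::finite_field poly fract fps" where
  "carlitz_exp = Abs_fps (\<lambda>m. \<Sum>n | m = CARD('a) ^ n. 1 / to_fract (carlitz_d n))"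

definition bernoulli_carlitz :: "nat \<Rightarrow> 'a::finite_field poly fract" where
  "bernoulli_carlitz n = to_fract (carlitz_factorial n) * fps_nth (fps_X / carlitz_exp) n"

definition monics :: "nat \<Rightarrow> 'a::finite_field poly set" where
  "monics d = {a. Polynomial.degree a = d \<and> Polynomial.lead_coeff a = 1}"

definition localization_at :: "'a::finite_field poly \<Rightarrow> 'a poly fract set" where
  "localization_at p = {to_fract a / to_fract b | a b. \<not> p dvd b}"

definition cong_localized ::
  "'a::finite_field poly \<Rightarrow> 'a poly fract \<Rightarrow> 'a poly fract \<Rightarrow> bool" where
  "cong_localized p x y \<longleftrightarrow>
     x \<in> localization_at p \<and> y \<in> localization_at p \<and>
     (\<exists>z \<in> localization_at p. x - y = to_fract p * z)"


section \<open>The field \<open>\<complex>\<^sub>\<infinity>\<close>\<close>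

definition abs_infinity :: "'a::finite_field fls \<Rightarrow> real" where
  "abs_infinity f = (if f = 0 then 0 else real CARD('a) powi (- fls_subdegree f))"

text \<open>
  A complete field \<open>'c\<close> whose metric comes from an ultrametric absolute value \<open>x \<mapsto> dist x 0\<close>,
  with a field embedding \<open>j\<close> of the algebraic closure of \<open>K\<^sub>\<infinity>\<close> that has dense image and is
  compatible with the absolute value of \<open>K\<^sub>\<infinity>\<close>. This determines \<open>('c, j)\<close> up to isometric
  isomorphism, because the absolute value of \<open>K\<^sub>\<infinity>\<close> extends uniquely to its algebraic closure.
\<close>

locale C_infinity =
  fixes j :: "'a::finite_field fls alg_closure \<Rightarrow> 'c::{field, complete_space}"
  assumes j_one: "j 1 = 1"
    and j_add: "j (x + y) = j x + j y"
    and j_mult: "j (x * y) = j x * j y"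
    and dist_diff: "dist u v = dist (u - v) (0::'c)"
    and dist_mult: "dist (u * v) (0::'c) = dist u 0 * dist v 0"
    and ultrametric: "dist (u + v) (0::'c) \<le> max (dist u 0) (dist v 0)"
    and extends: "dist (j (to_ac f)) 0 = abs_infinity f"
    and dense: "closure (range j) = UNIV"

definition embed_A ::
  "('a::finite_field fls alg_closure \<Rightarrow> 'c::{field, complete_space}) \<Rightarrow> 'a poly \<Rightarrow> 'c" where
  "embed_A j a = j (to_ac (poly (map_poly fls_const a) fls_X_inv))"


section \<open>The series \<open>\<omega>\<close>, \<open>V\<^sub>1\<^sub>,\<^sub>s\<close> and the fractions \<open>\<bool>\<^sub>s\<close>\<close>

text \<open>Throughout, \<open>lam\<close> is the chosen \<open>(q - 1)\<close>-th root of \<open>- \<theta>\<close>.\<close>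

definition carlitz_period ::
  "('a::finite_field fls alg_closure \<Rightarrow> 'c::{field, complete_space}) \<Rightarrow> 'c \<Rightarrow> 'c" where
  "carlitz_period j lam =
     embed_A j theta * lam *
     prodinf (\<lambda>i. inverse (1 - embed_A j theta powi (1 - int (CARD('a) ^ Suc i))))"

text \<open>
  The infinite product is a coefficientwise limit (which is implied by convergence in the
  Gauss norm); the metric on \<open>fps\<close> in the library is the \<open>X\<close>-adic one and is not the right one here.
\<close>

definition omega ::
  "('a::finite_field fls alg_closure \<Rightarrow> 'c::{field, complete_space}) \<Rightarrow> 'c \<Rightarrow> 'c fps" where
  "omega j lam = fps_const lam *
     Abs_fps (\<lambda>n. lim (\<lambda>N. fps_nth
       (\<Prod>i<N. inverse (1 - fps_const (1 / embed_A j theta ^ (CARD('a) ^ i)) * fps_X)) n))"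

text \<open>
  A monomial in the variables \<open>t\<^sub>0, t\<^sub>1, \<dots>\<close> is its exponent vector in \<open>nat \<Rightarrow>\<^sub>0 nat\<close>. A polynomial
  in these variables is an element of \<open>(nat \<Rightarrow>\<^sub>0 nat) \<Rightarrow>\<^sub>0 'b\<close>, with the convolution product; a formal
  power series is its function of coefficients, multiplied by \<open>mps_mult\<close>. The variables
  \<open>t\<^sub>1, \<dots>, t\<^sub>s\<close> of the definition of \<open>V\<^sub>1\<^sub>,\<^sub>s\<close> are numbered \<open>0, \<dots>, s - 1\<close>.
\<close>

definition mps_mult ::
  "((nat \<Rightarrow>\<^sub>0 nat) \<Rightarrow> 'c::comm_ring_1) \<Rightarrow> ((nat \<Rightarrow>\<^sub>0 nat) \<Rightarrow> 'c) \<Rightarrow> (nat \<Rightarrow>\<^sub>0 nat) \<Rightarrow> 'c" where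
  "mps_mult F G m = (\<Sum>(a, b) | a + b = m. F a * G b)"

definition mps_of_fps :: "nat \<Rightarrow> 'c::comm_ring_1 fps \<Rightarrow> (nat \<Rightarrow>\<^sub>0 nat) \<Rightarrow> 'c" where
  "mps_of_fps i f m =
     (if Poly_Mapping.keys m \<subseteq> {i} then fps_nth f (Poly_Mapping.lookup m i) else 0)"

definition mpoly_eval :: "((nat \<Rightarrow>\<^sub>0 nat) \<Rightarrow>\<^sub>0 'b::comm_ring_1) \<Rightarrow> (nat \<Rightarrow> 'b) \<Rightarrow> 'b" where
  "mpoly_eval P x =
     (\<Sum>m\<in>Poly_Mapping.keys P. Poly_Mapping.lookup P m *
        (\<Prod>i\<in>Poly_Mapping.keys m. x i ^ Poly_Mapping.lookup m i))"

definition chi :: "nat \<Rightarrow> 'a::finite_field poly \<Rightarrow> (nat \<Rightarrow>\<^sub>0 nat) \<Rightarrow>\<^sub>0 'a" where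
  "chi i a = (\<Sum>k\<le>Polynomial.degree a. Poly_Mapping.single (Poly_Mapping.single i k) (Polynomial.coeff a k))"

text \<open>As for \<open>omega\<close>, the sum over the degrees \<open>d\<close> is taken coefficientwise.\<close>

definition L_series ::
  "('a::finite_field fls alg_closure \<Rightarrow> 'c::{field, complete_space}) \<Rightarrow> nat \<Rightarrow>
     (nat \<Rightarrow>\<^sub>0 nat) \<Rightarrow> 'c" where
  "L_series j s m =
     suminf (\<lambda>d. \<Sum>a\<in>monics d.
       embed_A j [:Poly_Mapping.lookup (\<Prod>i<s. chi i a) m:] / embed_A j a)"

definition V_series ::
  "('a::finite_field fls alg_closure \<Rightarrow> 'c::{field, complete_space}) \<Rightarrow> 'c \<Rightarrow> nat \<Rightarrow>
     (nat \<Rightarrow>\<^sub>0 nat) \<Rightarrow> 'c" where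
  "V_series j lam s = (\<lambda>m. inverse (carlitz_period j lam) *
     foldr (\<lambda>i F. mps_mult F (mps_of_fps i (omega j lam))) [0..<s] (L_series j s) m)"

text \<open>
  The polynomial over \<open>A\<close> with the same coefficients as \<open>V_series\<close>. It is unique, since
  \<open>embed_A j\<close> is injective; it exists for \<open>s \<ge> 2\<close> and \<open>s \<equiv> 1 (mod q - 1)\<close>.
\<close>

definition V_poly ::
  "('a::finite_field fls alg_closure \<Rightarrow> 'c::{field, complete_space}) \<Rightarrow> 'c \<Rightarrow> nat \<Rightarrow>
     (nat \<Rightarrow>\<^sub>0 nat) \<Rightarrow>\<^sub>0 'a poly" where
  "V_poly j lam s = (THE P. \<forall>m. embed_A j (Poly_Mapping.lookup P m) = V_series j lam s m)"

definition BB ::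
  "('a::finite_field fls alg_closure \<Rightarrow> 'c::{field, complete_space}) \<Rightarrow> 'c \<Rightarrow> nat \<Rightarrow>
     'a poly fract" where
  "BB j lam s =
     to_fract (mpoly_eval (V_poly j lam s) (\<lambda>_. theta)) / to_fract (carlitz_factorial s)"

end

theory Submission
  imports Defs
begin

text \<open>
  Write \<open>t\<close> for the tuple \<open>(t\<^sub>1, \<dots>, t\<^sub>s)\<close>, \<open>L(t)\<close> for the sum of
  \<open>\<chi>\<^sub>t(a) / a\<close> over monic \<open>a\<close>, where \<open>\<chi>\<^sub>t(a) = \<Prod>\<^sub>i a(t\<^sub>i)\<close>, and
  \<open>\<pi>\<close> for the period, so that \<open>V = \<pi>\<^sup>-\<^sup>1 L(t) \<Prod>\<^sub>i \<omega>(t\<^sub>i)\<close>. Raising all coefficients of \<open>V\<close> to the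
  power \<open>q\<^sup>d\<close> does not change \<open>V\<close> modulo a prime \<open>p\<close> of degree \<open>d\<close>, because \<open>a\<^bsup>q^d\<^esup> \<equiv> a\<close>.
  At \<open>t = \<theta>\<close> this twisted series can be evaluated factor by factor. The twist of \<open>L\<close> becomes
  \<open>\<Sum> a\<^sup>s / a\<^bsup>q^d\<^esup>\<close>, which converges since \<open>q\<^sup>d > s\<close> and equals
  \<open>\<pi>\<^bsup>q^d - s\<^esup>\<close> times the coefficient of \<open>z\<^bsup>q^d - s\<^esup>\<close> in \<open>z / exp(z)\<close>. The twist of
  \<open>\<omega>\<close> has lost its pole at \<open>\<theta>\<close> and takes there the value \<open>-\<pi> l\<^bsub>d-1\<^esub>\<close>. So \<open>V(\<theta>, \<dots>, \<theta>)\<close> is congruent to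
  \<open>(-l\<^bsub>d-1\<^esub>)\<^sup>s BC\<^bsub>q^d - s\<^esub> / \<Pi>(q\<^sup>d - s)\<close>
  (\<open>eval_box_twisted_V\<close>, \<open>twisted_V_poly_value\<close>). Dividing by \<open>\<Pi>(s)\<close> and using
  \<open>l\<^bsub>d-1\<^esub>\<^bsup>q^i\<^esup> \<equiv> d\<^sub>i l\<^bsub>d-i-1\<^esub>\<^bsup>q^i\<^esup>\<close>, which is again \<open>\<theta>\<^bsup>q^d\<^esup> \<equiv> \<theta>\<close>
  (\<open>carlitz_l_power_cong\<close>), gives the stated right-hand side.

  The argument needs that \<open>V\<close> is a polynomial over \<open>A\<close>, and this is most of the work. The
  twisted Carlitz operator \<open>T = \<Prod>\<^sub>i (t\<^sub>i - \<theta>) \<cdot> \<tau>\<close> has an exponential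
  \<open>exp\<^sub>\<phi> = \<Sum> T\<^sup>n / d\<^sub>n\<close>, and the functional equation \<open>\<tau>(\<omega>) = (t - \<theta>) \<omega>\<close> turns
  \<open>exp\<^sub>\<phi>(L) = 0\<close> into \<open>exp(\<pi> v) = 0\<close> for every coefficient \<open>v\<close> of \<open>V\<close>. The zeros of
  \<open>exp(\<pi> z)\<close> are exactly the elements of \<open>A\<close> (\<open>exp_zero_imp_integral\<close>), hence \<open>v\<close> is in \<open>A\<close>; and as the
  coefficients of \<open>V\<close> tend to \<open>0\<close>, almost all of them vanish.

  That \<open>exp\<^sub>\<phi>(L) = 0\<close> is an instance of Anderson's log-algebraicity. Group \<open>exp\<^sub>\<phi>(L)\<close> into the
  parts \<open>exp_L_coeff\<close> obtained from \<open>T\<^sup>n\<close> and monics of degree \<open>M - n\<close>. Each part is integral at every prime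
  \<open>p\<close>: comparing \<open>exp\<^sub>\<phi>(p L)\<close> with \<open>\<phi>\<^sub>p(exp\<^sub>\<phi>(L))\<close> gives a Dwork-type recursion modulo \<open>p\<close>
  (\<open>exp_L_coeff_Loc\<close>). An element of \<open>A\<close> of absolute value below \<open>1\<close> is \<open>0\<close>, so only finitely many parts are
  nonzero and their sum is a polynomial in \<open>t\<close>. At \<open>t\<^sub>i = \<theta>\<^bsup>q^k\<^sub>i\<^esup>\<close> the sum is a combination of
  power sums \<open>\<Sum> a\<^sup>w\<close> with positive \<open>w\<close> divisible by \<open>q - 1\<close>. These are the trivial zeros, so
  the polynomial is zero (\<open>sum_exp_L_coeff_eq_0\<close>). The condition on \<open>s\<close> enters here: it makes \<open>w\<close>
  positive and divisible by \<open>q - 1\<close>.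

  Identities between \<open>exp\<close>, \<open>\<pi>\<close> and zeta values are obtained from exact identities for the finite
  sets of polynomials of degree less than \<open>N\<close>, by letting \<open>N\<close> tend to infinity coefficientwise.
\<close>

alias degree = Polynomial.degree
alias coeff = Polynomial.coeff
alias lead_coeff = Polynomial.lead_coeff
alias smult = Polynomial.smult
alias monom = Polynomial.monom
alias lookup = Poly_Mapping.lookup
alias keys = Poly_Mapping.keys
alias single = Poly_Mapping.single


section \<open>The \<open>q\<close>-th power map and power sums over \<open>\<F>\<^sub>q\<close>\<close>

text \<open>
  The polynomial \<open>(X + 1)\<^sup>q - X\<^sup>q - 1\<close> has degree less than \<open>q\<close> and vanishes on all of \<open>\<F>\<^sub>q\<close>. This
  makes the \<open>q\<close>-th power additive without knowing that \<open>q\<close> is a power of the characteristic.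
\<close>

lemma of_nat_card_choose_eq_0:
  assumes "0 < k" "k < CARD('a::finite_field)"
  shows "of_nat (CARD('a) choose k) = (0 :: 'a)"
proof -
  let ?q = "CARD('a)"
  define P :: "'a poly" where "P = [:1, 1:] ^ ?q - monom 1 ?q - 1"
  have coeff: "coeff P i = (if 0 < i \<and> i < ?q then of_nat (?q choose i) else 0)" for i
  proof -
    have "[:1, 1:] ^ ?q = (\<Sum>k\<le>?q. monom (of_nat (?q choose k) :: 'a) k)"
    proof -
      have "[:1, 1::'a:] = monom 1 1 + 1"
        by (simp add: monom_altdef one_pCons)
      then have "[:1, 1::'a:] ^ ?q = (\<Sum>k\<le>?q. of_nat (?q choose k) * monom 1 1 ^ k * 1 ^ (?q - k))"
        by (simp only: binomial_ring)
      also have "\<dots> = (\<Sum>k\<le>?q. monom (of_nat (?q choose k) :: 'a) k)"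
        by (intro sum.cong) (auto simp: monom_power of_nat_poly monom_altdef)
      finally show ?thesis .
    qed
    then have "coeff ([:1, 1::'a:] ^ ?q) i = (if i \<le> ?q then of_nat (?q choose i) else 0)"
      by (simp add: Polynomial.coeff_sum)
    moreover have "?q > 0" by simp
    ultimately show ?thesis
      unfolding P_def by (auto simp: le_less)
  qed
  have "P = 0"
  proof (rule ccontr)
    assume "P \<noteq> 0"
    have "poly P c = 0" for c
      using finite_field_power_card_eq_same[of "1 + c"] finite_field_power_card_eq_same[of c]
      by (simp add: P_def poly_monom)
    then have "card {x. poly P x = 0} = ?q" by simp
    moreover have "card {x. poly P x = 0} \<le> degree P"
      by (rule card_poly_roots_bound) fact
    moreover have "degree P < ?q"
    proof -
      have "degree P \<le> ?q - 1"
        by (rule degree_le) (use coeff in auto)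
      then show ?thesis
        using zero_less_card_finite[where ?'a = 'a] by linarith
    qed
    ultimately show False by simp
  qed
  then show ?thesis using coeff[of k] assms by simp
qed

lemma power_card_add:
  fixes x y :: "'b::comm_ring_1"
  assumes "CHAR('b) = CHAR('a::finite_field)"
  shows "(x + y) ^ (CARD('a) ^ n) = x ^ (CARD('a) ^ n) + y ^ (CARD('a) ^ n)"
proof (induction n)
  case (Suc n)
  have 1: "(u + v) ^ CARD('a) = u ^ CARD('a) + v ^ CARD('a)" for u v :: 'b
  proof -
    have z: "of_nat (CARD('a) choose k) = (0 :: 'b)" if "0 < k" "k < CARD('a)" for k
      using of_nat_card_choose_eq_0[OF that] assms by (simp add: of_nat_eq_0_iff_char_dvd)
    have "(u + v) ^ CARD('a) = (\<Sum>k\<le>CARD('a). of_nat (CARD('a) choose k) * u ^ k * v ^ (CARD('a) - k))"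
      by (rule binomial_ring)
    also have "\<dots> = (\<Sum>k\<in>{0, CARD('a)}. of_nat (CARD('a) choose k) * u ^ k * v ^ (CARD('a) - k))"
      by (intro sum.mono_neutral_right) (auto simp: z)
    also have "\<dots> = u ^ CARD('a) + v ^ CARD('a)"
      by (simp add: add.commute)
    finally show ?thesis .
  qed
  have "(x + y) ^ (CARD('a) ^ Suc n) = ((x + y) ^ (CARD('a) ^ n)) ^ CARD('a)"
    by (simp only: power_Suc2 power_mult)
  also have "\<dots> = x ^ (CARD('a) ^ Suc n) + y ^ (CARD('a) ^ Suc n)"
    by (simp only: Suc 1 power_Suc2 power_mult)
  finally show ?case .
qed simp

lemma of_nat_card_finite_field: "of_nat CARD('a) = (0 :: 'a::finite_field)"
proof -
  have "(\<Sum>c\<in>UNIV. c) = (\<Sum>c\<in>UNIV. c + 1 :: 'a)"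
    by (rule sum.reindex_bij_witness[of _ "\<lambda>c. c + 1" "\<lambda>c. c - 1"]) auto
  also have "\<dots> = (\<Sum>c\<in>UNIV. c) + of_nat CARD('a)"
    by (simp add: sum.distrib)
  finally show ?thesis using add_cancel_right_right by metis
qed

text \<open>
  Some \<open>g \<noteq> 0\<close> has \<open>g\<^sup>k \<noteq> 1\<close>, because \<open>X\<^sup>k - 1\<close> has too few roots; substituting \<open>g c\<close> for \<open>c\<close>
  multiplies the sum by \<open>g\<^sup>k\<close>.
\<close>

lemma sum_power_finite_field_eq_0:
  assumes "k < CARD('a::finite_field) - 1"
  shows "(\<Sum>c\<in>UNIV. c ^ k) = (0 :: 'a)"
proof (cases "k = 0")
  case True
  then show ?thesis by (simp add: of_nat_card_finite_field)
next
  case False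
  have "\<exists>g::'a. g \<noteq> 0 \<and> g ^ k \<noteq> 1"
  proof (rule ccontr)
    assume "\<not> ?thesis"
    then have sub: "UNIV - {0::'a} \<subseteq> {x. poly (monom 1 k - 1 :: 'a poly) x = 0}"
      by (auto simp: poly_monom)
    have nz: "monom 1 k - 1 \<noteq> (0 :: 'a poly)"
    proof
      assume "monom 1 k - 1 = (0 :: 'a poly)"
      then have "coeff (monom 1 k - 1 :: 'a poly) 0 = 0" by simp
      with False show False by simp
    qed
    have "CARD('a) - 1 = card (UNIV - {0::'a})" by (simp add: card_Diff_singleton)
    also have "\<dots> \<le> card {x. poly (monom 1 k - 1 :: 'a poly) x = 0}"
      by (rule card_mono) (use sub in auto)
    also have "\<dots> \<le> degree (monom 1 k - 1 :: 'a poly)"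
      by (rule card_poly_roots_bound) fact
    also have "\<dots> \<le> k"
      by (rule degree_diff_le) (auto simp: degree_monom_le)
    finally show False using assms by simp
  qed
  then obtain g :: 'a where g: "g \<noteq> 0" "g ^ k \<noteq> 1" by blast
  have "(\<Sum>c\<in>UNIV. c ^ k) = (\<Sum>c\<in>UNIV. (g * c) ^ k)"
    by (rule sum.reindex_bij_witness[of _ "\<lambda>c. g * c" "\<lambda>c. c / g"]) (use g in auto)
  also have "\<dots> = g ^ k * (\<Sum>c\<in>UNIV. c ^ k)"
    by (simp add: power_mult_distrib sum_distrib_left)
  finally have "(1 - g ^ k) * (\<Sum>c\<in>UNIV. c ^ k) = 0" by (simp add: algebra_simps)
  with g show ?thesis by simp
qed

lemma carlitz_d_0 [simp]: "carlitz_d 0 = 1"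
  by (simp add: carlitz_d_def)

lemma carlitz_d_Suc:
  "carlitz_d (Suc n) = (theta ^ (CARD('a) ^ Suc n) - theta) * (carlitz_d n :: 'a::finite_field poly) ^ CARD('a)"
proof -
  have f: "(x - y) ^ CARD('a) = x ^ CARD('a) - y ^ CARD('a)" for x y :: "'a poly"
    using power_card_add[where ?'a = 'a and ?'b = "'a poly" and n = 1, of "x - y" y]
    by (simp add: algebra_simps)
  have "carlitz_d (Suc n) = (theta ^ (CARD('a) ^ Suc n) - theta) *
          (\<Prod>i<n. theta ^ (CARD('a) ^ Suc n) - (theta :: 'a poly) ^ (CARD('a) ^ Suc i))"
    unfolding carlitz_d_def prod.lessThan_Suc_shift by simp
  also have "(\<Prod>i<n. theta ^ (CARD('a) ^ Suc n) - (theta :: 'a poly) ^ (CARD('a) ^ Suc i)) =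
     carlitz_d n ^ CARD('a)"
    unfolding carlitz_d_def prod_power_distrib
    by (intro prod.cong) (simp_all only: f power_Suc2 power_mult)
  finally show ?thesis .
qed

lemma carlitz_l_0 [simp]: "carlitz_l 0 = 1"
  by (simp add: carlitz_l_def)

lemma carlitz_l_Suc:
  "carlitz_l (Suc n) = (theta - theta ^ (CARD('a) ^ Suc n)) * (carlitz_l n :: 'a::finite_field poly)"
  unfolding carlitz_l_def by (simp add: algebra_simps)

lemma card_finite_field_ge_2: "CARD('a::finite_field) \<ge> 2"
proof -
  have "card {0, 1::'a} \<le> CARD('a)" by (rule card_mono) auto
  then show ?thesis by simp
qed

text \<open>
  The condition on coefficients, rather than on the degree, keeps \<open>0\<close> in the set also for \<open>N = 0\<close>.
\<close>

definition polys_below :: "nat \<Rightarrow> 'a::zero poly set" where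
  "polys_below N = {a. \<forall>i\<ge>N. coeff a i = 0}"

lemma polys_below_0 [simp]: "polys_below 0 = {0}"
  by (auto simp: polys_below_def poly_eq_iff)

lemma polys_below_Suc: "polys_below (Suc N) = (\<lambda>(c, a). pCons c a) ` (UNIV \<times> polys_below N)"
proof (rule subset_antisym; rule subsetI)
  fix a :: "'a poly" assume a: "a \<in> polys_below (Suc N)"
  obtain c b where cb: "a = pCons c b" by (cases a)
  have "b \<in> polys_below N"
    unfolding polys_below_def
  proof safe
    fix i assume "N \<le> i"
    then show "coeff b i = 0"
      using a cb by (auto simp: polys_below_def dest!: spec[of _ "Suc i"])
  qed
  with cb show "a \<in> (\<lambda>(c, a). pCons c a) ` (UNIV \<times> polys_below N)" by auto
qed (auto simp: polys_below_def coeff_pCons split: nat.splits)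

lemma inj_pCons: "inj_on (\<lambda>(c, a). pCons c a) A"
  by (auto simp: inj_on_def)

lemma finite_polys_below [simp]: "finite (polys_below N :: 'a::{zero,finite} poly set)"
  by (induction N) (simp_all add: polys_below_Suc)

lemma card_polys_below: "card (polys_below N :: 'a::{zero,finite} poly set) = CARD('a) ^ N"
  by (induction N) (simp_all add: polys_below_Suc card_image[OF inj_pCons] card_cartesian_product)

lemma sum_polys_below_Suc:
  "(\<Sum>a\<in>polys_below (Suc N). f a) = (\<Sum>c\<in>UNIV. \<Sum>a\<in>polys_below N. f (pCons c a))"
  for f :: "'a::{zero,finite} poly \<Rightarrow> 'b::comm_monoid_add"
proof -
  have "(\<Sum>a\<in>polys_below (Suc N). f a) = (\<Sum>x\<in>UNIV \<times> polys_below N. (f \<circ> (\<lambda>(c, a). pCons c a)) x)"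
    unfolding polys_below_Suc by (rule sum.reindex[OF inj_pCons])
  then show ?thesis by (simp add: sum.cartesian_product split_def)
qed

lemma polys_below_degree: "a \<in> polys_below N \<longleftrightarrow> a = 0 \<or> degree a < N"
proof
  assume a: "a \<in> polys_below N"
  show "a = 0 \<or> degree a < N"
  proof (rule ccontr)
    assume "\<not> ?thesis"
    then have "a \<noteq> 0" "N \<le> degree a" by auto
    with a show False by (auto simp: polys_below_def)
  qed
qed (auto simp: polys_below_def coeff_eq_0)

lemma finite_monics [simp]: "finite (monics d :: 'a::finite_field poly set)"
  by (rule finite_subset[OF _ finite_polys_below[of "Suc d"]])
     (auto simp: monics_def polys_below_degree)

lemma sum_polys_below_monics:
  fixes f :: "'a::finite_field poly \<Rightarrow> 'b::comm_monoid_add"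
  shows "(\<Sum>a\<in>polys_below N - {0}. f a) = (\<Sum>d<N. \<Sum>a\<in>monics d. \<Sum>c\<in>UNIV - {0}. f (smult c a))"
proof -
  have "(\<Sum>d<N. \<Sum>a\<in>monics d. \<Sum>c\<in>UNIV - {0}. f (smult c a)) =
     (\<Sum>(d, a, c)\<in>(SIGMA d:{..<N}. monics d \<times> (UNIV - {0})). f (smult c a))"
    by (subst sum.Sigma[symmetric], simp, simp, intro sum.cong refl, subst sum.cartesian_product) simp
  also have "\<dots> = (\<Sum>a\<in>polys_below N - {0}. f a)"
    by (rule sum.reindex_bij_witness[of _
          "\<lambda>a. (degree a, smult (inverse (lead_coeff a)) a, lead_coeff a)"
          "\<lambda>(d, a, c). smult c a"])
       (auto simp: polys_below_degree monics_def)
  finally show ?thesis by simp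
qed

lemma inverse_one_minus_const_X:
  "inverse (1 - fps_const c * fps_X) = Abs_fps (\<lambda>n. (c :: 'b::field) ^ n)"
proof (rule fps_inverse_unique)
  show "(1 - fps_const c * fps_X) * Abs_fps (\<lambda>n. c ^ n) = 1"
  proof (rule fps_ext)
    fix n show "fps_nth ((1 - fps_const c * fps_X) * Abs_fps (\<lambda>n. c ^ n)) n = fps_nth 1 n"
      by (cases n) (simp_all add: algebra_simps)
  qed
qed

text \<open>
  The algebra takes place in an arbitrary field containing \<open>A\<close>. It is used twice: for the field \<open>K\<close> of
  fractions and for \<open>\<complex>\<^sub>\<infinity>\<close>.
\<close>

locale poly_embedding =
  fixes q :: nat and emb :: "'a::finite_field poly \<Rightarrow> 'b::field"
  assumes q_def: "q = CARD('a)"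
    and emb_add: "emb (a + b) = emb a + emb b"
    and emb_mult: "emb (a * b) = emb a * emb b"
    and emb_1 [simp]: "emb 1 = 1"
    and emb_nonzero: "a \<noteq> 0 \<Longrightarrow> emb a \<noteq> 0"
begin

lemma emb_0 [simp]: "emb 0 = 0"
  using emb_add[of 0 0] by (simp only: add_0_right add_cancel_right_right)

lemma emb_eq_0_iff [simp]: "emb a = 0 \<longleftrightarrow> a = 0"
  using emb_nonzero by auto

lemma emb_minus: "emb (- a) = - emb a"
  using emb_add[of "- a" a] by (simp add: eq_neg_iff_add_eq_0)

lemma emb_diff: "emb (a - b) = emb a - emb b"
  using emb_add[of a "- b"] by (simp add: emb_minus)

lemma emb_eq_iff [simp]: "emb a = emb b \<longleftrightarrow> a = b"
  using emb_eq_0_iff[of "a - b"] by (simp add: emb_diff)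

lemma emb_power: "emb (a ^ n) = emb a ^ n"
  by (induction n) (simp_all add: emb_mult)

lemma emb_sum: "emb (sum f A) = (\<Sum>x\<in>A. emb (f x))"
  by (induction A rule: infinite_finite_induct) (simp_all add: emb_add)

lemma emb_prod: "emb (prod f A) = (\<Prod>x\<in>A. emb (f x))"
  by (induction A rule: infinite_finite_induct) (simp_all add: emb_mult)

lemma emb_of_nat: "emb (of_nat n) = of_nat n"
  by (induction n) (simp_all add: emb_add)

lemma CHAR_eq: "CHAR('b) = CHAR('a)"
proof (rule CHAR_eqI)
  show "of_nat CHAR('a) = (0 :: 'b)"
    by (simp flip: emb_of_nat add: of_nat_poly)
  show "CHAR('a) dvd n" if "of_nat n = (0 :: 'b)" for n
    using that by (simp flip: emb_of_nat add: of_nat_poly of_nat_eq_0_iff_char_dvd)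
qed

lemma q_ge_2: "q \<ge> 2"
  using card_finite_field_ge_2[where ?'a = 'a] q_def by simp

lemma q_pos [simp]: "q > 0" and q_nonzero [simp]: "q \<noteq> 0"
  using q_ge_2 by simp_all

lemma frob_add: "((x::'b) + y) ^ (q ^ n) = x ^ (q ^ n) + y ^ (q ^ n)"
  using power_card_add[OF CHAR_eq] q_def by simp

lemma frob_0 [simp]: "(0::'b) ^ (q ^ n) = 0"
  by (simp add: power_0_left)

lemma frob_minus: "(- (x::'b)) ^ (q ^ n) = - (x ^ (q ^ n))"
  using frob_add[of x "- x" n] by (simp add: eq_neg_iff_add_eq_0 add.commute)

lemma frob_diff: "((x::'b) - y) ^ (q ^ n) = x ^ (q ^ n) - y ^ (q ^ n)"
  using frob_add[of x "- y" n] by (simp add: frob_minus)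

lemma frob_sum: "(sum f A :: 'b) ^ (q ^ n) = (\<Sum>x\<in>A. f x ^ (q ^ n))"
  by (induction A rule: infinite_finite_induct) (simp_all add: frob_add)

lemma frob_frob: "((x::'b) ^ (q ^ m)) ^ (q ^ n) = x ^ (q ^ (m + n))"
  by (simp add: power_add power_mult[symmetric])

lemma of_nat_q [simp]: "of_nat q = (0 :: 'b)"
proof -
  have "emb (of_nat q) = 0" by (simp add: q_def of_nat_poly of_nat_card_finite_field)
  then show ?thesis by (simp only: emb_of_nat)
qed

definition ec :: "'a \<Rightarrow> 'b" where "ec c = emb [:c:]"

lemma ec_0 [simp]: "ec 0 = 0" and ec_1 [simp]: "ec 1 = 1"
  by (simp_all add: ec_def emb_1[unfolded one_pCons])

lemma ec_add: "ec (c + d) = ec c + ec d"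
  by (simp add: ec_def flip: emb_add)

lemma ec_mult: "ec (c * d) = ec c * ec d"
  by (simp add: ec_def flip: emb_mult)

lemma ec_power: "ec (c ^ n) = ec c ^ n"
  by (induction n) (simp_all add: ec_mult)

lemma ec_sum: "ec (sum f A) = (\<Sum>x\<in>A. ec (f x))"
  by (induction A rule: infinite_finite_induct) (simp_all add: ec_add)

lemma ec_frob [simp]: "ec c ^ (q ^ n) = ec c"
  using finite_field_power_card_power_eq_same[of "q ^ n" n c] by (simp add: q_def flip: ec_power)

lemma ec_eq_0_iff [simp]: "ec c = 0 \<longleftrightarrow> c = 0"
  by (simp add: ec_def)

definition th :: 'b where "th = emb theta"

lemma emb_pCons: "emb (pCons c a) = ec c + th * emb a"
proof -
  have "pCons c a = [:c:] + theta * a" by simp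
  then show ?thesis by (simp only: emb_add emb_mult ec_def th_def)
qed

definition dd :: "nat \<Rightarrow> 'b" where "dd n = emb (carlitz_d n)"
definition ll :: "nat \<Rightarrow> 'b" where "ll n = emb (carlitz_l n)"

lemma dd_0 [simp]: "dd 0 = 1" and ll_0 [simp]: "ll 0 = 1"
  by (simp_all add: dd_def ll_def)

lemma dd_Suc: "dd (Suc n) = (th ^ (q ^ Suc n) - th) * dd n ^ q"
  by (simp add: dd_def carlitz_d_Suc emb_mult emb_diff emb_power th_def q_def del: power_Suc)

lemma ll_Suc: "ll (Suc n) = (th - th ^ (q ^ Suc n)) * ll n"
  by (simp add: ll_def carlitz_l_Suc emb_mult emb_diff emb_power th_def q_def del: power_Suc)

lemma theta_power_inj: "m \<noteq> n \<Longrightarrow> (theta :: 'a poly) ^ m \<noteq> theta ^ n"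
  by (metis degree_power_eq degree_pCons_eq_if degree_0 mult.right_neutral one_neq_zero pCons_eq_0_iff One_nat_def)

lemma th_power_inj: "m \<noteq> n \<Longrightarrow> th ^ m \<noteq> th ^ n"
  using theta_power_inj by (simp add: th_def flip: emb_power)

lemma th_nonzero [simp]: "th \<noteq> 0"
  by (simp add: th_def)

lemma q_power_inj [simp]: "q ^ m = q ^ n \<longleftrightarrow> m = n"
  using q_ge_2 by (intro power_inject_exp) simp

lemma th_frob_inj: "m \<noteq> n \<Longrightarrow> th ^ (q ^ m) \<noteq> th ^ (q ^ n)"
  by (rule th_power_inj) simp

lemma dd_nonzero [simp]: "dd n \<noteq> 0"
proof (induction n)
  case (Suc n)
  then show ?case using th_frob_inj[of "Suc n" 0] by (simp add: dd_Suc del: power_Suc)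
qed simp

lemma ll_nonzero [simp]: "ll n \<noteq> 0"
proof (induction n)
  case (Suc n)
  then show ?case using th_frob_inj[of 0 "Suc n"] by (simp add: ll_Suc del: power_Suc)
qed simp

lemma dd_frob: "m < n \<Longrightarrow> dd (n - m) ^ (q ^ m) = (th ^ (q ^ n) - th ^ (q ^ m)) * dd (n - Suc m) ^ (q ^ Suc m)"
proof -
  assume "m < n"
  then have n: "n - m = Suc (n - Suc m)" by simp
  have "dd (n - m) ^ (q ^ m) = (th ^ (q ^ (n - m)) - th) ^ (q ^ m) * (dd (n - Suc m) ^ q) ^ (q ^ m)"
    by (simp add: n dd_Suc power_mult_distrib del: power_Suc)
  also have "(dd (n - Suc m) ^ q) ^ (q ^ m) = dd (n - Suc m) ^ (q ^ Suc m)"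
    by (simp add: power_mult)
  also have "(th ^ (q ^ (n - m)) - th) ^ (q ^ m) = th ^ (q ^ n) - th ^ (q ^ m)"
    using \<open>m < n\<close> by (simp only: frob_diff frob_frob) simp
  finally show ?thesis .
qed

lemma ll_frob: "j \<le> k \<Longrightarrow> ll (Suc k - j) ^ (q ^ j) = (th ^ (q ^ j) - th ^ (q ^ Suc k)) * ll (k - j) ^ (q ^ j)"
proof -
  assume "j \<le> k"
  then have "Suc k - j = Suc (k - j)" by simp
  then have "ll (Suc k - j) ^ (q ^ j) = (th - th ^ (q ^ Suc (k - j))) ^ (q ^ j) * ll (k - j) ^ (q ^ j)"
    by (simp add: ll_Suc power_mult_distrib del: power_Suc)
  also have "(th - th ^ (q ^ Suc (k - j))) ^ (q ^ j) = th ^ (q ^ j) - th ^ (q ^ Suc k)"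
    using \<open>j \<le> k\<close> by (simp only: frob_diff frob_frob) simp
  finally show ?thesis .
qed

section \<open>Carlitz's binomial polynomials\<close>

text \<open>
  \<open>bin k\<close> is Carlitz's binomial polynomial \<open>e\<^sub>k / d\<^sub>k\<close>, where \<open>e\<^sub>k(z)\<close> is the product of the \<open>z - a\<close>
  over \<open>a\<close> of degree less than \<open>k\<close>. The explicit formula is the divided difference at
  \<open>\<theta>, \<theta>\<^sup>q, \<dots>\<close> of the values \<open>z, z\<^sup>q, \<dots>\<close>, and \<open>bin k a\<close> is both the \<open>k\<close>-th Newton coefficient of
  \<open>a(t)\<close> at these nodes (\<open>newton_expansion\<close>) and the coefficient of \<open>\<tau>\<^sup>k\<close> in the Carlitz module
  \<open>C\<^sub>a\<close> (\<open>exp_functional_equation\<close>).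
\<close>

definition bin :: "nat \<Rightarrow> 'b \<Rightarrow> 'b" where
  "bin k z = (\<Sum>j\<le>k. z ^ (q ^ j) / (dd j * ll (k - j) ^ (q ^ j)))"

lemma bin_0_left [simp]: "bin 0 z = z"
  by (simp add: bin_def)

lemma bin_add: "bin k (x + y) = bin k x + bin k y"
  by (simp add: bin_def frob_add add_divide_distrib sum.distrib)

lemma bin_0 [simp]: "bin k 0 = 0"
  by (simp add: bin_def)

lemma bin_ec: "bin k (ec c * z) = ec c * bin k z"
  by (simp add: bin_def power_mult_distrib sum_distrib_left)

text \<open>
  The two recursions reflect \<open>C\<^bsub>a\<theta>\<^esub> = C\<^sub>a C\<^sub>\<theta>\<close> and \<open>C\<^bsub>\<theta>a\<^esub> = C\<^sub>\<theta> C\<^sub>a\<close>. Their difference determines \<open>bin k 1\<close>, and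
  the first one then determines \<open>bin k\<close> on \<open>A\<close>.
\<close>

lemma bin_Suc_th: "bin (Suc k) (th * z) = th ^ (q ^ Suc k) * bin (Suc k) z + bin k z"
proof -
  have "bin (Suc k) (th * z) - th ^ (q ^ Suc k) * bin (Suc k) z
      = (\<Sum>j\<le>Suc k. (th ^ (q ^ j) - th ^ (q ^ Suc k)) * z ^ (q ^ j) / (dd j * ll (Suc k - j) ^ (q ^ j)))"
    unfolding bin_def sum_distrib_left sum_subtractf[symmetric]
    by (intro sum.cong) (simp_all add: power_mult_distrib algebra_simps diff_divide_distrib del: power_Suc)
  also have "\<dots> = (\<Sum>j\<le>k. (th ^ (q ^ j) - th ^ (q ^ Suc k)) * z ^ (q ^ j) / (dd j * ll (Suc k - j) ^ (q ^ j)))"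
    by simp
  also have "\<dots> = bin k z"
    unfolding bin_def
  proof (intro sum.cong refl)
    fix j assume "j \<in> {..k}"
    then have j: "j \<le> k" by simp
    have "th ^ (q ^ j) - th ^ (q ^ Suc k) \<noteq> 0"
      using th_frob_inj[of j "Suc k"] j by simp
    then show "(th ^ (q ^ j) - th ^ (q ^ Suc k)) * z ^ (q ^ j) / (dd j * ll (Suc k - j) ^ (q ^ j))
        = z ^ (q ^ j) / (dd j * ll (k - j) ^ (q ^ j))"
      unfolding ll_frob[OF j] by (simp add: field_simps del: power_Suc)
  qed
  finally show ?thesis by (simp add: algebra_simps)
qed

lemma bin_Suc_th': "bin (Suc k) (th * z) = th * bin (Suc k) z + bin k z ^ q"
proof -
  have "bin (Suc k) (th * z) - th * bin (Suc k) z
      = (\<Sum>j\<le>Suc k. (th ^ (q ^ j) - th) * z ^ (q ^ j) / (dd j * ll (Suc k - j) ^ (q ^ j)))"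
    unfolding bin_def sum_distrib_left sum_subtractf[symmetric]
    by (intro sum.cong) (simp_all add: power_mult_distrib algebra_simps diff_divide_distrib del: power_Suc)
  also have "\<dots> = (\<Sum>j\<le>k. (th ^ (q ^ Suc j) - th) * z ^ (q ^ Suc j) / (dd (Suc j) * ll (k - j) ^ (q ^ Suc j)))"
    unfolding sum.atMost_Suc_shift by simp
  also have "\<dots> = (\<Sum>j\<le>k. (z ^ (q ^ j) / (dd j * ll (k - j) ^ (q ^ j))) ^ q)"
  proof (intro sum.cong refl)
    fix j
    have "th ^ (q ^ Suc j) - th \<noteq> 0"
      using th_frob_inj[of "Suc j" 0] by simp
    moreover have "x ^ (q ^ Suc j) = (x ^ (q ^ j)) ^ q" for x :: 'b
      by (simp only: power_Suc2 power_mult)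
    ultimately show "(th ^ (q ^ Suc j) - th) * z ^ (q ^ Suc j) / (dd (Suc j) * ll (k - j) ^ (q ^ Suc j)) =
        (z ^ (q ^ j) / (dd j * ll (k - j) ^ (q ^ j))) ^ q"
      unfolding dd_Suc by (simp add: power_divide power_mult_distrib del: power_Suc)
  qed
  also have "\<dots> = bin k z ^ q"
    using frob_sum[of "\<lambda>j. z ^ (q ^ j) / (dd j * ll (k - j) ^ (q ^ j))" "{..k}" 1] by (simp add: bin_def)
  finally show ?thesis by (simp add: algebra_simps)
qed

lemma bin_1: "bin k 1 = (if k = 0 then 1 else 0)"
proof (induction k)
  case (Suc k)
  have "(th ^ (q ^ Suc k) - th) * bin (Suc k) 1 = bin k 1 ^ q - bin k 1"
    using bin_Suc_th[of k 1] bin_Suc_th'[of k 1] by (simp add: algebra_simps)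
  moreover have "bin k 1 ^ q - bin k 1 = 0"
    using Suc q_pos by (simp add: power_0_left)
  moreover have "th ^ (q ^ Suc k) - th \<noteq> 0"
    using th_frob_inj[of "Suc k" 0] by simp
  ultimately show ?case by simp
qed simp

lemma bin_ec_Suc [simp]: "bin (Suc k) (ec c) = 0"
  using bin_ec[of "Suc k" c 1] by (simp add: bin_1)

lemma bin_emb_eq_0:
  assumes "a \<in> polys_below k" shows "bin k (emb a) = 0"
proof -
  have "bin k (emb a) = 0" if "a \<in> polys_below N" "N \<le> k" for N
    using that
  proof (induction N arbitrary: a k)
    case (Suc N)
    from Suc.prems(1) obtain c b where a: "a = pCons c b" "b \<in> polys_below N"
      by (auto simp: polys_below_Suc)
    obtain k' where k: "k = Suc k'" using Suc.prems by (cases k) auto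
    show ?case
      using Suc.IH[OF a(2), of k'] Suc.IH[OF a(2), of k] Suc.prems(2)
      by (simp add: a emb_pCons bin_add bin_Suc_th k)
  qed simp
  with assms show ?thesis by blast
qed

lemma bin_emb_monic:
  assumes "degree a = k" "lead_coeff a = 1" shows "bin k (emb a) = 1"
  using assms
proof (induction k arbitrary: a)
  case 0
  then have "a = 1" by (metis degree_0_id one_pCons)
  then show ?case by simp
next
  case (Suc k)
  obtain c b where a: "a = pCons c b" by (cases a)
  from Suc.prems a have b: "degree b = k" "lead_coeff b = 1"
    by (auto split: if_splits)
  have "b \<in> polys_below (Suc k)" using b by (simp add: polys_below_degree)
  then show ?case
    using Suc.IH[OF b] bin_emb_eq_0[of b "Suc k"] by (simp add: a emb_pCons bin_add bin_Suc_th)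
qed

text \<open>
  This is the coefficient of \<open>\<tau>\<^sup>n\<close> in \<open>exp a = C\<^sub>a exp\<close>. Both sides are \<open>\<F>\<^sub>q\<close>-linear in \<open>a\<close>, and
  multiplying \<open>a\<close> by \<open>\<theta>\<close> multiplies each of them by \<open>\<theta>\<^bsup>q^n\<^esup>\<close>.
\<close>

lemma exp_functional_equation:
  "emb a ^ (q ^ n) / dd n = (\<Sum>k\<le>n. bin k (emb a) / dd (n - k) ^ (q ^ k))"
proof (induction a)
  case 0
  then show ?case by simp
next
  case (pCons c b)
  define A where "A k = bin k (emb b)" for k
  have "(\<Sum>k\<le>n. bin k (emb (pCons c b)) / dd (n - k) ^ (q ^ k))
      = (\<Sum>k\<le>n. bin k (ec c) / dd (n - k) ^ (q ^ k)) + (\<Sum>k\<le>n. bin k (th * emb b) / dd (n - k) ^ (q ^ k))"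
    by (simp add: emb_pCons bin_add add_divide_distrib sum.distrib)
  also have "(\<Sum>k\<le>n. bin k (ec c) / dd (n - k) ^ (q ^ k)) = (\<Sum>k\<in>{0}. bin k (ec c) / dd (n - k) ^ (q ^ k))"
  proof (rule sum.mono_neutral_right)
    show "\<forall>k\<in>{..n} - {0}. bin k (ec c) / dd (n - k) ^ (q ^ k) = 0"
      using bin_ec_Suc by (metis DiffE div_0 insertCI not0_implies_Suc)
  qed auto
  also have "\<dots> = ec c / dd n" by simp
  also have "(\<Sum>k\<le>n. bin k (th * emb b) / dd (n - k) ^ (q ^ k))
      = (\<Sum>k\<le>n. th ^ (q ^ k) * A k / dd (n - k) ^ (q ^ k)) +
        (\<Sum>k\<le>n. (th ^ (q ^ n) - th ^ (q ^ k)) * A k / dd (n - k) ^ (q ^ k))"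
  proof (cases n)
    case 0
    then show ?thesis by (simp add: A_def)
  next
    case (Suc n')
    have "(\<Sum>k\<le>n. bin k (th * emb b) / dd (n - k) ^ (q ^ k)) =
        th * A 0 / dd n + (\<Sum>k\<le>n'. (th ^ (q ^ Suc k) * A (Suc k) + A k) / dd (n - Suc k) ^ (q ^ Suc k))"
      unfolding Suc sum.atMost_Suc_shift by (simp add: A_def bin_Suc_th del: power_Suc)
    also have "\<dots> = (\<Sum>k\<le>n. th ^ (q ^ k) * A k / dd (n - k) ^ (q ^ k)) + (\<Sum>k\<le>n'. A k / dd (n - Suc k) ^ (q ^ Suc k))"
      unfolding Suc sum.atMost_Suc_shift by (simp add: add_divide_distrib sum.distrib del: power_Suc)
    also have "(\<Sum>k\<le>n'. A k / dd (n - Suc k) ^ (q ^ Suc k)) =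
        (\<Sum>k\<le>n'. (th ^ (q ^ n) - th ^ (q ^ k)) * A k / dd (n - k) ^ (q ^ k))"
    proof (intro sum.cong refl)
      fix k assume "k \<in> {..n'}"
      then have k: "k < n" using Suc by simp
      have "th ^ (q ^ n) - th ^ (q ^ k) \<noteq> 0" using th_frob_inj[of n k] k by simp
      then show "A k / dd (n - Suc k) ^ (q ^ Suc k) = (th ^ (q ^ n) - th ^ (q ^ k)) * A k / dd (n - k) ^ (q ^ k)"
        unfolding dd_frob[OF k] by (simp del: power_Suc)
    qed
    also have "\<dots> = (\<Sum>k\<le>n. (th ^ (q ^ n) - th ^ (q ^ k)) * A k / dd (n - k) ^ (q ^ k))"
      unfolding Suc by simp
    finally show ?thesis .
  qed
  also have "\<dots> = th ^ (q ^ n) * (\<Sum>k\<le>n. A k / dd (n - k) ^ (q ^ k))"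
    by (simp add: sum_distrib_left flip: sum.distrib) (simp add: algebra_simps flip: add_divide_distrib)
  also have "(\<Sum>k\<le>n. A k / dd (n - k) ^ (q ^ k)) = emb b ^ (q ^ n) / dd n"
    using pCons.IH by (simp add: A_def)
  finally show ?case
    by (simp add: emb_pCons frob_add power_mult_distrib add_divide_distrib)
qed

text \<open>
  \<open>tp a\<close> is \<open>\<chi>\<^sub>t(a) = a(t)\<close>. The polynomials \<open>bp n\<close> form the Newton basis at the nodes
  \<open>\<theta>, \<theta>\<^sup>q, \<theta>\<^bsup>q^2\<^esup>, \<dots>\<close>; at the same time \<open>bp n\<close> is the factor in \<open>((t - \<theta>) \<tau>)\<^sup>n = bp n \<tau>\<^sup>n\<close>.
\<close>

definition tp :: "'a poly \<Rightarrow> 'b poly" where "tp a = map_poly ec a"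
definition bp :: "nat \<Rightarrow> 'b poly" where "bp n = (\<Prod>i<n. [:- (th ^ (q ^ i)), 1:])"

lemma coeff_tp [simp]: "coeff (tp a) i = ec (coeff a i)"
  by (simp add: tp_def coeff_map_poly)

lemma tp_pCons: "tp (pCons c a) = [:ec c:] + [:0, 1:] * tp a"
  by (rule poly_eqI) (auto simp: coeff_pCons split: nat.splits)

lemma tp_0 [simp]: "tp 0 = 0"
  by (rule poly_eqI) simp

lemma tp_mult: "tp (a * b) = tp a * tp b"
  by (rule poly_eqI) (simp add: coeff_mult ec_sum ec_mult)

lemma bp_0 [simp]: "bp 0 = 1"
  by (simp add: bp_def)

lemma bp_Suc: "bp (Suc n) = bp n * [:- (th ^ (q ^ n)), 1:]"
  by (simp add: bp_def)

lemma poly_tp_th: "poly (tp a) (th ^ (q ^ k)) = emb a ^ (q ^ k)"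
  by (induction a) (simp_all add: tp_pCons emb_pCons frob_add power_mult_distrib)

lemma poly_bp_th: "k < n \<Longrightarrow> poly (bp n) (th ^ (q ^ k)) = 0"
  by (simp add: bp_def poly_prod) (use lessThan_iff in fastforce)

lemma newton_expansion:
  assumes "a \<in> polys_below (Suc N)"
  shows "tp a = (\<Sum>k\<le>N. smult (bin k (emb a)) (bp k))"
  using assms
proof (induction N arbitrary: a)
  case 0
  then obtain c where "a = [:c:]" by (auto simp: polys_below_Suc)
  then show ?case by (simp add: tp_pCons emb_pCons)
next
  case (Suc N)
  then obtain c b where a: "a = pCons c b" and b: "b \<in> polys_below (Suc N)"
    by (auto simp: polys_below_Suc[of "Suc N"])
  define A where "A k = bin k (emb b)" for k
  have IH: "tp b = (\<Sum>k\<le>N. smult (A k) (bp k))"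
    using Suc.IH[OF b] by (simp add: A_def)
  have AN: "A (Suc N) = 0" using bin_emb_eq_0[OF b] by (simp add: A_def)
  \<comment> \<open>multiplication by \<open>t\<close> in the Newton basis, which matches the recursion \<open>bin_Suc_th\<close>\<close>
  have X: "[:0, 1:] * bp k = bp (Suc k) + smult (th ^ (q ^ k)) (bp k)" for k
    by (simp add: bp_Suc algebra_simps)
  have "(\<Sum>k\<le>Suc N. smult (bin k (emb a)) (bp k)) =
     (\<Sum>k\<le>Suc N. smult (bin k (ec c)) (bp k)) + (\<Sum>k\<le>Suc N. smult (bin k (th * emb b)) (bp k))"
    by (simp add: a emb_pCons bin_add smult_add_left sum.distrib)
  also have "(\<Sum>k\<le>Suc N. smult (bin k (ec c)) (bp k)) = [:ec c:]"
    unfolding sum.atMost_Suc_shift by simp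
  also have "(\<Sum>k\<le>Suc N. smult (bin k (th * emb b)) (bp k)) =
     smult (th * A 0) (bp 0) + (\<Sum>k\<le>N. smult (th ^ (q ^ Suc k) * A (Suc k)) (bp (Suc k)))
      + (\<Sum>k\<le>N. smult (A k) (bp (Suc k)))"
    unfolding sum.atMost_Suc_shift
    by (simp add: A_def bin_Suc_th smult_add_left sum.distrib del: power_Suc)
  also have "smult (th * A 0) (bp 0) + (\<Sum>k\<le>N. smult (th ^ (q ^ Suc k) * A (Suc k)) (bp (Suc k)))
      = (\<Sum>k\<le>Suc N. smult (th ^ (q ^ k) * A k) (bp k))"
    unfolding sum.atMost_Suc_shift by simp
  also have "\<dots> = (\<Sum>k\<le>N. smult (th ^ (q ^ k) * A k) (bp k))"
    by (simp add: AN)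
  also have "\<dots> + (\<Sum>k\<le>N. smult (A k) (bp (Suc k))) = [:0, 1:] * tp b"
    unfolding IH sum_distrib_left mult_smult_right X sum.distrib[symmetric]
    by (intro sum.cong) (simp_all add: smult_add_right mult.commute)
  finally show ?case by (simp add: a tp_pCons add.assoc)
qed


section \<open>Product formula and power sums\<close>

definition bin_poly :: "nat \<Rightarrow> 'b poly" where
  "bin_poly k = (\<Sum>j\<le>k. monom (1 / (dd j * ll (k - j) ^ (q ^ j))) (q ^ j))"

lemma poly_bin_poly: "poly (bin_poly k) z = bin k z"
  by (simp add: bin_poly_def bin_def poly_sum poly_monom)

lemma coeff_bin_poly:
  "coeff (bin_poly k) i = (\<Sum>j\<le>k. if q ^ j = i then 1 / (dd j * ll (k - j) ^ (q ^ j)) else 0)"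
  by (simp add: bin_poly_def Polynomial.coeff_sum)

text \<open>
  Both sides are monic of degree \<open>q\<^sup>N\<close> and vanish on the \<open>q\<^sup>N\<close> polynomials of degree less than \<open>N\<close>.
\<close>

lemma prod_polys_below: "smult (dd N) (bin_poly N) = (\<Prod>a\<in>polys_below N. [:- emb a, 1:])"
proof -
  let ?P = "smult (dd N) (bin_poly N)"
  let ?Q = "\<Prod>a\<in>polys_below N. [:- emb a, 1:]"
  have degQ: "degree ?Q = q ^ N"
    by (subst degree_prod_eq_sum_degree) (simp_all add: card_polys_below q_def)
  have lcQ: "coeff ?Q (q ^ N) = 1"
    using lead_coeff_prod[of "\<lambda>a. [:- emb a, 1:]" "polys_below N"] by (simp add: degQ)
  have degP: "degree ?P \<le> q ^ N"
  proof (rule degree_le, intro allI impI)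
    fix i assume i: "q ^ N < i"
    have "q ^ j \<noteq> i" if "j \<le> N" for j
    proof -
      have "q ^ j \<le> q ^ N" by (rule power_increasing[OF that]) (use q_pos in linarith)
      with i show ?thesis by simp
    qed
    then show "coeff ?P i = 0" by (simp add: coeff_bin_poly)
  qed
  have lcP: "coeff ?P (q ^ N) = 1"
    by (simp add: coeff_bin_poly)
  have deg: "degree (?P - ?Q) < q ^ N"
  proof -
    have "degree (?P - ?Q) \<le> q ^ N - 1"
    proof (rule degree_le, intro allI impI)
      fix i assume "q ^ N - 1 < i"
      then have "i = q ^ N \<or> q ^ N < i" by linarith
      then show "coeff (?P - ?Q) i = 0"
        using lcP lcQ degP degQ by (auto simp: coeff_eq_0)
    qed
    then show ?thesis using q_pos by (metis Suc_pred' less_Suc_eq_le zero_less_power)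
  qed
  have "?P - ?Q = 0"
  proof (rule ccontr)
    assume nz: "?P - ?Q \<noteq> 0"
    have "emb ` polys_below N \<subseteq> {z. poly (?P - ?Q) z = 0}"
      by (auto simp: poly_bin_poly bin_emb_eq_0 poly_prod)
    then have "card (emb ` polys_below N) \<le> card {z. poly (?P - ?Q) z = 0}"
      by (intro card_mono poly_roots_finite nz)
    also have "\<dots> \<le> degree (?P - ?Q)"
      by (rule card_poly_roots_bound[OF nz])
    finally show False
      using deg by (simp add: card_image inj_on_def card_polys_below q_def)
  qed
  then show ?thesis by simp
qed

lemma dd_bin_eq_prod:
  "dd N * bin N z = (\<Prod>a\<in>polys_below N. z - emb a)"
  using arg_cong[OF prod_polys_below[of N], of "\<lambda>P. poly P z"]
  by (simp add: poly_bin_poly poly_prod)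

lemma ll_bin_poly: "smult (ll N) (bin_poly N) = [:0, 1:] * (\<Prod>a\<in>polys_below N - {0}. [:1, - 1 / emb a:])"
proof -
  define c where "c = (\<Prod>a\<in>polys_below N - {0}. - emb a)"
  define R where "R = (\<Prod>a\<in>polys_below N - {0}. [:1, - 1 / emb a:])"
  have z: "0 \<in> polys_below N" by (simp add: polys_below_def)
  have "smult (dd N) (bin_poly N) = [:0, 1:] * (\<Prod>a\<in>polys_below N - {0}. [:- emb a, 1:])"
    unfolding prod_polys_below by (subst prod.remove[OF _ z]) simp_all
  also have "(\<Prod>a\<in>polys_below N - {0}. [:- emb a, 1:]) = (\<Prod>a\<in>polys_below N - {0}. smult (- emb a) [:1, - 1 / emb a:])"
    by (intro prod.cong) auto
  also have "\<dots> = smult c R"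
    unfolding c_def R_def by (simp only: prod_smult)
  finally have eq: "smult (dd N) (bin_poly N) = [:0, 1:] * smult c R" .
  have R0: "coeff R 0 = 1"
    by (simp add: R_def poly_0_coeff_0[symmetric] poly_prod)
  have "coeff (bin_poly N) 1 = (\<Sum>j\<le>N. if j = 0 then 1 / (dd j * ll (N - j) ^ (q ^ j)) else 0)"
    unfolding coeff_bin_poly using q_ge_2 by (intro sum.cong) auto
  then have c1: "coeff (bin_poly N) 1 = 1 / ll N"
    by simp
  have "dd N / ll N = c"
    using arg_cong[OF eq, of "\<lambda>P. coeff P 1"] c1 R0 by simp
  moreover have c: "c \<noteq> 0" by (simp add: c_def)
  ultimately have "1 / c * dd N = ll N" by (auto simp: field_simps)
  then have "smult (ll N) (bin_poly N) = smult (1 / c * dd N) (bin_poly N)"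
    by simp
  also have "\<dots> = smult (1 / c) ([:0, 1:] * smult c R)"
    by (simp only: eq[symmetric] smult_smult)
  also from c have "smult (1 / c) ([:0, 1:] * smult c R) = [:0, 1:] * R"
    by simp
  finally show ?thesis by (simp add: R_def)
qed

lemma ll_bin_eq_prod: "ll N * bin N z = z * (\<Prod>a\<in>polys_below N - {0}. 1 - z / emb a)"
  using arg_cong[OF ll_bin_poly[of N], of "\<lambda>P. poly P z"]
  by (simp add: poly_bin_poly poly_prod)

text \<open>
  The polynomial \<open>l\<^sub>N bin N(z) / z\<close>. For \<open>N \<rightarrow> \<infinity>\<close> it tends to \<open>exp(\<pi> z) / (\<pi> z)\<close>, hence the name.
\<close>

definition exp_trunc :: "nat \<Rightarrow> 'b fps" where
  "exp_trunc N = (\<Sum>j\<le>N. fps_const (ll N / (dd j * ll (N - j) ^ (q ^ j))) * fps_X ^ (q ^ j - 1))"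

lemma X_exp_trunc: "fps_X * exp_trunc N = fps_of_poly (smult (ll N) (bin_poly N))"
proof -
  have "fps_X * (fps_const c * fps_X ^ (q ^ j - 1)) = fps_of_poly (monom c (q ^ j))" for c :: 'b and j
  proof -
    have "q ^ j = Suc (q ^ j - 1)" by simp
    then show ?thesis
      by (metis (no_types, lifting) fps_of_poly_monom mult.left_commute power_Suc)
  qed
  note * = this
  show ?thesis
    unfolding exp_trunc_def sum_distrib_left *
    by (simp only: exp_trunc_def bin_poly_def sum_distrib_left fps_of_poly_sum fps_of_poly_smult)
       (simp add: fps_of_poly_monom mult.assoc[symmetric])
qed

lemma exp_trunc_prod: "exp_trunc N = (\<Prod>a\<in>polys_below N - {0}. 1 - fps_const (1 / emb a) * fps_X)"
proof -
  have "fps_X * exp_trunc N = fps_X * (\<Prod>a\<in>polys_below N - {0}. 1 - fps_const (1 / emb a) * fps_X)"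
    unfolding X_exp_trunc ll_bin_poly fps_of_poly_mult fps_of_poly_prod
    by (simp add: fps_of_poly_pCons algebra_simps fps_const_neg[symmetric] del: fps_const_neg)
  then show ?thesis by simp
qed

lemma fps_nth_0_prod: "fps_nth (prod f A) 0 = (\<Prod>a\<in>A. fps_nth (f a :: 'b fps) 0)"
  by (induction A rule: infinite_finite_induct) simp_all

lemma fps_deriv_prod_linear:
  assumes "finite A"
  shows "fps_deriv (\<Prod>a\<in>A. 1 - fps_const (f a) * fps_X) =
     (\<Prod>a\<in>A. 1 - fps_const (f a) * fps_X) * (\<Sum>a\<in>A. - fps_const (f a) * inverse (1 - fps_const (f a) * fps_X :: 'b fps))"
  using assms
proof (induction A rule: finite_induct)
  case (insert x A)
  have "(1 - fps_const (f x) * fps_X) * inverse (1 - fps_const (f x) * fps_X) = 1"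
    by (intro inverse_mult_eq_1') simp
  then have "- c * P + u * (P * S) = u * P * (- c * inverse u + S)"
    if u: "u = 1 - fps_const (f x) * fps_X" for u c P S :: "'b fps"
  proof -
    assume "(1 - fps_const (f x) * fps_X) * inverse (1 - fps_const (f x) * fps_X) = 1"
    then have 1: "u * inverse u = 1" by (simp only: u)
    have "u * P * (- c * inverse u + S) = - c * P * (u * inverse u) + u * (P * S)"
      by (simp only: algebra_simps)
    then show ?thesis by (simp only: 1 mult_1_right)
  qed
  note * = this[OF refl, of "fps_const (f x)"]
  show ?case
    unfolding prod.insert[OF insert.hyps] sum.insert[OF insert.hyps]
    by (subst *[symmetric]) (simp add: insert.IH fps_deriv_mult)
qed simp

text \<open>
  Logarithmic differentiation: the derivative of \<open>z exp_trunc N\<close> is \<open>1\<close>, because all its exponents are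
  powers of \<open>q\<close>, and \<open>exp_trunc N\<close> is a product over the nonzero polynomials of degree less than \<open>N\<close>.
\<close>

lemma power_sum_below:
  assumes "n > 0"
  shows "fps_nth (inverse (exp_trunc N)) n = - (\<Sum>a\<in>polys_below N - {0}. 1 / emb a ^ n)"
proof -
  let ?A = "polys_below N - {0} :: 'a poly set"
  let ?R = "exp_trunc N"
  define S where "S = (\<Sum>a\<in>?A. - fps_const (1 / emb a) * inverse (1 - fps_const (1 / emb a) * fps_X :: 'b fps))"
  have R': "fps_deriv ?R = ?R * S"
    unfolding exp_trunc_prod S_def by (rule fps_deriv_prod_linear) simp
  have nz: "fps_nth ?R 0 \<noteq> 0"
    unfolding exp_trunc_prod by (simp add: fps_nth_0_prod)
  have "fps_deriv (fps_X * ?R) = 1"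
  proof (rule fps_ext)
    fix i
    have "of_nat (Suc i) * (if q ^ j = Suc i then x else 0) = (if i = 0 \<and> j = 0 then x else 0)" for j and x :: 'b
    proof (cases j)
      case (Suc j')
      then have "of_nat (q ^ j) = (0 :: 'b)" by simp
      then have "q ^ j = Suc i \<Longrightarrow> of_nat (Suc i) = (0 :: 'b)" by metis
      then show ?thesis using Suc by (simp del: of_nat_Suc power_Suc)
    qed auto
    then show "fps_nth (fps_deriv (fps_X * ?R)) i = fps_nth 1 i"
      unfolding X_exp_trunc
      by (simp add: coeff_bin_poly sum_distrib_left mult.left_commute[of _ "ll N"] del: of_nat_Suc)
         (simp flip: sum_distrib_left)
  qed
  then have "?R * (1 + fps_X * S) = 1"
    by (simp add: R' algebra_simps)
  then have "inverse ?R = 1 + fps_X * S"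
    using nz by (metis fps_inverse_unique)
  then have "fps_nth (inverse ?R) n = fps_nth S (n - 1)"
    using assms by simp
  also have "\<dots> = (\<Sum>a\<in>?A. - (1 / emb a) * (1 / emb a) ^ (n - 1))"
  proof -
    show ?thesis by (simp add: S_def fps_sum_nth inverse_one_minus_const_X fps_const_neg[symmetric] del: fps_const_neg)
  qed
  also have "\<dots> = - (\<Sum>a\<in>?A. 1 / emb a ^ n)"
    unfolding sum_negf[symmetric]
    using assms by (intro sum.cong) (simp_all add: power_one_over flip: power_Suc)
  finally show ?thesis .
qed

lemma ec_unit_power: "c \<noteq> 0 \<Longrightarrow> (q - 1) dvd n \<Longrightarrow> ec c ^ n = 1"
proof -
  assume c: "c \<noteq> 0" and "(q - 1) dvd n"
  then obtain m where n: "n = (q - 1) * m" by blast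
  have "ec c * ec c ^ (q - 1) = ec c ^ (q ^ 1)"
    using q_pos by (simp flip: power_Suc)
  then have "ec c * ec c ^ (q - 1) = ec c * 1" by (simp only: ec_frob mult_1_right)
  then have "ec c ^ (q - 1) = 1" using c by simp
  then show ?thesis by (simp add: n power_mult)
qed

lemma sum_below_eq_neg_sum_monics:
  fixes f :: "'a poly \<Rightarrow> 'b"
  assumes "\<And>a c. c \<noteq> 0 \<Longrightarrow> f (smult c a) = f a"
  shows "(\<Sum>a\<in>polys_below N - {0}. f a) = - (\<Sum>d<N. \<Sum>a\<in>monics d. f a)"
proof -
  have "(\<Sum>c\<in>UNIV - {0::'a}. x) = - x" for x :: 'b
  proof -
    have "1 + of_nat (q - 1) = (of_nat q :: 'b)"
      using q_pos by (metis Suc_pred' of_nat_Suc One_nat_def)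
    then have "of_nat (q - 1) = (- 1 :: 'b)"
      by (simp only: of_nat_q add_eq_0_iff)
    then show ?thesis by (simp add: card_Diff_singleton q_def[symmetric] del: One_nat_def)
  qed
  then show ?thesis
    by (simp add: sum_polys_below_monics assms sum_negf)
qed

lemma emb_smult: "emb (smult c a) = ec c * emb a"
proof -
  have "smult c a = [:c:] * a" by simp
  then show ?thesis by (simp only: emb_mult ec_def)
qed

lemma monic_power_sum:
  assumes "n > 0" "(q - 1) dvd n"
  shows "(\<Sum>d<N. \<Sum>a\<in>monics d. 1 / emb a ^ n) = fps_nth (inverse (exp_trunc N)) n"
  unfolding power_sum_below[OF assms(1)]
  by (subst sum_below_eq_neg_sum_monics)
     (use ec_unit_power[OF _ assms(2)] in \<open>simp_all add: emb_smult power_mult_distrib\<close>)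

text \<open>
  Split off the constant coefficient \<open>c\<close> of \<open>a\<close> and expand binomially. The sum of \<open>c\<^sup>k\<close> over \<open>\<F>\<^sub>q\<close>
  vanishes for \<open>k < q - 1\<close>; for larger \<open>k\<close> the exponent that is left has dropped by at least \<open>q - 1\<close>.
\<close>

lemma positive_power_sum_eq_0:
  assumes "w < N * (q - 1)"
  shows "(\<Sum>a\<in>polys_below N. emb a ^ w) = 0"
  using assms
proof (induction N arbitrary: w)
  case (Suc N)
  have "(\<Sum>a\<in>polys_below (Suc N). emb a ^ w) =
     (\<Sum>c\<in>UNIV. \<Sum>a\<in>polys_below N. \<Sum>k\<le>w. of_nat (w choose k) * ec c ^ k * (th * emb a) ^ (w - k))"
    unfolding sum_polys_below_Suc emb_pCons binomial_ring ..
  also have "\<dots> = (\<Sum>k\<le>w. \<Sum>c\<in>UNIV. \<Sum>a\<in>polys_below N. of_nat (w choose k) * ec c ^ k * (th * emb a) ^ (w - k))"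
    by (subst (2) sum.swap, subst sum.swap) (rule refl)
  also have "\<dots> = (\<Sum>k\<le>w. of_nat (w choose k) * th ^ (w - k) * ((\<Sum>c\<in>UNIV. ec c ^ k) * (\<Sum>a\<in>polys_below N. emb a ^ (w - k))))"
    by (intro sum.cong refl, subst sum_product, subst sum_distrib_left, subst sum_distrib_left)
       (simp add: power_mult_distrib mult_ac)
  also have "\<dots> = 0"
  proof (intro sum.neutral ballI)
    fix k assume k: "k \<in> {..w}"
    show "of_nat (w choose k) * th ^ (w - k) * ((\<Sum>c\<in>UNIV. ec c ^ k) * (\<Sum>a\<in>polys_below N. emb a ^ (w - k))) = 0"
    proof (cases "k < q - 1")
      case True
      then have "(\<Sum>c\<in>(UNIV :: 'a set). c ^ k) = 0"
        using sum_power_finite_field_eq_0[where ?'a = 'a, of k] by (simp add: q_def)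
      then have "ec (\<Sum>c\<in>(UNIV :: 'a set). c ^ k) = 0" by simp
      then show ?thesis by (simp add: ec_sum ec_power)
    next
      case False
      then have "w - k < N * (q - 1)" using Suc.prems k by auto
      then show ?thesis by (simp add: Suc.IH)
    qed
  qed
  finally show ?case .
qed simp

lemma trivial_zero:
  assumes "w > 0" "(q - 1) dvd w" "w < N * (q - 1)"
  shows "(\<Sum>d<N. \<Sum>a\<in>monics d. emb a ^ w) = 0"
proof -
  have "- (\<Sum>d<N. \<Sum>a\<in>monics d. emb a ^ w) = (\<Sum>a\<in>polys_below N - {0}. emb a ^ w)"
    by (rule sum_below_eq_neg_sum_monics[symmetric])
       (use ec_unit_power[OF _ assms(2)] in \<open>simp add: emb_smult power_mult_distrib\<close>)
  also have "\<dots> = (\<Sum>a\<in>polys_below N. emb a ^ w)"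
    by (rule sum.mono_neutral_left) (use assms in auto)
  also have "\<dots> = 0" by (rule positive_power_sum_eq_0[OF assms(3)])
  finally show ?thesis by simp
qed

end

section \<open>Power series in several variables, one variable at a time\<close>

text \<open>
  A series in \<open>t\<^sub>0, t\<^sub>1, \<dots>\<close> is its function of coefficients. All multipliers that occur are products of
  series in one variable, so only the operator of multiplication by \<open>g(t\<^sub>i)\<close> is needed. Fixing all exponents but
  the \<open>i\<close>-th reduces it to the product of power series in one variable.
\<close>

definition mult_var :: "nat \<Rightarrow> 'b::comm_ring_1 fps \<Rightarrow> ((nat \<Rightarrow> nat) \<Rightarrow> 'b) \<Rightarrow> (nat \<Rightarrow> nat) \<Rightarrow> 'b" where
  "mult_var i g F m = fps_nth (g * Abs_fps (\<lambda>n. F (m(i := n)))) (m i)"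

primrec mult_vars :: "nat \<Rightarrow> 'b::comm_ring_1 fps \<Rightarrow> ((nat \<Rightarrow> nat) \<Rightarrow> 'b) \<Rightarrow> (nat \<Rightarrow> nat) \<Rightarrow> 'b" where
  "mult_vars 0 g F = F"
| "mult_vars (Suc s) g F = mult_vars s g (mult_var s g F)"

lemma mult_var_altdef: "mult_var i g F m = (\<Sum>k\<le>m i. fps_nth g k * F (m(i := m i - k)))"
  by (simp add: mult_var_def fps_mult_nth atLeast0AtMost)

lemma mult_var_one [simp]: "mult_var i 1 F = F"
  by (rule ext) (simp add: mult_var_def)

lemma mult_var_mult_var: "mult_var i g (mult_var i h F) = mult_var i (g * h) F"
proof
  fix m
  have "Abs_fps (\<lambda>n. mult_var i h F (m(i := n))) = h * Abs_fps (\<lambda>n. F (m(i := n)))"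
    by (rule fps_ext) (simp add: mult_var_def)
  then show "mult_var i g (mult_var i h F) m = mult_var i (g * h) F m"
    by (simp add: mult_var_def[of i g] mult_var_def[of i "g * h"] mult.assoc)
qed

lemma mult_var_commute: "i \<noteq> j \<Longrightarrow> mult_var i g (mult_var j h F) = mult_var j h (mult_var i g F)"
  by (rule ext, simp add: mult_var_altdef sum_distrib_left fun_upd_twist[of i j], subst sum.swap)
     (simp add: mult.left_commute)

lemma mult_var_mult_vars_commute: "s \<le> i \<Longrightarrow> mult_var i g (mult_vars s h F) = mult_vars s h (mult_var i g F)"
  by (induction s arbitrary: F) (simp_all add: mult_var_commute)

lemma mult_vars_one [simp]: "mult_vars s 1 F = F"
  by (induction s) simp_all

lemma mult_vars_mult_vars: "mult_vars s g (mult_vars s h F) = mult_vars s (g * h) F"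
  by (induction s arbitrary: F) (simp_all add: mult_var_mult_vars_commute mult_var_mult_var)

lemma mult_var_sum:
  "mult_var i g (\<lambda>m. \<Sum>x\<in>A. c x * F x m) m = (\<Sum>x\<in>A. c x * mult_var i g (F x) m)"
  by (simp add: mult_var_altdef sum_distrib_left mult_ac, subst sum.swap) (rule refl)

lemma mult_vars_sum:
  "mult_vars s g (\<lambda>m. \<Sum>x\<in>A. c x * F x m) m = (\<Sum>x\<in>A. c x * mult_vars s g (F x) m)"
proof (induction s arbitrary: F m)
  case (Suc s)
  have "mult_var s g (\<lambda>m. \<Sum>x\<in>A. c x * F x m) = (\<lambda>m. \<Sum>x\<in>A. c x * mult_var s g (F x) m)"
    by (rule ext) (rule mult_var_sum)
  then show ?case by (simp add: Suc.IH)
qed simp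

lemma mult_vars_add: "mult_vars s g (\<lambda>m. F m + G m) m = mult_vars s g F m + mult_vars s g G m"
  using mult_vars_sum[of s g "\<lambda>_. 1" "\<lambda>x. if x then F else G" UNIV m] by (simp add: UNIV_bool add.commute)

lemma mult_vars_cmult: "mult_vars s g (\<lambda>m. c * F m) m = c * mult_vars s g F m"
  using mult_vars_sum[of s g "\<lambda>_. c" "\<lambda>_. F" "{0::nat}" m] by simp

lemma mult_vars_diff: "mult_vars s g (\<lambda>m. F m - G m) m = mult_vars s g F m - mult_vars s g G m"
  using mult_vars_add[of s g F "\<lambda>m. - 1 * G m" m] mult_vars_cmult[of s g "-1" G m] by simp

lemma mult_vars_const: "mult_vars s (fps_const c * g) F m = c ^ s * mult_vars s g F m"
proof (induction s arbitrary: F m)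
  case (Suc s)
  have "mult_var s (fps_const c * g) F = (\<lambda>m. c * mult_var s g F m)"
    by (rule ext) (simp add: mult_var_def mult.assoc)
  then show ?case by (simp add: Suc.IH mult_vars_cmult)
qed simp

lemma mult_var_closed:
  assumes "0 \<in> C" "\<And>x y. x \<in> C \<Longrightarrow> y \<in> C \<Longrightarrow> x + y \<in> C"
    and "\<And>k m. fps_nth g k * F m \<in> C"
  shows "mult_var i g F m \<in> C"
proof -
  have "(\<Sum>k\<in>A. fps_nth g k * F (m(i := m i - k))) \<in> C" for A
    by (induction A rule: infinite_finite_induct) (simp_all add: assms)
  then show ?thesis by (simp add: mult_var_altdef)
qed

lemma mult_vars_closed:
  assumes "0 \<in> C" "\<And>x y. x \<in> C \<Longrightarrow> y \<in> C \<Longrightarrow> x + y \<in> C"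
    and "\<And>k x. x \<in> C \<Longrightarrow> fps_nth g k * x \<in> C" and "\<And>m. F m \<in> C"
  shows "mult_vars s g F m \<in> C"
  using assms(4)
proof (induction s arbitrary: F)
  case (Suc s)
  have "mult_var s g F m \<in> C" for m
    by (rule mult_var_closed) (use assms Suc.prems in auto)
  then show ?case using Suc.IH by simp
qed simp

text \<open>
  The product \<open>\<Prod>\<^sub>i\<^sub><\<^sub>s h\<^sub>i(t\<^sub>i)\<close>.
\<close>

definition tensor :: "nat \<Rightarrow> (nat \<Rightarrow> 'b::comm_ring_1 fps) \<Rightarrow> (nat \<Rightarrow> nat) \<Rightarrow> 'b" where
  "tensor s h m = (if \<forall>i\<ge>s. m i = 0 then \<Prod>i<s. fps_nth (h i) (m i) else 0)"

lemma mult_var_tensor: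
  assumes "i < s"
  shows "mult_var i g (tensor s h) = tensor s (h(i := g * h i))"
proof
  fix m
  show "mult_var i g (tensor s h) m = tensor s (h(i := g * h i)) m"
  proof (cases "\<forall>i\<ge>s. m i = 0")
    case True
    have i: "i \<in> {..<s}" using assms by simp
    have supp: "\<forall>i'\<ge>s. (m(i := n)) i' = 0" for n using True assms by simp
    define P where "P = (\<Prod>i'\<in>{..<s} - {i}. fps_nth (h i') (m i'))"
    have *: "tensor s h (m(i := n)) = fps_nth (h i) n * P" for n
      unfolding tensor_def using supp
      by (simp add: prod.remove[OF _ i] P_def)
    have "mult_var i g (tensor s h) m = (\<Sum>k\<le>m i. fps_nth g k * fps_nth (h i) (m i - k)) * P"
      by (simp add: mult_var_altdef * sum_distrib_right mult.assoc)
    also have "\<dots> = fps_nth (g * h i) (m i) * P"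
      by (simp add: fps_mult_nth atLeast0AtMost)
    also have "\<dots> = tensor s (h(i := g * h i)) m"
      unfolding tensor_def using True by (simp add: prod.remove[OF _ i] P_def)
    finally show ?thesis .
  next
    case False
    then have *: "\<not> (\<forall>i'\<ge>s. (m(i := n)) i' = 0)" for n using assms by auto
    have "tensor s h (m(i := n)) = 0" for n
      unfolding tensor_def by (rule if_not_P) (rule *)
    moreover have "tensor s (h(i := g * h i)) m = 0"
      unfolding tensor_def by (rule if_not_P) (rule False)
    ultimately show ?thesis by (simp add: mult_var_altdef)
  qed
qed

lemma mult_vars_tensor_aux:
  "t \<le> s \<Longrightarrow> mult_vars t g (tensor s h) = tensor s (\<lambda>i. if i < t then g * h i else h i)"
proof (induction t arbitrary: h)
  case (Suc t)
  have "(\<lambda>i. if i < t then g * (h(t := g * h t)) i else (h(t := g * h t)) i) =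
      (\<lambda>i. if i < Suc t then g * h i else h i)"
    by (auto simp: less_Suc_eq)
  with Suc show ?case by (simp add: mult_var_tensor)
qed simp

lemma tensor_cong: "(\<And>i. i < s \<Longrightarrow> h i = h' i) \<Longrightarrow> tensor s h = tensor s h'"
  unfolding tensor_def by (intro ext if_cong prod.cong) auto

lemma mult_vars_tensor: "mult_vars s g (tensor s h) = tensor s (\<lambda>i. g * h i)"
  by (simp add: mult_vars_tensor_aux) (rule tensor_cong, simp)

lemma sum_triangle:
  "(\<Sum>k\<le>M. \<Sum>n\<le>M - k. f k n) = (\<Sum>N\<le>M. \<Sum>k\<le>N. f k (N - k))" for M :: nat
  unfolding sum.Sigma[OF finite_atMost ballI[OF finite_atMost]]
  by (rule sum.reindex_bij_witness[of _ "\<lambda>(N, k). (k, N - k)" "\<lambda>(k, n). (k + n, k)"]) auto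

definition box :: "nat \<Rightarrow> nat \<Rightarrow> (nat \<Rightarrow> nat) set" where
  "box s D = {m. (\<forall>i<s. m i \<le> D) \<and> (\<forall>i\<ge>s. m i = 0)}"

text \<open>
  The value at \<open>x\<close> of a polynomial whose exponents are at most \<open>D\<close>. The summation set is explicit
  because the coefficient functions do not carry their support.
\<close>

definition eval_box :: "nat \<Rightarrow> nat \<Rightarrow> (nat \<Rightarrow> 'b::comm_ring_1) \<Rightarrow> ((nat \<Rightarrow> nat) \<Rightarrow> 'b) \<Rightarrow> 'b" where
  "eval_box s D x F = (\<Sum>m\<in>box s D. F m * (\<Prod>i<s. x i ^ m i))"

lemma box_0: "box 0 D = {\<lambda>_. 0}"
  by (auto simp: box_def)

lemma box_Suc: "box (Suc s) D = (\<lambda>(k, m). m(s := k)) ` ({..D} \<times> box s D)"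
proof (rule subset_antisym; rule subsetI)
  fix m assume m: "m \<in> box (Suc s) D"
  have "m(s := 0) \<in> box s D"
    unfolding box_def
  proof (intro CollectI conjI allI impI)
    fix i assume "i \<ge> s"
    then show "(m(s := 0)) i = 0" using m by (cases "i = s") (auto simp: box_def)
  qed (use m in \<open>auto simp: box_def\<close>)
  moreover have "m s \<le> D" using m by (simp add: box_def)
  ultimately show "m \<in> (\<lambda>(k, m). m(s := k)) ` ({..D} \<times> box s D)"
    by (intro image_eqI[of _ _ "(m s, m(s := 0))"]) auto
qed (auto simp: box_def less_Suc_eq)

lemma box_inj: "inj_on (\<lambda>(k, m). m(s := k)) ({..D} \<times> box s D)"
proof (rule inj_onI, clarify)
  fix k m k' m'
  assume "m \<in> box s D" "m' \<in> box s D" and eq: "m(s := k) = m'(s := k')"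
  then have "m s = m' s" by (simp add: box_def)
  then have "m = m'" using eq by (metis fun_upd_triv fun_upd_upd)
  moreover have "k = k'" using eq by (metis fun_upd_same)
  ultimately show "k = k' \<and> m = m'" by simp
qed

lemma finite_box [simp]: "finite (box s D)"
  by (induction s) (simp_all add: box_0 box_Suc)

lemma box_mono: "D \<le> D' \<Longrightarrow> box s D \<subseteq> box s D'"
  by (auto simp: box_def intro: order_trans)

lemma sum_box_Suc: "(\<Sum>m\<in>box (Suc s) D. f m) = (\<Sum>k\<le>D. \<Sum>m\<in>box s D. f (m(s := k)))"
proof -
  have "(\<Sum>m\<in>box (Suc s) D. f m) = (\<Sum>x\<in>{..D} \<times> box s D. (f \<circ> (\<lambda>(k, m). m(s := k))) x)"
    unfolding box_Suc by (rule sum.reindex[OF box_inj])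
  then show ?thesis by (simp add: sum.cartesian_product split_def)
qed

lemma eval_box_tensor: "eval_box s D x (tensor s h) = (\<Prod>i<s. \<Sum>k\<le>D. fps_nth (h i) k * x i ^ k)"
proof (induction s)
  case 0
  then show ?case by (simp add: eval_box_def box_0 tensor_def)
next
  case (Suc s)
  have *: "tensor (Suc s) h (m(s := k)) = tensor s h m * fps_nth (h s) k" if "m \<in> box s D" for m k
  proof -
    from that have z: "\<forall>i\<ge>s. m i = 0" by (simp add: box_def)
    then have "\<forall>i\<ge>Suc s. (m(s := k)) i = 0" by simp
    with z show ?thesis by (simp add: tensor_def del: fun_upd_apply) simp
  qed
  have "eval_box (Suc s) D x (tensor (Suc s) h) = (\<Sum>k\<le>D. \<Sum>m\<in>box s D.
      (tensor s h m * (\<Prod>i<s. x i ^ m i)) * (fps_nth (h s) k * x s ^ k))"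
    unfolding eval_box_def sum_box_Suc by (intro sum.cong refl) (simp add: * mult_ac)
  also have "\<dots> = (\<Sum>m\<in>box s D. tensor s h m * (\<Prod>i<s. x i ^ m i)) * (\<Sum>k\<le>D. fps_nth (h s) k * x s ^ k)"
    by (subst sum.swap) (simp add: sum_product)
  also have "\<dots> = (\<Prod>i<Suc s. \<Sum>k\<le>D. fps_nth (h i) k * x i ^ k)"
    using Suc.IH by (simp add: eval_box_def)
  finally show ?case .
qed

lemma poly_eq_sum:
  fixes f :: "'b::comm_ring_1 poly"
  assumes "degree f \<le> D"
  shows "(\<Sum>k\<le>D. coeff f k * x ^ k) = poly f x"
  unfolding poly_altdef
  by (rule sum.mono_neutral_right) (use assms in \<open>auto simp: coeff_eq_0\<close>)

lemma eval_box_tensor_poly: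
  assumes "\<And>i. i < s \<Longrightarrow> degree (f i) \<le> D"
  shows "eval_box s D x (tensor s (\<lambda>i. fps_of_poly (f i))) = (\<Prod>i<s. poly (f i) (x i))"
  unfolding eval_box_tensor by (intro prod.cong refl) (simp add: poly_eq_sum assms)

lemma eval_box_sum: "eval_box s D x (\<lambda>m. \<Sum>y\<in>A. c y * F y m) = (\<Sum>y\<in>A. c y * eval_box s D x (F y))"
  by (simp add: eval_box_def sum_distrib_left sum_distrib_right mult.assoc, subst sum.swap) (rule refl)

lemma eval_box_cmult: "eval_box s D x (\<lambda>m. c * F m) = c * eval_box s D x F"
  by (simp add: eval_box_def sum_distrib_left mult.assoc)

lemma eval_box_mono:
  assumes "\<And>m. m \<notin> box s D \<Longrightarrow> F m = 0" "D \<le> D'"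
  shows "eval_box s D' x F = eval_box s D x F"
  unfolding eval_box_def
  by (rule sum.mono_neutral_right) (use assms box_mono[OF assms(2)] in auto)

text \<open>
  By induction on the number of variables: for fixed values of the others, the polynomial in the last variable has
  infinitely many zeros, so each of its coefficients vanishes on the grid of one dimension less.
\<close>

lemma eval_box_eq_0_imp_zero:
  fixes F :: "(nat \<Rightarrow> nat) \<Rightarrow> 'b::field"
  assumes "infinite U" and "\<And>x. (\<And>i. x i \<in> U) \<Longrightarrow> eval_box s D x F = 0"
  shows "\<forall>m\<in>box s D. F m = 0"
  using assms(2)
proof (induction s arbitrary: F)
  case 0
  obtain x0 where "x0 \<in> U" using assms(1) by (metis ex_in_conv finite.emptyI)
  then show ?case using 0[of "\<lambda>_. x0"] by (simp add: eval_box_def box_0)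
next
  case (Suc s)
  have "eval_box s D x (\<lambda>m. F (m(s := k))) = 0" if x: "\<And>i. x i \<in> U" and k: "k \<le> D" for x k
  proof -
    define G where "G = (\<Sum>k\<le>D. monom (eval_box s D x (\<lambda>m. F (m(s := k)))) k)"
    have "poly G y = 0" if "y \<in> U" for y
    proof -
      have "eval_box (Suc s) D (x(s := y)) F = (\<Sum>k\<le>D. \<Sum>m\<in>box s D. F (m(s := k)) * ((\<Prod>i<s. x i ^ m i) * y ^ k))"
        unfolding eval_box_def sum_box_Suc by simp
      also have "\<dots> = poly G y"
        by (simp add: G_def poly_sum poly_monom eval_box_def sum_distrib_right mult.assoc)
      finally show ?thesis using Suc.prems[of "x(s := y)"] x that by simp
    qed
    then have "U \<subseteq> {y. poly G y = 0}" by auto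
    then have "infinite {y. poly G y = 0}" using assms(1) finite_subset by blast
    then have "G = 0" using poly_roots_finite by blast
    moreover have "coeff G k = eval_box s D x (\<lambda>m. F (m(s := k)))"
      using k by (simp add: G_def Polynomial.coeff_sum)
    ultimately show ?thesis by simp
  qed
  then have "\<forall>m\<in>box s D. F (m(s := k)) = 0" if "k \<le> D" for k
    using Suc.IH[of "\<lambda>m. F (m(s := k))"] that by blast
  then show ?case by (auto simp: box_Suc)
qed

section \<open>Twists and the exponential of the \<open>L\<close>-series\<close>

context poly_embedding
begin

definition frob_fps :: "nat \<Rightarrow> 'b fps \<Rightarrow> 'b fps" where
  "frob_fps n g = Abs_fps (\<lambda>k. fps_nth g k ^ (q ^ n))"

lemma frob_fps_nth [simp]: "fps_nth (frob_fps n g) k = fps_nth g k ^ (q ^ n)"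
  by (simp add: frob_fps_def)

lemma frob_fps_mult: "frob_fps n (g * h) = frob_fps n g * frob_fps n h"
  by (rule fps_ext) (simp add: fps_mult_nth frob_sum power_mult_distrib)

lemma frob_fps_1 [simp]: "frob_fps n 1 = 1"
  by (rule fps_ext) simp

lemma mult_var_frob: "mult_var i g F m ^ (q ^ n) = mult_var i (frob_fps n g) (\<lambda>m. F m ^ (q ^ n)) m"
  by (simp add: mult_var_altdef frob_sum power_mult_distrib)

lemma mult_vars_frob: "mult_vars s g F m ^ (q ^ n) = mult_vars s (frob_fps n g) (\<lambda>m. F m ^ (q ^ n)) m"
  by (induction s arbitrary: F) (simp_all add: mult_var_frob)

lemma tensor_frob: "tensor s h m ^ (q ^ n) = tensor s (\<lambda>i. frob_fps n (h i)) m"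
proof (cases "\<forall>i\<ge>s. m i = 0")
  case False
  show ?thesis unfolding tensor_def if_not_P[OF False] by (rule frob_0)
qed (simp add: tensor_def prod_power_distrib)

lemma frob_bp: "bp k * map_poly (\<lambda>x. x ^ (q ^ k)) (bp n) = bp (k + n)"
proof (induction n)
  case 0
  have "map_poly (\<lambda>x. x ^ (q ^ k)) (1 :: 'b poly) = 1"
    by (rule poly_eqI) (simp add: coeff_map_poly)
  then show ?case by simp
next
  case (Suc n)
  have "map_poly (\<lambda>x. x ^ (q ^ k)) (f * g) = map_poly (\<lambda>x. x ^ (q ^ k)) f * map_poly (\<lambda>x. x ^ (q ^ k)) g" for f g :: "'b poly"
    by (rule poly_eqI) (simp add: coeff_map_poly coeff_mult frob_sum power_mult_distrib)
  moreover have "map_poly (\<lambda>x. x ^ (q ^ k)) [:- (th ^ (q ^ n)), 1:] = [:- (th ^ (q ^ (k + n))), 1:]"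
    by (rule poly_eqI) (simp add: coeff_map_poly coeff_pCons frob_minus frob_frob add.commute split: nat.splits)
  ultimately show ?case using Suc by (simp only: bp_Suc mult.assoc[symmetric] add_Suc_right)
qed

lemma frob_fps_bp: "fps_of_poly (bp k) * frob_fps k (fps_of_poly (bp n)) = fps_of_poly (bp (k + n))"
proof -
  have "frob_fps k (fps_of_poly (bp n)) = fps_of_poly (map_poly (\<lambda>x. x ^ (q ^ k)) (bp n))"
    by (rule fps_ext) (simp add: coeff_map_poly)
  then show ?thesis by (simp add: frob_bp flip: fps_of_poly_mult)
qed

lemma frob_fps_tp [simp]: "frob_fps k (fps_of_poly (tp a)) = fps_of_poly (tp a)"
  by (rule fps_ext) simp

text \<open>
  The operator \<open>T\<^sup>n\<close> with \<open>T = \<Prod>\<^sub>i (t\<^sub>i - \<theta>) \<cdot> \<tau>\<close>, where \<open>\<tau>\<close> raises coefficients to the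
  power \<open>q\<close> and fixes the variables.
\<close>

definition twist :: "nat \<Rightarrow> nat \<Rightarrow> ((nat \<Rightarrow> nat) \<Rightarrow> 'b) \<Rightarrow> (nat \<Rightarrow> nat) \<Rightarrow> 'b" where
  "twist s n F = mult_vars s (fps_of_poly (bp n)) (\<lambda>m. F m ^ (q ^ n))"

lemma twist_0 [simp]: "twist s 0 F = F"
  by (simp add: twist_def)

lemma twist_twist: "twist s k (twist s n F) = twist s (k + n) F"
proof -
  have "(\<lambda>m. twist s n F m ^ (q ^ k)) = mult_vars s (frob_fps k (fps_of_poly (bp n))) (\<lambda>m. F m ^ (q ^ (k + n)))"
    by (rule ext) (simp add: twist_def mult_vars_frob frob_frob add.commute)
  then show ?thesis by (simp add: twist_def mult_vars_mult_vars frob_fps_bp)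
qed

lemma twist_sum: "twist s n (\<lambda>m. \<Sum>x\<in>A. c x * F x m) m = (\<Sum>x\<in>A. c x ^ (q ^ n) * twist s n (F x) m)"
  by (simp add: twist_def frob_sum power_mult_distrib mult_vars_sum)

lemma twist_cmult: "twist s n (\<lambda>m. c * F m) m = c ^ (q ^ n) * twist s n F m"
  by (simp add: twist_def power_mult_distrib mult_vars_cmult)

lemma twist_add: "twist s n (\<lambda>m. F m + G m) m = twist s n F m + twist s n G m"
  by (simp add: twist_def frob_add mult_vars_add)

lemma twist_diff: "twist s n (\<lambda>m. F m - G m) m = twist s n F m - twist s n G m"
  by (simp add: twist_def frob_diff mult_vars_diff)

lemma twist_mult_vars_tp: "twist s n (mult_vars s (fps_of_poly (tp a)) F) = mult_vars s (fps_of_poly (tp a)) (twist s n F)"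
proof -
  have "(\<lambda>m. mult_vars s (fps_of_poly (tp a)) F m ^ (q ^ n)) = mult_vars s (fps_of_poly (tp a)) (\<lambda>m. F m ^ (q ^ n))"
    by (rule ext) (simp add: mult_vars_frob)
  then show ?thesis by (simp add: twist_def mult_vars_mult_vars mult.commute)
qed

definition chi_t :: "nat \<Rightarrow> 'a poly \<Rightarrow> (nat \<Rightarrow> nat) \<Rightarrow> 'b" where
  "chi_t s a = tensor s (\<lambda>_. fps_of_poly (tp a))"

lemma chi_t_mult: "chi_t s (a * b) = mult_vars s (fps_of_poly (tp a)) (chi_t s b)"
  by (simp add: chi_t_def mult_vars_tensor tp_mult fps_of_poly_mult)

lemma chi_t_frob [simp]: "chi_t s a m ^ (q ^ n) = chi_t s a m"
  by (simp add: chi_t_def tensor_frob)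

lemma twist_chi_t: "twist s n (chi_t s a) = tensor s (\<lambda>_. fps_of_poly (bp n * tp a))"
  by (simp add: twist_def) (simp add: chi_t_def mult_vars_tensor fps_of_poly_mult)

definition L_part :: "nat \<Rightarrow> nat \<Rightarrow> (nat \<Rightarrow> nat) \<Rightarrow> 'b" where
  "L_part s d m = (\<Sum>a\<in>monics d. 1 / emb a * chi_t s a m)"

text \<open>
  Give the degree \<open>d\<close> part of \<open>L\<close> the weight \<open>z\<^bsup>q^d\<^esup>\<close>, with \<open>\<tau>(z) = z\<^sup>q\<close>. This is the coefficient of
  \<open>z\<^bsup>q^M\<^esup>\<close> in \<open>exp\<^sub>\<phi>(L)\<close>.
\<close>

definition exp_L_coeff :: "nat \<Rightarrow> nat \<Rightarrow> (nat \<Rightarrow> nat) \<Rightarrow> 'b" where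
  "exp_L_coeff s M m = (\<Sum>n\<le>M. 1 / dd n * twist s n (L_part s (M - n)) m)"

end

section \<open>Integrality at a prime\<close>

definition local_ring :: "('a::comm_ring_1 \<Rightarrow> 'b::field) \<Rightarrow> 'a \<Rightarrow> 'b set" where
  "local_ring emb p = {emb a / emb b | a b. \<not> p dvd b}"

locale prime_embedding = poly_embedding q emb
  for q :: nat and emb :: "'a::finite_field poly \<Rightarrow> 'b::field" +
  fixes p :: "'a poly" and d :: nat
  assumes p_irreducible: "Factorial_Ring.irreducible p"
    and p_monic: "lead_coeff p = 1"
    and p_degree: "degree p = d"
begin

abbreviation Loc :: "'b set" where "Loc \<equiv> local_ring emb p"

definition pLoc :: "'b set" where "pLoc = (*) (emb p) ` Loc"

lemma p_prime: "prime_elem p"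
  by (rule field_poly_irreducible_imp_prime) (rule p_irreducible)

lemma p_nonzero [simp]: "p \<noteq> 0"
  using p_monic by auto

lemma p_not_dvd_1: "\<not> p dvd 1"
  using p_prime by (auto simp: prime_elem_def)

lemma d_pos: "d > 0"
proof (rule ccontr)
  assume "\<not> d > 0"
  then have "p dvd 1" using p_degree by (simp add: is_unit_iff_degree)
  then show False using p_not_dvd_1 by blast
qed

lemma p_dvd_mult_iff: "p dvd a * b \<longleftrightarrow> p dvd a \<or> p dvd b"
  by (rule prime_elem_dvd_mult_iff) (rule p_prime)

lemma LocI: "\<not> p dvd b \<Longrightarrow> emb a / emb b \<in> Loc"
  by (auto simp: local_ring_def)

lemma LocE:
  assumes "x \<in> Loc"
  obtains a b where "x = emb a / emb b" "\<not> p dvd b" "b \<noteq> 0"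
proof -
  from assms obtain a b where "x = emb a / emb b" "\<not> p dvd b" by (auto simp: local_ring_def)
  moreover from this have "b \<noteq> 0" by auto
  ultimately show thesis using that by blast
qed

lemma emb_in_Loc [simp]: "emb a \<in> Loc"
  using LocI[of 1 a] p_not_dvd_1 by simp

lemma Loc_0 [simp]: "0 \<in> Loc" and Loc_1 [simp]: "1 \<in> Loc" and Loc_ec [simp]: "ec c \<in> Loc"
  and Loc_th [simp]: "th \<in> Loc"
  using emb_in_Loc[of 0] emb_in_Loc[of 1] emb_in_Loc[of "[:c:]"] emb_in_Loc[of theta]
  by (simp_all add: ec_def th_def)

lemma Loc_add [intro]: "x \<in> Loc \<Longrightarrow> y \<in> Loc \<Longrightarrow> x + y \<in> Loc"
proof -
  assume "x \<in> Loc" "y \<in> Loc"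
  then obtain a b a' b' where "x = emb a / emb b" "\<not> p dvd b" "b \<noteq> 0" "y = emb a' / emb b'" "\<not> p dvd b'" "b' \<noteq> 0"
    by (elim LocE)
  then show ?thesis
    using LocI[of "b * b'" "a * b' + a' * b"] by (simp add: p_dvd_mult_iff emb_add emb_mult add_frac_eq mult.commute)
qed

lemma Loc_mult [intro]: "x \<in> Loc \<Longrightarrow> y \<in> Loc \<Longrightarrow> x * y \<in> Loc"
proof -
  assume "x \<in> Loc" "y \<in> Loc"
  then obtain a b a' b' where "x = emb a / emb b" "\<not> p dvd b" "b \<noteq> 0" "y = emb a' / emb b'" "\<not> p dvd b'" "b' \<noteq> 0"
    by (elim LocE)
  then show ?thesis
    using LocI[of "b * b'" "a * a'"] by (simp add: p_dvd_mult_iff emb_mult)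
qed

lemma Loc_minus [intro]: "x \<in> Loc \<Longrightarrow> - x \<in> Loc"
  using Loc_mult[OF emb_in_Loc[of "- 1"], of x] by (simp add: emb_minus)

lemma Loc_diff [intro]: "x \<in> Loc \<Longrightarrow> y \<in> Loc \<Longrightarrow> x - y \<in> Loc"
  using Loc_add[of x "- y"] by auto

lemma Loc_power [intro]: "x \<in> Loc \<Longrightarrow> x ^ n \<in> Loc"
  by (induction n) auto

lemma Loc_sum [intro]: "(\<And>x. x \<in> A \<Longrightarrow> f x \<in> Loc) \<Longrightarrow> sum f A \<in> Loc"
  by (induction A rule: infinite_finite_induct) auto

lemma Loc_prod [intro]: "(\<And>x. x \<in> A \<Longrightarrow> f x \<in> Loc) \<Longrightarrow> prod f A \<in> Loc"
  by (induction A rule: infinite_finite_induct) auto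

lemma Loc_inverse: "\<not> p dvd b \<Longrightarrow> 1 / emb b \<in> Loc"
  using LocI[of b 1] by simp

lemma pLocI [intro]: "z \<in> Loc \<Longrightarrow> emb p * z \<in> pLoc"
  by (auto simp: pLoc_def)

lemma pLoc_cancel: "emb p * z \<in> pLoc \<Longrightarrow> z \<in> Loc"
  by (auto simp: pLoc_def)

lemma pLoc_0 [simp]: "0 \<in> pLoc"
  using pLocI[of 0] by simp

lemma pLoc_add [intro]: "x \<in> pLoc \<Longrightarrow> y \<in> pLoc \<Longrightarrow> x + y \<in> pLoc"
  unfolding pLoc_def by (auto simp flip: distrib_left)

lemma pLoc_mult [intro]: "x \<in> Loc \<Longrightarrow> y \<in> pLoc \<Longrightarrow> x * y \<in> pLoc"
  unfolding pLoc_def by (auto simp: mult.left_commute[of x])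

lemma pLoc_minus [intro]: "x \<in> pLoc \<Longrightarrow> - x \<in> pLoc"
  using pLoc_mult[OF Loc_minus[OF Loc_1], of x] by simp

lemma pLoc_diff [intro]: "x \<in> pLoc \<Longrightarrow> y \<in> pLoc \<Longrightarrow> x - y \<in> pLoc"
  using pLoc_add[of x "- y"] by auto

lemma pLoc_sum [intro]: "(\<And>x. x \<in> A \<Longrightarrow> f x \<in> pLoc) \<Longrightarrow> sum f A \<in> pLoc"
  by (induction A rule: infinite_finite_induct) auto

lemma pLoc_dvd: "p dvd a \<Longrightarrow> emb a \<in> pLoc"
proof -
  assume "p dvd a"
  then obtain k where "a = p * k" by blast
  then show ?thesis using pLocI[OF emb_in_Loc[of k]] by (simp add: emb_mult)
qed

lemma p_dvd_powerD: "p dvd a ^ n \<Longrightarrow> p dvd a"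
  by (rule prime_elem_dvd_power) (rule p_prime)

lemma p_dvd_prodD: "p dvd prod f A \<Longrightarrow> \<exists>x\<in>A. p dvd f x"
  by (induction A rule: infinite_finite_induct) (use p_not_dvd_1 in \<open>auto simp: p_dvd_mult_iff\<close>)

text \<open>
  Evaluate \<open>d\<^sub>k bin k\<close>, a product over the polynomials of degree less than \<open>k\<close>, at \<open>\<theta>\<^sup>k\<close>, where \<open>bin k\<close> is \<open>1\<close>.
  The factors run over all monic polynomials of degree \<open>k\<close>, so \<open>p\<close> divides \<open>d\<^sub>k\<close> for \<open>k = d\<close> but not for \<open>k < d\<close>.
\<close>

lemma carlitz_d_eq_prod: "carlitz_d k = (\<Prod>a\<in>polys_below k. monom 1 k - a :: 'a poly)"
proof -
  have "bin k (emb (monom 1 k)) = 1"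
    by (rule bin_emb_monic) (simp_all add: degree_monom_eq)
  then have "emb (carlitz_d k) = emb (\<Prod>a\<in>polys_below k. monom 1 k - a)"
    using dd_bin_eq_prod[of k "emb (monom 1 k)"]
    by (simp add: dd_def emb_prod emb_diff)
  then show ?thesis by simp
qed

lemma not_dvd_carlitz_d: "k < d \<Longrightarrow> \<not> p dvd carlitz_d k"
proof
  assume k: "k < d" and "p dvd carlitz_d k"
  then obtain a where a: "a \<in> polys_below k" "p dvd monom 1 k - a"
    unfolding carlitz_d_eq_prod by (auto dest: p_dvd_prodD)
  have "coeff (monom 1 k - a) k = 1"
    using a(1) by (simp add: polys_below_def)
  then have nz: "monom 1 k - a \<noteq> 0" by force
  have "degree (monom 1 k - a) \<le> k"
    using a(1) by (intro degree_diff_le) (auto simp: polys_below_degree degree_monom_le)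
  then show False using dvd_imp_degree_le[OF a(2) nz] p_degree k by simp
qed

lemma dvd_carlitz_d: "p dvd carlitz_d d"
proof -
  have "monom 1 d - p \<in> polys_below d"
    using p_monic p_degree by (auto simp: polys_below_def le_less coeff_eq_0)
  then have "monom 1 d - (monom 1 d - p) dvd carlitz_d d"
    unfolding carlitz_d_eq_prod by (intro dvd_prodI) auto
  then show ?thesis by simp
qed

text \<open>
  \<open>p\<close> divides \<open>d\<^sub>d\<close>, which is \<open>\<theta>\<^bsup>q^d\<^esup> - \<theta>\<close> times a power of \<open>d\<^bsub>d-1\<^esub>\<close>.
\<close>

lemma theta_frobenius_cong: "p dvd theta ^ (q ^ d) - theta"
proof -
  obtain d' where d': "d = Suc d'" using d_pos by (cases d) auto
  have "p dvd (theta ^ (q ^ d) - theta) * carlitz_d d' ^ q"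
    using dvd_carlitz_d by (simp add: d' carlitz_d_Suc q_def del: power_Suc)
  moreover have "\<not> p dvd carlitz_d d' ^ q"
    using not_dvd_carlitz_d[of d'] d' by (auto dest: p_dvd_powerD)
  ultimately show ?thesis by (simp add: p_dvd_mult_iff)
qed

lemma frobenius_cong: "p dvd a ^ (q ^ d) - a"
proof (induction a)
  case 0
  then show ?case by (simp add: power_0_left)
next
  case (pCons c b)
  have frob_diff_poly: "(x + y) ^ (q ^ d) = x ^ (q ^ d) + y ^ (q ^ d)" for x y :: "'a poly"
    unfolding q_def by (rule power_card_add) simp
  have c: "[:c:] ^ (q ^ d) = [:c:]"
    using finite_field_power_card_power_eq_same[of "q ^ d" d c] by (simp add: q_def poly_const_pow)
  have "pCons c b = [:c:] + theta * b" by simp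
  then have "pCons c b ^ (q ^ d) - pCons c b = theta ^ (q ^ d) * b ^ (q ^ d) - theta * b"
    by (simp only: frob_diff_poly c power_mult_distrib) simp
  also have "\<dots> = (theta ^ (q ^ d) - theta) * b ^ (q ^ d) + theta * (b ^ (q ^ d) - b)"
    by (simp only: left_diff_distrib right_diff_distrib) simp
  finally show ?case
    using pCons.IH theta_frobenius_cong by (metis dvd_add dvd_mult dvd_mult2)
qed

lemma Loc_frobenius: "x \<in> Loc \<Longrightarrow> x ^ (q ^ d) - x \<in> pLoc"
proof -
  assume "x \<in> Loc"
  then obtain a b where ab: "x = emb a / emb b" "\<not> p dvd b" "b \<noteq> 0" by (rule LocE)
  have "x ^ (q ^ d) - x = 1 / emb (b ^ (q ^ d) * b) * emb ((a ^ (q ^ d) - a) * b - a * (b ^ (q ^ d) - b))"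
    unfolding ab(1) using ab(3) by (simp add: emb_mult emb_power emb_diff power_divide field_simps)
  moreover have "1 / emb (b ^ (q ^ d) * b) \<in> Loc"
    by (rule Loc_inverse) (use ab in \<open>auto simp: p_dvd_mult_iff dest: p_dvd_powerD\<close>)
  moreover have "emb ((a ^ (q ^ d) - a) * b - a * (b ^ (q ^ d) - b)) \<in> pLoc"
    by (rule pLoc_dvd) (use frobenius_cong in auto)
  ultimately show ?thesis by (metis pLoc_mult)
qed

text \<open>
  The derivative of \<open>\<theta>\<^bsup>q^k\<^esup> - \<theta>\<close> is \<open>-1\<close>, so \<open>p\<^sup>2\<close> does not divide it.
\<close>

lemma p_over_bracket: "k > 0 \<Longrightarrow> emb p / (th ^ (q ^ k) - th) \<in> Loc"
proof -
  assume k: "k > 0"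
  define f :: "'a poly" where "f = theta ^ (q ^ k) - theta"
  have f: "th ^ (q ^ k) - th = emb f"
    by (simp add: f_def th_def emb_diff emb_power)
  show ?thesis
  proof (cases "p dvd f")
    case True
    then obtain g where g: "f = p * g" by blast
    have "\<not> p dvd g"
    proof
      assume "p dvd g"
      then obtain h where "f = p * (p * h)" using g by auto
      then have "pderiv f = p * (h * pderiv p + pderiv (p * h))"
        by (simp add: pderiv_mult algebra_simps)
      moreover have "pderiv f = - 1"
      proof -
        have "emb (of_nat q) = emb 0"
          unfolding emb_of_nat by simp
        then have "of_nat q = (0 :: 'a poly)" by (simp only: emb_eq_iff)
        then have "of_nat q = (0 :: 'a)" by (simp add: of_nat_poly)
        then have "pderiv (theta ^ (q ^ k) :: 'a poly) = 0"
          using k by (simp add: pderiv_power)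
        then show ?thesis by (simp add: f_def pderiv_diff pderiv_pCons one_pCons)
      qed
      ultimately have "p dvd - 1" by (metis dvd_triv_left)
      then show False using p_not_dvd_1 by simp
    qed
    then show ?thesis unfolding f g using Loc_inverse by (simp add: emb_mult)
  next
    case False
    then show ?thesis unfolding f using LocI by blast
  qed
qed

lemma p_power_over_dd: "emb p ^ (q ^ n - 1) / dd n \<in> Loc"
proof (induction n)
  case (Suc n)
  have "q ^ Suc n - 1 = (q ^ n - 1) * q + (q - 2) + 1"
  proof -
    have "q ^ n \<noteq> 0" by simp
    then obtain m where m: "q ^ n = Suc m" by (cases "q ^ n") auto
    then show ?thesis using q_ge_2 by (simp add: algebra_simps)
  qed
  then have "emb p ^ (q ^ Suc n - 1) = (emb p ^ (q ^ n - 1)) ^ q * emb p ^ (q - 2) * emb p"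
    by (simp add: power_add power_mult)
  then have "emb p ^ (q ^ Suc n - 1) / dd (Suc n) =
      (emb p ^ (q ^ n - 1) / dd n) ^ q * emb p ^ (q - 2) * (emb p / (th ^ (q ^ Suc n) - th))"
    by (simp add: dd_Suc power_divide)
  moreover have "\<dots> \<in> Loc"
    by (intro Loc_mult Loc_power Suc.IH emb_in_Loc p_over_bracket) simp
  ultimately show ?case by simp
qed simp

text \<open>
  This is what makes \<open>exp\<^sub>\<phi>(p x)\<close> divisible by \<open>p\<close> for integral \<open>x\<close>.
\<close>

lemma p_power_over_dd': "emb p ^ (q ^ n) / dd n \<in> pLoc"
proof -
  have "emb p ^ (q ^ n) = emb p * emb p ^ (q ^ n - 1)"
    by (simp flip: power_Suc)
  then show ?thesis using pLocI[OF p_power_over_dd[of n]] by simp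
qed

lemma not_dvd_carlitz_l: "k < d \<Longrightarrow> \<not> p dvd carlitz_l k"
proof (induction k)
  case (Suc k)
  have "\<not> p dvd theta ^ (q ^ Suc k) - theta"
    using not_dvd_carlitz_d[OF Suc.prems] by (auto simp: carlitz_d_Suc q_def p_dvd_mult_iff)
  then have "\<not> p dvd theta - theta ^ (q ^ Suc k)"
    by (metis dvd_minus_iff minus_diff_eq)
  then show ?case
    using Suc by (simp add: carlitz_l_Suc p_dvd_mult_iff q_def)
qed (use p_not_dvd_1 in simp)

text \<open>
  Together with \<open>bin_p_d\<close> and \<open>bin_p_large\<close>: the Carlitz module reduces modulo \<open>p\<close> to \<open>C\<^sub>p \<equiv> \<tau>\<^sup>d\<close>.
\<close>

lemma bin_p_small: "k < d \<Longrightarrow> bin k (emb p) \<in> pLoc"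
  unfolding bin_def
proof (intro pLoc_sum)
  fix j assume k: "k < d" and j: "j \<in> {..k}"
  have "emb p ^ (q ^ j) / (dd j * ll (k - j) ^ (q ^ j)) = emb p * (emb p ^ (q ^ j - 1) * (1 / emb (carlitz_d j * carlitz_l (k - j) ^ (q ^ j))))"
    by (simp add: dd_def ll_def emb_mult emb_power flip: power_Suc)
  moreover have "\<dots> \<in> pLoc"
    using k j not_dvd_carlitz_d[of j] not_dvd_carlitz_l[OF less_imp_diff_less[OF k], of j]
    by (intro pLocI Loc_mult Loc_power emb_in_Loc Loc_inverse) (auto simp: p_dvd_mult_iff dest: p_dvd_powerD)
  ultimately show "emb p ^ (q ^ j) / (dd j * ll (k - j) ^ (q ^ j)) \<in> pLoc" by simp
qed

lemma bin_p_d: "bin d (emb p) = 1"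
  by (rule bin_emb_monic) (fact p_degree p_monic)+

lemma bin_p_large: "d < k \<Longrightarrow> bin k (emb p) = 0"
  by (rule bin_emb_eq_0) (use p_degree in \<open>simp add: polys_below_degree\<close>)

lemma coeff_bp_Loc: "coeff (bp k) i \<in> Loc"
proof (induction k arbitrary: i)
  case (Suc k)
  have eq: "bp (Suc k) = [:0, 1:] * bp k - smult (th ^ (q ^ k)) (bp k)"
    by (simp add: bp_Suc algebra_simps)
  show ?case unfolding eq using Suc
    by (auto simp: coeff_pCons intro!: Loc_diff Loc_mult Loc_minus Loc_power split: nat.splits)
qed (auto simp: coeff_1)

text \<open>
  Modulo \<open>p\<close>, the polynomial \<open>p(t)\<close> splits with the roots \<open>\<theta>\<^bsup>q^i\<^esup>\<close>, \<open>i < d\<close>. In its Newton expansion all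
  coefficients but the leading one are divisible by \<open>p\<close>.
\<close>

lemma tp_bp_cong: "coeff (tp p - bp d) i \<in> pLoc"
proof -
  have "p \<in> polys_below (Suc d)" using p_degree by (simp add: polys_below_degree)
  then have "tp p = (\<Sum>k\<le>d. smult (bin k (emb p)) (bp k))"
    by (rule newton_expansion)
  also have "\<dots> = (\<Sum>k<d. smult (bin k (emb p)) (bp k)) + bp d"
    by (simp add: bin_p_d flip: lessThan_Suc_atMost)
  finally have "tp p - bp d = (\<Sum>k<d. smult (bin k (emb p)) (bp k))" by simp
  moreover have "coeff \<dots> i \<in> pLoc"
    unfolding Polynomial.coeff_sum coeff_smult
    by (intro pLoc_sum) (use pLoc_mult[OF coeff_bp_Loc bin_p_small] in \<open>simp add: mult.commute\<close>)
  ultimately show ?thesis by simp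
qed

lemma mult_vars_Loc:
  "(\<And>k. fps_nth g k \<in> Loc) \<Longrightarrow> (\<And>m. F m \<in> Loc) \<Longrightarrow> mult_vars s g F m \<in> Loc"
  by (rule mult_vars_closed) auto

lemma mult_vars_pLoc:
  "(\<And>k. fps_nth g k \<in> Loc) \<Longrightarrow> (\<And>m. F m \<in> pLoc) \<Longrightarrow> mult_vars s g F m \<in> pLoc"
  by (rule mult_vars_closed) auto

lemma mult_vars_cong_pLoc:
  assumes "\<And>k. fps_nth g k \<in> Loc" "\<And>k. fps_nth h k \<in> Loc" "\<And>k. fps_nth (g - h) k \<in> pLoc"
    and "\<And>m. F m \<in> Loc"
  shows "mult_vars s g F m - mult_vars s h F m \<in> pLoc"
  using assms(4)
proof (induction s arbitrary: F m)
  case (Suc s)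
  have 1: "mult_var s g F m - mult_var s h F m \<in> pLoc" for m
  proof -
    have "mult_var s g F m - mult_var s h F m = mult_var s (g - h) F m"
      by (simp add: mult_var_def algebra_simps)
    moreover have "mult_var s (g - h) F m \<in> pLoc"
      by (rule mult_var_closed) (use pLoc_mult[OF Suc.prems assms(3)] in \<open>auto simp: mult.commute\<close>)
    ultimately show ?thesis by simp
  qed
  have 2: "mult_var s h F m \<in> Loc" for m
    by (rule mult_var_closed) (use assms(2) Suc.prems in auto)
  have "mult_vars s g (mult_var s g F) m - mult_vars s h (mult_var s h F) m =
      mult_vars s g (\<lambda>m. mult_var s g F m - mult_var s h F m) m + (mult_vars s g (mult_var s h F) m - mult_vars s h (mult_var s h F) m)"
    by (simp add: mult_vars_diff)
  also have "\<dots> \<in> pLoc"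
    by (intro pLoc_add mult_vars_pLoc Suc.IH) (use assms(1) 1 2 in auto)
  finally show ?case by simp
qed simp

lemma twist_Loc: "(\<And>m. F m \<in> Loc) \<Longrightarrow> twist s n F m \<in> Loc"
  unfolding twist_def by (rule mult_vars_Loc) (auto simp: coeff_bp_Loc)

text \<open>
  Combined with \<open>C\<^sub>p \<equiv> \<tau>\<^sup>d\<close>: on integral series, \<open>\<phi>\<^sub>p\<close> is modulo \<open>p\<close> the multiplication by \<open>\<chi>\<^sub>t(p)\<close>.
\<close>

lemma twist_d_cong:
  assumes "\<And>m. F m \<in> Loc"
  shows "mult_vars s (fps_of_poly (tp p)) F m - twist s d F m \<in> pLoc"
proof -
  let ?t = "fps_of_poly (tp p)" and ?b = "fps_of_poly (bp d)"
  have "mult_vars s ?t F m - twist s d F m =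
     (mult_vars s ?t F m - mult_vars s ?b F m) - mult_vars s ?b (\<lambda>m. F m ^ (q ^ d) - F m) m"
    by (simp add: twist_def mult_vars_diff)
  also have "\<dots> \<in> pLoc"
  proof (rule pLoc_diff)
    show "mult_vars s ?t F m - mult_vars s ?b F m \<in> pLoc"
      by (rule mult_vars_cong_pLoc) (use tp_bp_cong assms coeff_bp_Loc in \<open>auto simp flip: fps_of_poly_diff\<close>)
    show "mult_vars s ?b (\<lambda>m. F m ^ (q ^ d) - F m) m \<in> pLoc"
      by (rule mult_vars_pLoc) (use Loc_frobenius assms coeff_bp_Loc in auto)
  qed
  finally show ?thesis .
qed

definition L_part' :: "nat \<Rightarrow> nat \<Rightarrow> (nat \<Rightarrow> nat) \<Rightarrow> 'b" where
  "L_part' s j m = (\<Sum>a\<in>{a \<in> monics j. \<not> p dvd a}. 1 / emb a * chi_t s a m)"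

lemma chi_t_Loc: "chi_t s a m \<in> Loc"
  by (auto simp: chi_t_def tensor_def)

lemma L_part'_Loc: "L_part' s j m \<in> Loc"
  unfolding L_part'_def by (intro Loc_sum Loc_mult chi_t_Loc Loc_inverse) simp

text \<open>
  The polynomials \<open>a = p b\<close> contribute \<open>\<chi>\<^sub>t(p) / p\<close> times the part of \<open>L\<close> in degree \<open>j - d\<close>; all others contribute
  integral terms.
\<close>

lemma L_part_split:
  "L_part s j m = L_part' s j m + (if d \<le> j then 1 / emb p * mult_vars s (fps_of_poly (tp p)) (L_part s (j - d)) m else 0)"
proof -
  have split: "monics j = {a \<in> monics j. \<not> p dvd a} \<union> {a \<in> monics j. p dvd a}" by blast
  have "L_part s j m = L_part' s j m + (\<Sum>a\<in>{a \<in> monics j. p dvd a}. 1 / emb a * chi_t s a m)"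
    unfolding L_part_def L_part'_def by (subst split, rule sum.union_disjoint) auto
  also have "(\<Sum>a\<in>{a \<in> monics j. p dvd a}. 1 / emb a * chi_t s a m) =
     (if d \<le> j then 1 / emb p * mult_vars s (fps_of_poly (tp p)) (L_part s (j - d)) m else 0)"
  proof (cases "d \<le> j")
    case True
    have "(\<Sum>a\<in>{a \<in> monics j. p dvd a}. 1 / emb a * chi_t s a m) =
       (\<Sum>a\<in>monics (j - d). 1 / emb (p * a) * chi_t s (p * a) m)"
    proof (rule sum.reindex_bij_witness[of _ "\<lambda>a. p * a" "\<lambda>a. a div p"])
      fix a assume "a \<in> {a \<in> monics j. p dvd a}"
      then obtain b where b: "a = p * b" and a: "a \<in> monics j" by auto
      then have "b \<noteq> 0" by (auto simp: monics_def)
      then show "a div p \<in> monics (j - d)"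
        using a b p_degree p_monic coeff_mult_degree_sum[of p b] by (auto simp: monics_def degree_mult_eq)
      show "p * (a div p) = a" using b by simp
      then show "1 / emb (p * (a div p)) * chi_t s (p * (a div p)) m = 1 / emb a * chi_t s a m" by simp
    next
      fix a :: "'a poly" assume "a \<in> monics (j - d)"
      then have a: "degree a = j - d" "lead_coeff a = 1" by (auto simp: monics_def)
      then have "a \<noteq> 0" by auto
      then have "degree (p * a) = j" using a True p_degree by (simp add: degree_mult_eq)
      then show "p * a \<in> {a \<in> monics j. p dvd a}"
        using a p_monic lead_coeff_mult[of p a] by (simp add: monics_def)
    qed simp
    also have "\<dots> = (\<Sum>a\<in>monics (j - d). (1 / emb p) * (1 / emb a * mult_vars s (fps_of_poly (tp p)) (chi_t s a) m))"
      by (simp add: chi_t_mult emb_mult)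
    also have "\<dots> = 1 / emb p * mult_vars s (fps_of_poly (tp p)) (L_part s (j - d)) m"
      unfolding L_part_def[abs_def] mult_vars_sum by (simp only: sum_distrib_left)
    finally show ?thesis using True by simp
  next
    case False
    have "{a \<in> monics j. p dvd a} = {}"
    proof (rule ccontr)
      assume "\<not> ?thesis"
      then obtain a where a: "a \<in> monics j" "p dvd a" by blast
      then have "a \<noteq> 0" by (auto simp: monics_def)
      then show False using dvd_imp_degree_le[OF a(2)] a(1) False p_degree by (simp add: monics_def)
    qed
    then show ?thesis using False by (simp only: sum.empty if_False)
  qed
  finally show ?thesis .
qed

text \<open>
  \<open>\<phi>\<^sub>p(exp\<^sub>\<phi>(L)) = exp\<^sub>\<phi>(p L)\<close>, one coefficient at a time.
\<close>

lemma phi_exp_L_coeff: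
  "(\<Sum>k\<le>M. bin k (emb p) * twist s k (exp_L_coeff s (M - k)) m) = (\<Sum>N\<le>M. emb p ^ (q ^ N) / dd N * twist s N (L_part s (M - N)) m)"
proof -
  have "(\<Sum>k\<le>M. bin k (emb p) * twist s k (exp_L_coeff s (M - k)) m) =
     (\<Sum>k\<le>M. \<Sum>n\<le>M - k. bin k (emb p) * (1 / dd n) ^ (q ^ k) * twist s (k + n) (L_part s (M - (k + n))) m)"
    unfolding exp_L_coeff_def[abs_def] twist_sum twist_twist by (simp add: sum_distrib_left mult.assoc)
  also have "\<dots> = (\<Sum>N\<le>M. \<Sum>k\<le>N. bin k (emb p) * (1 / dd (N - k)) ^ (q ^ k) * twist s (k + (N - k)) (L_part s (M - (k + (N - k)))) m)"
    by (rule sum_triangle)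
  also have "\<dots> = (\<Sum>N\<le>M. (\<Sum>k\<le>N. bin k (emb p) / dd (N - k) ^ (q ^ k)) * twist s N (L_part s (M - N)) m)"
    by (simp add: sum_distrib_right power_divide)
  also have "\<dots> = (\<Sum>N\<le>M. emb p ^ (q ^ N) / dd N * twist s N (L_part s (M - N)) m)"
    by (simp add: exp_functional_equation)
  finally show ?thesis .
qed

text \<open>
  In \<open>exp\<^sub>\<phi>(p L)\<close>, the multiples of \<open>p\<close> reproduce \<open>\<chi>\<^sub>t(p) exp\<^sub>\<phi>(L)\<close> in degree \<open>M - d\<close>, because \<open>\<chi>\<^sub>t(p)\<close> commutes with
  \<open>T\<close>.
\<close>

lemma exp_p_L_part:
  "(\<Sum>N\<le>M. emb p ^ (q ^ N) / dd N * twist s N (L_part s (M - N)) m) =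
     (\<Sum>N\<le>M. emb p ^ (q ^ N) / dd N * twist s N (L_part' s (M - N)) m) +
     (if d \<le> M then mult_vars s (fps_of_poly (tp p)) (exp_L_coeff s (M - d)) m else 0)"
proof -
  let ?X = "mult_vars s (fps_of_poly (tp p))"
  have *: "emb p ^ (q ^ N) / dd N * twist s N (L_part s (M - N)) m =
      emb p ^ (q ^ N) / dd N * twist s N (L_part' s (M - N)) m +
      (if d \<le> M - N then 1 / dd N * ?X (twist s N (L_part s (M - N - d))) m else 0)" for N
  proof (cases "d \<le> M - N")
    case True
    have "L_part s (M - N) = (\<lambda>m. L_part' s (M - N) m + 1 / emb p * ?X (L_part s (M - N - d)) m)"
      using L_part_split[of s "M - N"] True by auto
    then have "twist s N (L_part s (M - N)) m =
        twist s N (L_part' s (M - N)) m + (1 / emb p) ^ (q ^ N) * ?X (twist s N (L_part s (M - N - d))) m"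
      by (simp only: twist_add twist_cmult twist_mult_vars_tp)
    then show ?thesis using True by (simp add: algebra_simps power_divide)
  next
    case False
    then have "L_part s (M - N) = L_part' s (M - N)" using L_part_split[of s "M - N"] by auto
    then show ?thesis using False by simp
  qed
  have "(\<Sum>N\<le>M. if d \<le> M - N then 1 / dd N * ?X (twist s N (L_part s (M - N - d))) m else 0) =
     (if d \<le> M then ?X (exp_L_coeff s (M - d)) m else 0)"
  proof (cases "d \<le> M")
    case True
    have "(\<Sum>N\<le>M. if d \<le> M - N then 1 / dd N * ?X (twist s N (L_part s (M - N - d))) m else 0) =
        (\<Sum>N\<le>M - d. 1 / dd N * ?X (twist s N (L_part s (M - d - N))) m)"
      by (rule sum.mono_neutral_cong_right) (use True d_pos in \<open>auto simp: add.commute\<close>)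
    then show ?thesis using True unfolding exp_L_coeff_def[abs_def] mult_vars_sum by simp
  next
    case False
    then show ?thesis by (intro trans[OF sum.neutral]) auto
  qed
  then show ?thesis by (simp only: * sum.distrib)
qed

text \<open>
  A Dwork-type recursion. By the two preceding lemmas, \<open>p\<close> times the coefficient of index \<open>M\<close> is the sum of terms
  divisible by \<open>p\<close> and of the difference between multiplication by \<open>\<chi>\<^sub>t(p)\<close> and \<open>T\<^sup>d\<close>, applied to the coefficient of
  index \<open>M - d\<close>. That difference is divisible by \<open>p\<close> because the earlier coefficient is integral.
\<close>

lemma exp_L_coeff_Loc: "exp_L_coeff s M m \<in> Loc"
proof (induction M arbitrary: m rule: less_induct)
  case (less M)
  let ?X = "mult_vars s (fps_of_poly (tp p))"
  define c where "c k = bin k (emb p) * twist s k (exp_L_coeff s (M - k)) m" for k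
  define A where "A = (\<Sum>N\<le>M. emb p ^ (q ^ N) / dd N * twist s N (L_part' s (M - N)) m)"
  have A: "A \<in> pLoc"
    unfolding A_def
    by (intro pLoc_sum) (use pLoc_mult[OF twist_Loc p_power_over_dd'] L_part'_Loc in \<open>auto simp: mult.commute\<close>)
  have sum_c: "(\<Sum>k\<le>M. c k) = A + (if d \<le> M then ?X (exp_L_coeff s (M - d)) m else 0)"
    by (simp only: c_def A_def phi_exp_L_coeff exp_p_L_part)
  have "(\<Sum>k\<le>M. c k) = c 0 + (\<Sum>k\<in>{..M} - {0}. c k)"
    by (rule sum.remove) auto
  moreover have "c 0 = emb p * exp_L_coeff s M m" by (simp add: c_def)
  ultimately have eq: "emb p * exp_L_coeff s M m =
      A + (if d \<le> M then ?X (exp_L_coeff s (M - d)) m else 0) - (\<Sum>k\<in>{..M} - {0}. c k)"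
    using sum_c by (simp add: algebra_simps)
  \<comment> \<open>the middle coefficients of \<open>\<phi>\<^sub>p\<close> are divisible by \<open>p\<close>, and there are none beyond \<open>d\<close>\<close>
  have small: "c k \<in> pLoc" if "k \<noteq> 0" "k \<le> M" "k \<noteq> d" for k
  proof (cases "k < d")
    case True
    have "twist s k (exp_L_coeff s (M - k)) m \<in> Loc"
      using that by (intro twist_Loc less.IH) simp
    then show ?thesis
      unfolding c_def using pLoc_mult bin_p_small[OF True] by (metis mult.commute)
  next
    case False
    then show ?thesis using that by (simp add: c_def bin_p_large)
  qed
  have "emb p * exp_L_coeff s M m \<in> pLoc"
  proof (cases "d \<le> M")
    case True
    have "(\<Sum>k\<in>{..M} - {0}. c k) = c d + (\<Sum>k\<in>{..M} - {0} - {d}. c k)"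
      by (rule sum.remove) (use True d_pos in auto)
    moreover have "c d = twist s d (exp_L_coeff s (M - d)) m" by (simp add: c_def bin_p_d)
    ultimately have "emb p * exp_L_coeff s M m = A + (?X (exp_L_coeff s (M - d)) m - twist s d (exp_L_coeff s (M - d)) m) - (\<Sum>k\<in>{..M} - {0} - {d}. c k)"
      using eq True by simp
    moreover have "\<dots> \<in> pLoc"
      by (intro pLoc_diff[OF pLoc_add] A twist_d_cong less.IH pLoc_sum) (use True d_pos small in auto)
    ultimately show ?thesis by simp
  next
    case False
    have "emb p * exp_L_coeff s M m = A - (\<Sum>k\<in>{..M} - {0}. c k)"
      using eq False by simp
    moreover have "\<dots> \<in> pLoc"
      by (intro pLoc_diff A pLoc_sum) (use False small in auto)
    ultimately show ?thesis by simp
  qed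
  then show ?case by (rule pLoc_cancel)
qed

end

lemma monic_irreducible_factor:
  fixes b :: "'a::field poly"
  assumes "degree b > 0"
  obtains p where "p dvd b" "Factorial_Ring.irreducible p" "lead_coeff p = 1"
proof -
  define P where "P p \<longleftrightarrow> p dvd b \<and> degree p > 0" for p
  have "P b" using assms by (simp add: P_def)
  then obtain r where r: "P r" and min: "\<And>r'. P r' \<Longrightarrow> degree r \<le> degree r'"
    using ex_has_least_nat[of P b degree] by blast
  define p where "p = smult (inverse (lead_coeff r)) r"
  have r0: "r \<noteq> 0" using r by (auto simp: P_def)
  then have p: "p dvd b" "degree p = degree r" "lead_coeff p = 1"
    using r by (auto simp: p_def P_def smult_dvd_iff)
  have "Factorial_Ring.irreducible p"
  proof (rule Factorial_Ring.irreducibleI)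
    show p0: "p \<noteq> 0" using p(3) by auto
    show "\<not> p dvd 1" using r p(2) p0 by (auto simp: P_def is_unit_iff_degree)
    fix u v assume uv: "p = u * v"
    then have nz: "u \<noteq> 0" "v \<noteq> 0" using p(3) by auto
    then have deg: "degree u + degree v = degree r"
      using p(2) uv by (simp add: degree_mult_eq)
    have "degree u = 0 \<or> degree v = 0"
    proof (rule ccontr)
      assume nz': "\<not> ?thesis"
      then have "P u" using p(1) uv by (auto simp: P_def dest: dvd_mult_left)
      then show False using min[of u] deg nz' by simp
    qed
    then show "u dvd 1 \<or> v dvd 1" using nz by (auto simp: is_unit_iff_degree)
  qed
  then show thesis using that p by blast
qed

context poly_embedding
begin

text \<open>
  Take a fraction with denominator of least degree. A prime factor of the denominator would also divide the numerator.
\<close>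

lemma locally_integral_imp_integral:
  assumes "\<And>p. Factorial_Ring.irreducible p \<Longrightarrow> lead_coeff p = 1 \<Longrightarrow> x \<in> local_ring emb p"
  shows "x \<in> range emb"
proof -
  define P where "P b \<longleftrightarrow> b \<noteq> 0 \<and> (\<exists>a. x = emb a / emb b)" for b :: "'a poly"
  have "degree (theta :: 'a poly) > 0" by simp
  then obtain p0 :: "'a poly" where "Factorial_Ring.irreducible p0" "lead_coeff p0 = 1"
    by (rule monic_irreducible_factor)
  then have "x \<in> local_ring emb p0" by (rule assms)
  then obtain a0 b0 where "x = emb a0 / emb b0" "\<not> p0 dvd b0" unfolding local_ring_def by blast
  then have "P b0" unfolding P_def by (metis dvd_0_right)
  then obtain b where b: "P b" and min: "\<And>b'. P b' \<Longrightarrow> degree b \<le> degree b'"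
    using ex_has_least_nat[of P b0 degree] by blast
  then obtain a where a: "x = emb a / emb b" and b0: "b \<noteq> 0" by (auto simp: P_def)
  have "degree b = 0"
  proof (rule ccontr)
    assume "degree b \<noteq> 0"
    then have "degree b > 0" by simp
    then obtain p where p: "p dvd b" "Factorial_Ring.irreducible p" "lead_coeff p = 1"
      by (rule monic_irreducible_factor)
    have prime: "prime_elem p" using p by (intro field_poly_irreducible_imp_prime)
    obtain a' b' where ab': "x = emb a' / emb b'" "\<not> p dvd b'"
      using assms[OF p(2,3)] by (auto simp: local_ring_def)
    then have "b' \<noteq> 0" by auto
    then have "emb (a * b') = emb (a' * b)" using a ab' b0 by (simp add: emb_mult field_simps)
    then have "a * b' = a' * b" by simp
    then have "p dvd a * b'" using p(1) by simp
    then have "p dvd a" using ab'(2) prime by (simp add: prime_elem_dvd_mult_iff)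
    then obtain a1 where a1: "a = p * a1" by blast
    obtain b1 where b1: "b = p * b1" using p(1) by blast
    note 1 = a1 b1
    then have "b1 \<noteq> 0" "p \<noteq> 0" using b0 by auto
    then have "P b1" using a 1 by (auto simp: P_def emb_mult)
    then have "degree b \<le> degree b1" by (rule min)
    moreover have "degree p > 0"
      using p(2) by (auto simp: Factorial_Ring.irreducible_def is_unit_iff_degree)
    ultimately show False using 1 \<open>b1 \<noteq> 0\<close> \<open>p \<noteq> 0\<close> by (simp add: degree_mult_eq)
  qed
  then obtain c where c: "b = [:c:]" "c \<noteq> 0" using b0 by (metis degree_0_id pCons_0_0)
  then have "emb b * ec (inverse c) = 1"
    by (simp add: ec_def[symmetric] flip: ec_mult)
  moreover have "x * emb b = emb a" using a b0 by simp
  ultimately have "x = emb a * ec (inverse c)"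
    by (metis mult.assoc mult_1_right)
  then have "x = emb (smult (inverse c) a)"
    by (simp add: emb_smult mult.commute)
  then show ?thesis by blast
qed

lemma exp_L_coeff_integral: "exp_L_coeff s M m \<in> range emb"
proof (rule locally_integral_imp_integral)
  fix p :: "'a poly" assume p: "Factorial_Ring.irreducible p" "lead_coeff p = 1"
  interpret prime_embedding q emb p "degree p"
    by unfold_locales (use p in auto)
  show "exp_L_coeff s M m \<in> local_ring emb p" by (rule exp_L_coeff_Loc)
qed

end

section \<open>Analysis in \<open>\<complex>\<^sub>\<infinity>\<close>\<close>

text \<open>
  The absolute value. The type of \<open>\<complex>\<^sub>\<infinity>\<close> is only known to be a complete metric field, so the limit laws
  for its operations are derived from the ultrametric inequality.
\<close>

definition nm :: "'c::{zero,metric_space} \<Rightarrow> real" where "nm x = dist x 0"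

context C_infinity
begin

lemma nm_0 [simp]: "nm (0::'c) = 0" and nm_nonneg [simp]: "nm (x::'c) \<ge> 0"
  and nm_eq_0_iff [simp]: "nm (x::'c) = 0 \<longleftrightarrow> x = 0" and nm_pos_iff [simp]: "nm (x::'c) > 0 \<longleftrightarrow> x \<noteq> 0"
  by (simp_all add: nm_def)

lemma dist_nm: "dist x y = nm (x - y :: 'c)"
  using dist_diff[of x y] by (simp add: nm_def)

lemma nm_mult: "nm (x * y :: 'c) = nm x * nm y"
  by (simp add: nm_def dist_mult)

lemma nm_1 [simp]: "nm (1::'c) = 1"
  using nm_mult[of 1 1] by simp

lemma nm_power: "nm (x ^ n :: 'c) = nm x ^ n"
  by (induction n) (simp_all add: nm_mult)

lemma nm_minus [simp]: "nm (- x :: 'c) = nm x"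
proof -
  have "nm (- 1 :: 'c) ^ 2 = 1" by (simp flip: nm_power)
  then have "nm (- 1 :: 'c) = 1" by (simp add: power2_eq_1_iff) (metis nm_nonneg not_one_le_zero neg_0_le_iff_le)
  then show ?thesis using nm_mult[of "- 1" x] by simp
qed

lemma nm_minus_commute: "nm (x - y :: 'c) = nm (y - x)"
  using nm_minus[of "x - y"] by simp

lemma nm_inverse: "nm (inverse x :: 'c) = inverse (nm x)"
proof (cases "x = 0")
  case False
  then have "nm x * nm (inverse x) = 1" by (simp flip: nm_mult)
  then show ?thesis by (metis inverse_unique)
qed simp

lemma nm_divide: "nm (x / y :: 'c) = nm x / nm y"
  by (simp add: divide_inverse nm_mult nm_inverse)

lemma nm_add_le: "nm (x + y :: 'c) \<le> max (nm x) (nm y)"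
  by (simp add: nm_def ultrametric)

lemma nm_add_leI: "nm (x :: 'c) \<le> e \<Longrightarrow> nm y \<le> e \<Longrightarrow> nm (x + y) \<le> e"
  using nm_add_le[of x y] by simp

lemma nm_diff_leI: "nm (x :: 'c) \<le> e \<Longrightarrow> nm y \<le> e \<Longrightarrow> nm (x - y) \<le> e"
  using nm_add_leI[of x e "- y"] by simp

lemma nm_add_eq: "nm (x :: 'c) < nm y \<Longrightarrow> nm (x + y) = nm y"
  using nm_add_le[of x y] nm_add_le[of "x + y" "- x"] by auto

lemma nm_sum_le: "(\<And>x. x \<in> A \<Longrightarrow> nm (f x :: 'c) \<le> e) \<Longrightarrow> 0 \<le> e \<Longrightarrow> nm (sum f A) \<le> e"
  by (induction A rule: infinite_finite_induct) (auto intro: nm_add_leI)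

lemma nm_prod: "nm (prod f A :: 'c) = (\<Prod>x\<in>A. nm (f x))"
  by (induction A rule: infinite_finite_induct) (simp_all add: nm_mult)

lemma tendsto_nm: "(f \<longlongrightarrow> (l :: 'c)) F \<longleftrightarrow> ((\<lambda>n. nm (f n - l)) \<longlongrightarrow> 0) F"
  unfolding tendsto_dist_iff[of f] by (simp add: dist_nm)

lemma tendsto_0_nm: "(f \<longlongrightarrow> (0 :: 'c)) F \<longleftrightarrow> ((\<lambda>n. nm (f n)) \<longlongrightarrow> 0) F"
  unfolding tendsto_nm by simp

lemma lim_null_le:
  assumes "\<And>n. nm (f n :: 'c) \<le> g n" "g \<longlonglongrightarrow> 0" shows "f \<longlonglongrightarrow> 0"
  unfolding tendsto_0_nm
  by (rule tendsto_sandwich[OF _ _ tendsto_const assms(2)]) (use assms in auto)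

lemma lim_add:
  assumes "f \<longlonglongrightarrow> (a :: 'c)" "g \<longlonglongrightarrow> b" shows "(\<lambda>n. f n + g n) \<longlonglongrightarrow> a + b"
proof -
  have "(\<lambda>n. max (nm (f n - a)) (nm (g n - b))) \<longlonglongrightarrow> max 0 0"
    using assms unfolding tendsto_nm by (rule tendsto_max)
  then have "(\<lambda>n. (f n + g n) - (a + b)) \<longlonglongrightarrow> 0"
    by (intro lim_null_le[where g = "\<lambda>n. max (nm (f n - a)) (nm (g n - b))"])
       (use nm_add_le in \<open>simp_all add: add_diff_add\<close>)
  then show ?thesis unfolding tendsto_nm[of _ "a + b"] tendsto_0_nm .
qed

lemma lim_mult_null:
  assumes "f \<longlonglongrightarrow> (a :: 'c)" "g \<longlonglongrightarrow> 0" shows "(\<lambda>n. f n * g n) \<longlonglongrightarrow> 0"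
proof -
  have "(\<lambda>n. max (nm (f n - a)) (nm a) * nm (g n)) \<longlonglongrightarrow> max 0 (nm a) * 0"
    using assms unfolding tendsto_nm by (intro tendsto_mult tendsto_max tendsto_const) auto
  moreover have "nm (f n) \<le> max (nm (f n - a)) (nm a)" for n
    using nm_add_le[of "f n - a" a] by simp
  ultimately show ?thesis
    by (intro lim_null_le[where g = "\<lambda>n. max (nm (f n - a)) (nm a) * nm (g n)"])
       (auto simp: nm_mult intro: mult_right_mono)
qed

lemma lim_cmult_null: "g \<longlonglongrightarrow> 0 \<Longrightarrow> (\<lambda>n. c * g n) \<longlonglongrightarrow> (0 :: 'c)"
  by (rule lim_mult_null[OF tendsto_const])

lemma lim_minus: "f \<longlonglongrightarrow> (a :: 'c) \<Longrightarrow> (\<lambda>n. - f n) \<longlonglongrightarrow> - a"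
  unfolding tendsto_nm by (simp add: nm_minus_commute[of _ a] add.commute)

lemma lim_diff: "f \<longlonglongrightarrow> (a :: 'c) \<Longrightarrow> g \<longlonglongrightarrow> b \<Longrightarrow> (\<lambda>n. f n - g n) \<longlonglongrightarrow> a - b"
  using lim_add[OF _ lim_minus, of f a g b] by simp

lemma lim_shift: "(\<lambda>n. f n - a) \<longlonglongrightarrow> 0 \<longleftrightarrow> f \<longlonglongrightarrow> (a :: 'c)"
  unfolding tendsto_0_nm tendsto_nm[of f] ..

lemma lim_mult:
  assumes "f \<longlonglongrightarrow> (a :: 'c)" "g \<longlonglongrightarrow> b" shows "(\<lambda>n. f n * g n) \<longlonglongrightarrow> a * b"
proof -
  have "(\<lambda>n. f n * (g n - b) + b * (f n - a)) \<longlonglongrightarrow> 0 + 0"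
    using assms unfolding lim_shift[symmetric, of f] lim_shift[symmetric, of g]
    by (intro lim_add lim_cmult_null lim_mult_null[OF assms(1)])
  then show ?thesis
    unfolding lim_shift[symmetric, of "\<lambda>n. f n * g n"] by (simp add: algebra_simps)
qed

lemma lim_cmult: "f \<longlonglongrightarrow> (a :: 'c) \<Longrightarrow> (\<lambda>n. c * f n) \<longlonglongrightarrow> c * a"
  by (rule lim_mult[OF tendsto_const])

lemma lim_power: "f \<longlonglongrightarrow> (a :: 'c) \<Longrightarrow> (\<lambda>n. f n ^ k) \<longlonglongrightarrow> a ^ k"
  by (induction k) (simp_all add: lim_mult)

lemma lim_sum: "(\<And>x. x \<in> A \<Longrightarrow> f x \<longlonglongrightarrow> (a x :: 'c)) \<Longrightarrow> (\<lambda>n. \<Sum>x\<in>A. f x n) \<longlonglongrightarrow> (\<Sum>x\<in>A. a x)"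
  by (induction A rule: infinite_finite_induct) (auto intro: lim_add)

lemma lim_nm: "f \<longlonglongrightarrow> (a :: 'c) \<Longrightarrow> (\<lambda>n. nm (f n)) \<longlonglongrightarrow> nm a"
  unfolding nm_def by (intro tendsto_dist tendsto_const)

lemma lim_nm_le: "f \<longlonglongrightarrow> (a :: 'c) \<Longrightarrow> (\<And>n. nm (f n) \<le> e) \<Longrightarrow> nm a \<le> e"
  using LIMSEQ_le_const2[OF lim_nm] by blast

lemma lim_inverse:
  assumes "f \<longlonglongrightarrow> (a :: 'c)" "a \<noteq> 0" shows "(\<lambda>n. inverse (f n)) \<longlonglongrightarrow> inverse a"
proof -
  have "(\<lambda>n. nm (f n - a) / (nm (f n) * nm a)) \<longlonglongrightarrow> 0 / (nm a * nm a)"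
    using assms(1)[unfolded tendsto_nm] lim_nm[OF assms(1)] assms(2)
    by (intro tendsto_divide tendsto_mult tendsto_const) auto
  moreover have "eventually (\<lambda>n. nm (f n) > 0) sequentially"
    using order_tendstoD(1)[OF lim_nm[OF assms(1)], of 0] assms(2) by simp
  then have "eventually (\<lambda>n. nm (f n - a) / (nm (f n) * nm a) = nm (inverse (f n) - inverse a)) sequentially"
  proof eventually_elim
    case (elim n)
    then have "inverse (f n) - inverse a = (a - f n) / (f n * a)"
      using assms(2) by (simp add: field_simps)
    then show ?case by (simp add: nm_divide nm_mult nm_minus_commute)
  qed
  ultimately show ?thesis
    unfolding tendsto_nm by (auto elim: Lim_transform_eventually)
qed

lemma convergentI:
  assumes "(\<lambda>n. f (Suc n) - f n) \<longlonglongrightarrow> (0 :: 'c)" shows "convergent f"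
proof -
  have "Cauchy f"
    unfolding metric_Cauchy_iff2
  proof
    fix k
    have "eventually (\<lambda>n. nm (f (Suc n) - f n) < inverse (real (Suc k))) sequentially"
      using assms unfolding tendsto_0_nm by (rule order_tendstoD(2)) simp
    then obtain M where M: "\<And>n. n \<ge> M \<Longrightarrow> nm (f (Suc n) - f n) < inverse (real (Suc k))"
      by (auto simp: eventually_sequentially)
    have *: "nm (f (M + n) - f M) < inverse (real (Suc k))" for n
    proof (induction n)
      case (Suc n)
      have "nm (f (M + Suc n) - f M) \<le> max (nm (f (Suc (M + n)) - f (M + n))) (nm (f (M + n) - f M))"
        using nm_add_le[of "f (Suc (M + n)) - f (M + n)" "f (M + n) - f M"] by simp
      then show ?case using Suc M[of "M + n"] by linarith
    qed simp
    show "\<exists>M. \<forall>m\<ge>M. \<forall>n\<ge>M. dist (f m) (f n) < inverse (real (Suc k))"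
    proof (intro exI allI impI)
      fix m n assume "M \<le> m" "M \<le> n"
      then have "nm (f m - f M) < inverse (real (Suc k))" "nm (f M - f n) < inverse (real (Suc k))"
        using *[of "m - M"] *[of "n - M"] by (simp_all add: nm_minus_commute)
      then show "dist (f m) (f n) < inverse (real (Suc k))"
        using nm_add_le[of "f m - f M" "f M - f n"] by (simp add: dist_nm)
    qed
  qed
  then show ?thesis by (rule Cauchy_convergent)
qed

text \<open>
  Dominated convergence for sums whose number of terms grows.
\<close>

lemma lim_dominated_sum:
  assumes "\<And>j. (\<lambda>N. f N j) \<longlonglongrightarrow> (0 :: 'c)" "\<And>N j. nm (f N j) \<le> b j" "b \<longlonglongrightarrow> 0"
  shows "(\<lambda>N. \<Sum>j\<le>N. f N j) \<longlonglongrightarrow> 0"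
  unfolding tendsto_0_nm
proof (rule LIMSEQ_I)
  fix e :: real assume e: "e > 0"
  have "eventually (\<lambda>j. b j < e / 2) sequentially"
    using assms(3) by (rule order_tendstoD(2)) (use e in simp)
  then obtain J where J: "\<And>j. j \<ge> J \<Longrightarrow> b j < e / 2" by (auto simp: eventually_sequentially)
  have "(\<lambda>N. \<Sum>j<J. f N j) \<longlonglongrightarrow> (\<Sum>j<J. 0)"
    by (intro lim_sum assms(1))
  then have "eventually (\<lambda>N. nm (\<Sum>j<J. f N j) < e / 2) sequentially"
    unfolding sum.neutral_const tendsto_0_nm by (rule order_tendstoD(2)) (use e in simp)
  then obtain N0 where N0: "\<And>N. N \<ge> N0 \<Longrightarrow> nm (\<Sum>j<J. f N j) < e / 2"
    by (auto simp: eventually_sequentially)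
  show "\<exists>N0. \<forall>N\<ge>N0. norm (nm (\<Sum>j\<le>N. f N j) - 0) < e"
  proof (intro exI[of _ "max N0 J"] allI impI)
    fix N assume N: "N \<ge> max N0 J"
    have "(\<Sum>j\<le>N. f N j) = (\<Sum>j<J. f N j) + (\<Sum>j\<in>{..N} - {..<J}. f N j)"
      by (subst sum.subset_diff[of "{..<J}"]) (use N in \<open>auto simp: add.commute\<close>)
    moreover have "nm (\<Sum>j\<in>{..N} - {..<J}. f N j) \<le> e / 2"
    proof (rule nm_sum_le)
      fix j assume "j \<in> {..N} - {..<J}"
      then have "b j < e / 2" using J by simp
      then show "nm (f N j) \<le> e / 2" using assms(2)[of N j] by linarith
    qed (use e in simp)
    ultimately have "nm (\<Sum>j\<le>N. f N j) \<le> e / 2"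
      using N0[of N] N nm_add_leI[of "\<Sum>j<J. f N j" "e / 2"] by simp
    then show "norm (nm (\<Sum>j\<le>N. f N j) - 0) < e" using e by simp
  qed
qed

lemma j_0 [simp]: "j 0 = 0"
  using j_add[of 0 0] by (simp only: add_0_right add_cancel_right_right)

lemma embed_A_add: "embed_A j (a + b) = embed_A j a + embed_A j b"
proof -
  have "map_poly fls_const (a + b) = map_poly fls_const a + map_poly fls_const b"
    by (rule poly_eqI) (simp add: coeff_map_poly fls_plus_const)
  then show ?thesis by (simp add: embed_A_def j_add)
qed

lemma embed_A_mult: "embed_A j (a * b) = embed_A j a * embed_A j b"
proof -
  have s: "fls_const (sum f A) = (\<Sum>x\<in>A. fls_const (f x :: 'a))" for f :: "nat \<Rightarrow> 'a" and A
    by (induction A rule: infinite_finite_induct) (simp_all flip: fls_plus_const)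
  have "map_poly fls_const (a * b) = map_poly fls_const a * map_poly fls_const b"
    by (rule poly_eqI) (simp add: coeff_map_poly coeff_mult s)
  then show ?thesis by (simp add: embed_A_def j_mult)
qed

lemma embed_A_1 [simp]: "embed_A j 1 = 1"
  by (simp add: embed_A_def j_one)

lemma nm_embed_const: "c \<noteq> 0 \<Longrightarrow> nm (embed_A j [:c:]) = 1"
  by (simp add: embed_A_def nm_def extends abs_infinity_def map_poly_pCons)

lemma nm_embed_theta: "nm (embed_A j theta) = real CARD('a)"
  by (simp add: embed_A_def nm_def extends abs_infinity_def map_poly_pCons)

lemma nm_embed_A: "a \<noteq> 0 \<Longrightarrow> nm (embed_A j a) = real CARD('a) ^ degree a"
proof (induction a)
  case (pCons c a)
  show ?case
  proof (cases "a = 0")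
    case True
    then show ?thesis using pCons.prems nm_embed_const[of c] by simp
  next
    case False
    have "pCons c a = [:c:] + theta * a" by simp
    then have eq: "embed_A j (pCons c a) = embed_A j [:c:] + embed_A j theta * embed_A j a"
      by (simp only: embed_A_add embed_A_mult)
    have 1: "nm (embed_A j theta * embed_A j a) = real CARD('a) ^ Suc (degree a)"
      using pCons.IH False by (simp add: nm_mult nm_embed_theta)
    have "real CARD('a) > 1" using card_finite_field_ge_2[where ?'a = 'a] by simp
    then have "real CARD('a) ^ Suc (degree a) > 1" by (intro one_less_power) auto
    moreover have "nm (embed_A j [:c:]) \<le> 1"
      using nm_embed_const[of c] by (cases "c = 0") (simp_all add: embed_A_def)
    ultimately have "nm (embed_A j [:c:]) < nm (embed_A j theta * embed_A j a)"
      unfolding 1 by linarith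
    then have "nm (embed_A j (pCons c a)) = real CARD('a) ^ Suc (degree a)"
      unfolding eq by (simp only: nm_add_eq 1)
    then show ?thesis using False by simp
  qed
qed simp

lemma poly_embedding_embed_A: "poly_embedding CARD('a) (embed_A j)"
proof
  fix a :: "'a poly" assume "a \<noteq> 0"
  then have "nm (embed_A j a) \<noteq> 0" using nm_embed_A[of a] by simp
  then show "embed_A j a \<noteq> 0" by simp
qed (simp_all add: embed_A_add embed_A_mult)

end

section \<open>The period\<close>

locale carlitz_data = C_infinity j + poly_embedding q "embed_A j"
  for j :: "'a::finite_field fls alg_closure \<Rightarrow> 'c::{field, complete_space}" and q +
  fixes lam :: 'c
  assumes lam_power: "lam ^ (q - 1) = - embed_A j theta"
begin

abbreviation qinv :: real where "qinv \<equiv> 1 / real q"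

lemma nm_th: "nm th = real q"
  by (simp add: th_def nm_embed_theta q_def)

lemma nm_emb: "a \<noteq> 0 \<Longrightarrow> nm (embed_A j a) = real q ^ degree a"
  by (simp add: nm_embed_A q_def)

lemma real_q_ge_2: "real q \<ge> 2"
  using q_ge_2 by simp

lemma less_q_power: "n < q ^ n"
  using q_ge_2 by (intro power_gt_expt) simp

lemma qinv_power_null: "(\<lambda>n. qinv ^ n) \<longlonglongrightarrow> 0"
  by (rule LIMSEQ_power_zero) (use real_q_ge_2 in simp)

lemma qinv_power_antimono: "m \<le> n \<Longrightarrow> qinv ^ n \<le> qinv ^ m"
  by (rule power_decreasing) (use real_q_ge_2 in auto)

lemma lam_th: "lam * - th = lam ^ q"
proof -
  have "q = Suc (q - 1)" by simp
  then have "lam ^ q = lam * lam ^ (q - 1)" by (metis power_Suc)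
  then show ?thesis by (simp only: lam_power th_def)
qed

lemma lam_nonzero [simp]: "lam \<noteq> 0"
proof
  assume "lam = 0"
  then have "lam ^ (q - 1) = 0"
    using q_ge_2 by (simp add: power_0_left)
  then have "- embed_A j theta = 0" using lam_power by (simp only:)
  then show False by simp
qed

text \<open>
  The terms \<open>\<theta>\<^bsup>1 - q^(i+1)\<^esup>\<close> in the product for the period, their partial products
  \<open>\<Prod> (1 - \<theta>\<^bsup>1 - q^i\<^esup>)\<close>, and the limit. As all factors have absolute value \<open>1\<close>, so has the limit.
\<close>

definition unit_term :: "nat \<Rightarrow> 'c" where "unit_term i = inverse (th ^ (q ^ Suc i - 1))"
definition unit_prod :: "nat \<Rightarrow> 'c" where "unit_prod N = (\<Prod>i<N. 1 - unit_term i)"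
definition unit_lim :: 'c where "unit_lim = lim unit_prod"

lemma th_powi: "th powi (1 - int (q ^ Suc i)) = unit_term i"
proof -
  have "q ^ Suc i > 1"
    using q_ge_2 by (intro one_less_power) auto
  then have "int (q ^ Suc i) > 1" by linarith
  moreover have "nat (- (1 - int (q ^ Suc i))) = q ^ Suc i - 1"
    by (simp add: nat_diff_distrib del: power_Suc of_nat_power)
  ultimately show ?thesis
    unfolding power_int_def unit_term_def power_inverse by (simp del: power_Suc of_nat_power)
qed

lemma nm_unit_term: "nm (unit_term i) \<le> qinv ^ Suc i"
proof -
  have "nm (unit_term i) = qinv ^ (q ^ Suc i - 1)"
    by (simp add: unit_term_def nm_divide nm_power nm_th power_one_over inverse_eq_divide del: power_Suc)
  also have "\<dots> \<le> qinv ^ Suc i"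
    by (rule qinv_power_antimono) (use less_q_power[of "Suc i"] in linarith)
  finally show ?thesis .
qed

lemma nm_one_minus_unit_term [simp]: "nm (1 - unit_term i) = 1"
proof -
  have "qinv ^ Suc i < 1"
    using real_q_ge_2 by (intro power_Suc_less_one) auto
  then have "nm (unit_term i) < 1" using nm_unit_term[of i] by (rule le_less_trans[rotated])
  then have "nm (- unit_term i) < nm (1 :: 'c)" by simp
  from nm_add_eq[OF this] show ?thesis by simp
qed

lemma nm_unit_prod [simp]: "nm (unit_prod N) = 1"
  by (simp add: unit_prod_def nm_prod)

lemma unit_prod_lim: "unit_prod \<longlonglongrightarrow> unit_lim"
proof -
  have "convergent unit_prod"
  proof (rule convergentI, rule lim_null_le)
    fix n
    have "unit_prod (Suc n) - unit_prod n = - (unit_prod n * unit_term n)" by (simp add: unit_prod_def algebra_simps)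
    then have "nm (unit_prod (Suc n) - unit_prod n) = nm (unit_term n)"
      by (simp only: nm_minus nm_mult nm_unit_prod mult_1_left)
    also have "\<dots> \<le> qinv ^ n"
      by (rule order_trans[OF nm_unit_term qinv_power_antimono]) simp
    finally show "nm (unit_prod (Suc n) - unit_prod n) \<le> qinv ^ n" .
  qed (rule qinv_power_null)
  then show ?thesis by (simp add: unit_lim_def convergent_LIMSEQ_iff)
qed

lemma nm_unit_lim [simp]: "nm unit_lim = 1"
  using lim_nm[OF unit_prod_lim] by (simp add: LIMSEQ_const_iff)

lemma unit_lim_nonzero [simp]: "unit_lim \<noteq> 0"
  using nm_unit_lim by force

lemma unit_prod_nonzero [simp]: "unit_prod n \<noteq> 0"
  using nm_unit_prod[of n] by force

definition period :: 'c where "period = carlitz_period j lam"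

lemma period_eq: "period = th * lam / unit_lim"
proof -
  let ?f = "\<lambda>i. inverse (1 - embed_A j theta powi (1 - int (q ^ Suc i)))"
  have f: "?f = (\<lambda>i. inverse (1 - unit_term i))"
    unfolding th_def[symmetric] th_powi ..
  have "(\<lambda>n. \<Prod>i\<le>n. inverse (1 - unit_term (i + 0))) = (\<lambda>n. inverse (unit_prod (Suc n)))"
    by (simp add: unit_prod_def prod_inversef[unfolded comp_def] lessThan_Suc_atMost)
  moreover have "(\<lambda>n. inverse (unit_prod (Suc n))) \<longlonglongrightarrow> inverse unit_lim"
    by (rule lim_inverse[OF LIMSEQ_Suc[OF unit_prod_lim]]) simp
  ultimately have "raw_has_prod (\<lambda>i. inverse (1 - unit_term i)) 0 (inverse unit_lim)"
    by (simp add: raw_has_prod_def)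
  then have "?f has_prod inverse unit_lim" unfolding f by (simp add: has_prod_def)
  then have "prodinf ?f = inverse unit_lim" by (rule has_prod_unique[symmetric])
  then show ?thesis by (simp add: period_def carlitz_period_def th_def divide_inverse flip: q_def)
qed

lemma period_nonzero [simp]: "period \<noteq> 0"
  by (simp add: period_eq)

text \<open>
  \<open>(q\<^sup>n - 1) / (q - 1)\<close>
\<close>

definition geom :: "nat \<Rightarrow> nat" where "geom n = (\<Sum>i<n. q ^ i)"

lemma geom_Suc: "geom (Suc n) = 1 + q * geom n"
  unfolding geom_def sum.lessThan_Suc_shift by (simp add: sum_distrib_left)

lemma geom_Suc': "geom (Suc n) = geom n + q ^ n"
  by (simp add: geom_def)

lemma geom_add: "geom (m + n) = geom m + q ^ m * geom n"
  by (induction n) (simp_all add: geom_Suc' power_add algebra_simps, simp add: geom_def)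

lemma geom_le: "geom n \<le> q ^ n"
proof (induction n)
  case (Suc n)
  have "geom (Suc n) \<le> 2 * q ^ n" using Suc by (simp add: geom_Suc')
  also have "\<dots> \<le> q ^ Suc n" using q_ge_2 by simp
  finally show ?case .
qed (simp add: geom_def)

lemma lam_frob: "lam ^ (q ^ n) = (- th) ^ geom n * lam"
proof (induction n)
  case (Suc n)
  have "lam ^ (q ^ Suc n) = (lam ^ (q ^ n)) ^ q"
    by (simp only: power_Suc2 power_mult)
  also have "\<dots> = (- th) ^ (geom n * q) * lam ^ q"
    by (simp add: Suc power_mult_distrib power_mult)
  also have "\<dots> = (- th) ^ geom (Suc n) * lam"
    by (simp add: lam_th[symmetric] geom_Suc mult.commute)
  finally show ?case .
qed (simp add: geom_def)

lemma neg_one_frob: "((- 1 :: 'c) ^ k) ^ (q ^ n) = (- 1) ^ k"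
proof -
  have "((- 1 :: 'c) ^ k) ^ (q ^ n) = ((- 1) ^ (q ^ n)) ^ k"
    by (simp add: power_mult[symmetric] mult.commute)
  then show ?thesis by (simp add: frob_minus)
qed

lemma ll_formula: "ll N = (- 1) ^ N * th ^ (q * geom N) * unit_prod N"
proof (induction N)
  case (Suc N)
  have "th ^ (q ^ Suc N) * unit_term N = th"
  proof -
    have "q ^ Suc N = Suc (q ^ Suc N - 1)" using q_pos by simp
    then have "th ^ (q ^ Suc N) = th * th ^ (q ^ Suc N - 1)" by (metis power_Suc)
    then show ?thesis by (simp add: unit_term_def del: power_Suc)
  qed
  then have "th - th ^ (q ^ Suc N) = - (th ^ (q ^ Suc N) * (1 - unit_term N))"
    by (simp add: algebra_simps)
  then have "ll (Suc N) = - (th ^ (q ^ Suc N) * (1 - unit_term N)) * ((- 1) ^ N * th ^ (q * geom N) * unit_prod N)"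
    by (simp only: ll_Suc Suc)
  also have "\<dots> = (- 1) ^ Suc N * th ^ (q * geom (Suc N)) * unit_prod (Suc N)"
    by (simp add: geom_Suc' unit_prod_def power_add algebra_simps)
  finally show ?case .
qed (simp add: geom_def unit_prod_def)

text \<open>
  The coefficient of \<open>z\<^bsup>q^k\<^esup>\<close> in \<open>l\<^sub>N bin N(z)\<close>, multiplied by \<open>d\<^sub>k\<close>. The powers of \<open>\<theta>\<close> that would depend on
  \<open>N\<close> cancel (\<open>coeff_ratio_formula\<close>), and what remains tends to \<open>\<pi>\<^bsup>q^k - 1\<^esup>\<close>.
\<close>

definition coeff_ratio :: "nat \<Rightarrow> nat \<Rightarrow> 'c" where "coeff_ratio N k = ll N / ll (N - k) ^ (q ^ k)"

lemma coeff_ratio_formula: "k \<le> N \<Longrightarrow> coeff_ratio N k = (- 1) ^ k * th ^ (q * geom k) * (unit_prod N / unit_prod (N - k) ^ (q ^ k))"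
proof -
  assume "k \<le> N"
  then obtain n where N: "N = k + n" using le_Suc_ex by blast
  have 1: "ll n ^ (q ^ k) = (- 1) ^ n * th ^ (q * geom n * q ^ k) * unit_prod n ^ (q ^ k)"
    unfolding ll_formula power_mult_distrib neg_one_frob power_mult[of th "q * geom n" "q ^ k"] ..
  have 2: "th ^ (q * geom (k + n)) = th ^ (q * geom k) * th ^ (q * geom n * q ^ k)"
    unfolding geom_add power_add[symmetric] by (simp add: distrib_left mult.commute mult.left_commute)
  show ?thesis
    unfolding coeff_ratio_def N diff_add_inverse 1 ll_formula[of "k + n"] 2 power_add[of "- 1"] by simp
qed

lemma nm_coeff_ratio: "k \<le> N \<Longrightarrow> nm (coeff_ratio N k) = real q ^ (q * geom k)"
  by (simp add: coeff_ratio_formula nm_mult nm_divide nm_power nm_th)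

lemma neg_one_geom: "(- 1 :: 'c) ^ geom k = (- 1) ^ k"
proof (induction k)
  case (Suc k)
  have "(- 1 :: 'c) ^ (q * geom k) = ((- 1) ^ geom k) ^ (q ^ 1)"
    by (simp only: power_one_right power_mult[symmetric] mult.commute)
  then have "(- 1 :: 'c) ^ geom (Suc k) = - (((- 1) ^ geom k) ^ (q ^ 1))"
    by (simp only: geom_Suc power_add power_one_right mult_minus1)
  also have "\<dots> = (- 1) ^ Suc k" by (simp only: Suc neg_one_frob) simp
  finally show ?case .
qed (simp add: geom_def)

lemma period_frob: "period ^ (q ^ k) = period * ((- 1) ^ k * th ^ (q * geom k) * (unit_lim / unit_lim ^ (q ^ k)))"
proof -
  have e: "q ^ k + geom k = Suc (q * geom k)"
    using geom_Suc[of k] geom_Suc'[of k] by linarith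
  have t: "th ^ (q ^ k) * th ^ geom k = th * th ^ (q * geom k)"
    unfolding power_add[symmetric] e power_Suc ..
  have l: "lam ^ (q ^ k) = (- 1) ^ k * th ^ geom k * lam"
    unfolding lam_frob power_minus[of th] neg_one_geom ..
  have "th ^ (q ^ k) * ((- 1) ^ k * th ^ geom k * lam) = (- 1) ^ k * lam * (th ^ (q ^ k) * th ^ geom k)"
    by (simp only: mult_ac)
  then have "period ^ (q ^ k) = (- 1) ^ k * lam * (th * th ^ (q * geom k)) / unit_lim ^ (q ^ k)"
    unfolding period_eq power_divide power_mult_distrib l t by (simp only:)
  moreover have "t * l / u * (a * T * (u / W)) = a * l * (t * T) / W" if "u \<noteq> 0" for t l u a T W :: 'c
    using that by simp
  ultimately show ?thesis
    unfolding period_eq[THEN arg_cong[where f = "\<lambda>x. x * _"]] by (simp only: unit_lim_nonzero simp_thms)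
qed

lemma coeff_ratio_lim: "(\<lambda>N. coeff_ratio N k) \<longlonglongrightarrow> period ^ (q ^ k) / period"
proof -
  have "(\<lambda>N. (- 1) ^ k * th ^ (q * geom k) * (unit_prod (N + k) * inverse (unit_prod N ^ (q ^ k))))
      \<longlonglongrightarrow> (- 1) ^ k * th ^ (q * geom k) * (unit_lim * inverse (unit_lim ^ (q ^ k)))"
    by (intro lim_cmult lim_mult lim_inverse lim_power LIMSEQ_ignore_initial_segment unit_prod_lim) simp
  then have "(\<lambda>N. coeff_ratio (N + k) k) \<longlonglongrightarrow> (- 1) ^ k * th ^ (q * geom k) * (unit_lim / unit_lim ^ (q ^ k))"
    by (simp add: coeff_ratio_formula divide_inverse)
  then have "(\<lambda>N. coeff_ratio N k) \<longlonglongrightarrow> (- 1) ^ k * th ^ (q * geom k) * (unit_lim / unit_lim ^ (q ^ k))"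
    by (rule LIMSEQ_offset)
  then show ?thesis by (simp add: period_frob)
qed

lemma nm_dd: "nm (dd n) = real q ^ (n * q ^ n)"
proof (induction n)
  case (Suc n)
  have "nm (th ^ (q ^ Suc n) - th) = real q ^ (q ^ Suc n)"
  proof -
    have "real q ^ 1 < real q ^ (q ^ Suc n)"
      using real_q_ge_2 one_less_power[of q "Suc n"] by (intro power_strict_increasing) auto
    then have "nm (- th) < nm (th ^ (q ^ Suc n))" by (simp add: nm_power nm_th del: power_Suc)
    from nm_add_eq[OF this] show ?thesis by (simp add: nm_power nm_th del: power_Suc)
  qed
  then have "nm (dd (Suc n)) = real q ^ (q ^ Suc n) * (real q ^ (n * q ^ n)) ^ q"
    by (simp only: dd_Suc nm_mult nm_power Suc)
  also have "\<dots> = real q ^ (Suc n * q ^ Suc n)"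
    by (simp flip: power_mult power_add) (simp add: algebra_simps)
  finally show ?case .
qed simp

text \<open>
  In the limit, \<open>l\<^sub>N bin N(x) = x \<Prod> (1 - x / a)\<close> becomes \<open>exp(\<pi> x) / \<pi>\<close>. If \<open>x\<close> is not in \<open>A\<close>, no factor vanishes, and
  all factors with \<open>|a| > |x|\<close> have absolute value \<open>1\<close>; so the product stays away from \<open>0\<close>.
\<close>

lemma exp_zero_imp_integral:
  assumes "(\<lambda>M. \<Sum>n\<le>M. (period * x) ^ (q ^ n) / dd n) \<longlonglongrightarrow> 0"
  shows "x \<in> range (embed_A j)"
proof (rule ccontr)
  assume x: "x \<notin> range (embed_A j)"
  define f where "f N n = (if n \<le> N then (period * coeff_ratio N n - period ^ (q ^ n)) * x ^ (q ^ n) / dd n else 0)" for N n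
  define b where "b n = nm period * (nm x * real q ^ 2 / real q ^ n) ^ (q ^ n)" for n
  have "(\<lambda>N. \<Sum>n\<le>N. f N n) \<longlonglongrightarrow> 0"
  proof (rule lim_dominated_sum)
    fix n
    have "(\<lambda>N. (x ^ (q ^ n) / dd n) * (period * coeff_ratio N n - period ^ (q ^ n))) \<longlonglongrightarrow>
        (x ^ (q ^ n) / dd n) * (period * (period ^ (q ^ n) / period) - period ^ (q ^ n))"
      by (intro lim_cmult lim_diff coeff_ratio_lim tendsto_const)
    then have "(\<lambda>N. (period * coeff_ratio N n - period ^ (q ^ n)) * x ^ (q ^ n) / dd n) \<longlonglongrightarrow> 0"
      by (simp add: mult.commute)
    moreover have "eventually (\<lambda>N. (period * coeff_ratio N n - period ^ (q ^ n)) * x ^ (q ^ n) / dd n = f N n) sequentially"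
      using eventually_ge_at_top[of n] by eventually_elim (simp add: f_def)
    ultimately show "(\<lambda>N. f N n) \<longlonglongrightarrow> 0" by (rule Lim_transform_eventually)
  next
    fix N n
    show "nm (f N n) \<le> b n"
    proof (cases "n \<le> N")
      case True
      have "nm (period ^ (q ^ n)) = nm (period * coeff_ratio N n)"
        by (simp add: period_frob nm_mult nm_divide nm_coeff_ratio[OF True] nm_power nm_th)
      then have "nm (period * coeff_ratio N n - period ^ (q ^ n)) \<le> nm (period * coeff_ratio N n)"
        by (intro nm_diff_leI) auto
      also have "\<dots> = nm period * real q ^ (q * geom n)" by (simp add: nm_mult nm_coeff_ratio[OF True])
      also have "\<dots> \<le> nm period * real q ^ (2 * q ^ n)"
      proof (intro mult_left_mono power_increasing)
        have "q * geom n < q ^ n + geom n" using geom_Suc[of n] geom_Suc'[of n] by simp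
        then show "q * geom n \<le> 2 * q ^ n" using geom_le[of n] by simp
      qed (use real_q_ge_2 in auto)
      finally have "nm (f N n) \<le> nm period * real q ^ (2 * q ^ n) * nm x ^ (q ^ n) / real q ^ (n * q ^ n)"
        using True by (simp add: f_def nm_divide nm_mult nm_power nm_dd divide_right_mono mult_right_mono)
      also have "\<dots> = b n"
        by (simp add: b_def power_divide power_mult_distrib power_mult)
      finally show ?thesis .
    qed (simp add: f_def b_def)
  next
    have "(\<lambda>n. nm period * (nm x * real q ^ 2 * qinv ^ n)) \<longlonglongrightarrow> nm period * (nm x * real q ^ 2 * 0)"
      by (intro tendsto_mult tendsto_const qinv_power_null)
    then have lim: "(\<lambda>n. nm period * (nm x * real q ^ 2 * qinv ^ n)) \<longlonglongrightarrow> 0" by simp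
    have lim1: "(\<lambda>n. nm x * real q ^ 2 * qinv ^ n) \<longlonglongrightarrow> 0"
      using tendsto_mult[OF tendsto_const[of "nm x * real q ^ 2"] qinv_power_null] by simp
    show "b \<longlonglongrightarrow> 0"
    proof (rule tendsto_sandwich[OF _ _ tendsto_const lim])
      show "eventually (\<lambda>n. 0 \<le> b n) sequentially" by (simp add: b_def)
      have "eventually (\<lambda>n. nm x * real q ^ 2 * qinv ^ n < 1) sequentially"
        using lim1 by (rule order_tendstoD(2)) simp
      then show "eventually (\<lambda>n. b n \<le> nm period * (nm x * real q ^ 2 * qinv ^ n)) sequentially"
      proof eventually_elim
        case (elim n)
        define y where "y = nm x * real q ^ 2 * qinv ^ n"
        have "y ^ (q ^ n) \<le> y ^ 1"
          by (rule power_decreasing) (use elim in \<open>auto simp: y_def Suc_leI\<close>)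
        moreover have "b n = nm period * y ^ (q ^ n)"
          by (simp add: b_def y_def power_one_over)
        ultimately show ?case by (simp add: y_def[symmetric] mult_left_mono)
      qed
    qed
  qed
  moreover have "(\<Sum>n\<le>N. f N n) = period * (ll N * bin N x) - (\<Sum>n\<le>N. (period * x) ^ (q ^ n) / dd n)" for N
  proof -
    have "(\<Sum>n\<le>N. f N n) = (\<Sum>n\<le>N. period * (coeff_ratio N n * x ^ (q ^ n) / dd n) - (period * x) ^ (q ^ n) / dd n)"
      by (intro sum.cong) (auto simp: f_def algebra_simps diff_divide_distrib power_mult_distrib)
    also have "\<dots> = period * (\<Sum>n\<le>N. coeff_ratio N n * x ^ (q ^ n) / dd n) - (\<Sum>n\<le>N. (period * x) ^ (q ^ n) / dd n)"
      by (simp add: sum_subtractf sum_distrib_left)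
    also have "(\<Sum>n\<le>N. coeff_ratio N n * x ^ (q ^ n) / dd n) = ll N * bin N x"
      by (simp add: bin_def sum_distrib_left coeff_ratio_def mult_ac)
    finally show ?thesis .
  qed
  ultimately have "(\<lambda>N. period * (ll N * bin N x)) \<longlonglongrightarrow> 0"
    using lim_add[OF _ assms, of "\<lambda>N. \<Sum>n\<le>N. f N n" 0] by simp
  then have "(\<lambda>N. inverse period * (period * (ll N * bin N x))) \<longlonglongrightarrow> 0"
    by (rule lim_cmult_null)
  then have null: "(\<lambda>N. nm (ll N * bin N x)) \<longlonglongrightarrow> 0"
    unfolding tendsto_0_nm by (simp flip: mult.assoc)
  obtain N0 where N0: "nm x < real q ^ N0"
    using real_arch_pow[of "real q" "nm x"] real_q_ge_2 by auto
  define c where "c = nm (ll N0 * bin N0 x)"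
  have "nm (ll N * bin N x) = c" if "N \<ge> N0" for N
  proof -
    have "(\<Prod>a\<in>polys_below N - {0}. nm (1 - x / embed_A j a)) = (\<Prod>a\<in>polys_below N0 - {0}. nm (1 - x / embed_A j a))"
    proof (rule prod.mono_neutral_right)
      show "polys_below N0 - {0 :: 'a poly} \<subseteq> polys_below N - {0}"
        using that by (auto simp: polys_below_def)
      show "\<forall>a\<in>polys_below N - {0} - (polys_below N0 - {0}). nm (1 - x / embed_A j a) = 1"
      proof
        fix a :: "'a poly" assume "a \<in> polys_below N - {0} - (polys_below N0 - {0})"
        then have a: "a \<noteq> 0" "degree a \<ge> N0" by (auto simp: polys_below_degree)
        then have "real q ^ N0 \<le> nm (embed_A j a)"
          using real_q_ge_2 by (simp add: nm_emb power_increasing)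
        then have "nm x < nm (embed_A j a)" using N0 by linarith
        then have "nm (- (x / embed_A j a)) < nm (1 :: 'c)"
          using a by (simp add: nm_divide)
        from nm_add_eq[OF this] show "nm (1 - x / embed_A j a) = 1" by simp
      qed
    qed simp
    then show ?thesis by (simp add: c_def ll_bin_eq_prod nm_mult nm_prod)
  qed
  then have "eventually (\<lambda>N. nm (ll N * bin N x) = c) sequentially"
    by (auto simp: eventually_sequentially)
  then have "(\<lambda>N. c) \<longlonglongrightarrow> 0"
    by (rule Lim_transform_eventually[OF null])
  then have "c = 0" by (simp add: LIMSEQ_const_iff)
  then have "x = 0 \<or> (\<exists>a\<in>polys_below N0 - {0}. 1 - x / embed_A j a = 0)"
    by (simp add: c_def ll_bin_eq_prod)
  then show False
  proof
    assume "x = 0"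
    then show False using x emb_0 by (metis rangeI)
  next
    assume "\<exists>a\<in>polys_below N0 - {0}. 1 - x / embed_A j a = 0"
    then obtain a where "a \<noteq> 0" "x / embed_A j a = 1" by auto
    then have "x = embed_A j a" by (simp add: field_simps)
    then show False using x by blast
  qed
qed

section \<open>Carlitz's formula for the values at positive integers\<close>

text \<open>
  \<open>exp(z) / z\<close>
\<close>

definition exp_quot :: "'c fps" where
  "exp_quot = Abs_fps (\<lambda>k. \<Sum>n | Suc k = q ^ n. 1 / dd n)"

lemma exp_quot_nth: "fps_nth exp_quot (q ^ n - 1) = 1 / dd n"
proof -
  have "{m. Suc (q ^ n - 1) = q ^ m} = {n}"
    by (auto simp: Suc_pred' intro: q_power_inj[THEN iffD1])
  then show ?thesis by (simp add: exp_quot_def)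
qed

lemma exp_quot_nth_0: "(\<And>n. k \<noteq> q ^ n - 1) \<Longrightarrow> fps_nth exp_quot k = 0"
proof -
  assume k: "\<And>n. k \<noteq> q ^ n - 1"
  have "Suc k \<noteq> q ^ n" for n using k[of n] by (metis diff_Suc_1)
  then have "{n. Suc k = q ^ n} = {}" by blast
  then show ?thesis by (simp add: exp_quot_def)
qed

lemma exp_trunc_nth_lim: "(\<lambda>N. fps_nth (exp_trunc N) k) \<longlonglongrightarrow> period ^ k * fps_nth exp_quot k"
proof (cases "\<exists>n. k = q ^ n - 1")
  case True
  then obtain n where k: "k = q ^ n - 1" by blast
  have inj: "q ^ j - 1 = q ^ n - 1 \<longleftrightarrow> j = n" for j
  proof
    assume "q ^ j - 1 = q ^ n - 1"
    moreover have "q ^ j > 0" "q ^ n > 0" by simp_all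
    ultimately have "q ^ j = q ^ n" by linarith
    then show "j = n" by simp
  qed simp
  have eq: "fps_nth (exp_trunc N) k = coeff_ratio N n * (1 / dd n)" if "N \<ge> n" for N
  proof -
    have "fps_nth (exp_trunc N) k = (\<Sum>j\<le>N. if j = n then coeff_ratio N j * (1 / dd j) else 0)"
      unfolding exp_trunc_def fps_sum_nth
    proof (intro sum.cong refl)
      fix j
      show "fps_nth (fps_const (ll N / (dd j * ll (N - j) ^ (q ^ j))) * fps_X ^ (q ^ j - 1)) k =
          (if j = n then coeff_ratio N j * (1 / dd j) else 0)"
        using inj[of j] by (auto simp: k coeff_ratio_def fps_X_power_nth)
    qed
    then show ?thesis using that by simp
  qed
  have eval_box: "eventually (\<lambda>N. coeff_ratio N n * (1 / dd n) = fps_nth (exp_trunc N) k) sequentially"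
    using eventually_ge_at_top[of n] by eventually_elim (rule eq[symmetric])
  have "(\<lambda>N. coeff_ratio N n * (1 / dd n)) \<longlonglongrightarrow> period ^ (q ^ n) / period * (1 / dd n)"
    by (intro lim_mult coeff_ratio_lim tendsto_const)
  then have lim: "(\<lambda>N. fps_nth (exp_trunc N) k) \<longlonglongrightarrow> period ^ (q ^ n) / period * (1 / dd n)"
    using eval_box by (rule Lim_transform_eventually)
  have "q ^ n = Suc k" by (simp add: k)
  then have "period ^ (q ^ n) / period = period ^ k" by simp
  moreover have "fps_nth exp_quot k = 1 / dd n" unfolding k by (rule exp_quot_nth)
  ultimately show ?thesis using lim by (simp only:)
next
  case False
  then have "fps_nth (exp_trunc N) k = 0" for N
    by (auto simp: exp_trunc_def fps_sum_nth intro!: sum.neutral)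
  then show ?thesis using False by (simp add: exp_quot_nth_0)
qed

lemma fps_inverse_nth_lim:
  fixes f :: "nat \<Rightarrow> 'c fps"
  assumes "\<And>k. (\<lambda>N. fps_nth (f N) k) \<longlonglongrightarrow> fps_nth g k" "fps_nth g 0 \<noteq> 0"
  shows "(\<lambda>N. fps_nth (inverse (f N)) k) \<longlonglongrightarrow> fps_nth (inverse g) k"
proof (induction k rule: less_induct)
  case (less k)
  show ?case
  proof (cases k)
    case 0
    then show ?thesis using lim_inverse[OF assms(1)[of 0] assms(2)] by simp
  next
    case (Suc k')
    have "fps_nth (inverse h) k = - inverse (fps_nth h 0) * (\<Sum>i=1..k. fps_nth h i * fps_nth (inverse h) (k - i))" for h :: "'c fps"
      using Suc by (simp add: fps_inverse_def sum_negf)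
    then show ?thesis
      by (simp only:) (intro lim_mult lim_minus lim_inverse lim_sum assms less.IH; use assms in auto)
  qed
qed

text \<open>
  Let \<open>N\<close> tend to infinity in \<open>monic_power_sum\<close>; inversion of power series is continuous in each coefficient.
\<close>

lemma carlitz_zeta:
  assumes "n > 0" "(q - 1) dvd n"
  shows "(\<lambda>N. \<Sum>d<N. \<Sum>a\<in>monics d. 1 / embed_A j a ^ n) \<longlonglongrightarrow> period ^ n * fps_nth (inverse exp_quot) n"
proof -
  have 0: "fps_nth exp_quot 0 = 1" using exp_quot_nth[of 0] by simp
  have "Abs_fps (\<lambda>k. period ^ k * fps_nth exp_quot k) * Abs_fps (\<lambda>k. period ^ k * fps_nth (inverse exp_quot) k) = 1"
  proof (rule fps_ext)
    fix k
    have "period ^ k * fps_nth (exp_quot * inverse exp_quot) k =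
       fps_nth (Abs_fps (\<lambda>k. period ^ k * fps_nth exp_quot k) * Abs_fps (\<lambda>k. period ^ k * fps_nth (inverse exp_quot) k)) k"
      unfolding fps_mult_nth sum_distrib_left
    proof (intro sum.cong refl)
      fix i assume "i \<in> {0..k}"
      then have "period ^ k = period ^ i * period ^ (k - i)" by (simp flip: power_add)
      then show "period ^ k * (fps_nth exp_quot i * fps_nth (inverse exp_quot) (k - i)) =
          fps_nth (Abs_fps (\<lambda>k. period ^ k * fps_nth exp_quot k)) i * fps_nth (Abs_fps (\<lambda>k. period ^ k * fps_nth (inverse exp_quot) k)) (k - i)"
        by simp
    qed
    moreover have "exp_quot * inverse exp_quot = 1"
      using 0 by (simp add: inverse_mult_eq_1')
    ultimately have "fps_nth (Abs_fps (\<lambda>k. period ^ k * fps_nth exp_quot k) * Abs_fps (\<lambda>k. period ^ k * fps_nth (inverse exp_quot) k)) k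
        = period ^ k * fps_nth 1 k"
      by (simp only:)
    also have "\<dots> = fps_nth 1 k" by (cases k) simp_all
    finally show "fps_nth (Abs_fps (\<lambda>k. period ^ k * fps_nth exp_quot k) * Abs_fps (\<lambda>k. period ^ k * fps_nth (inverse exp_quot) k)) k = fps_nth 1 k" .
  qed
  then have "inverse (Abs_fps (\<lambda>k. period ^ k * fps_nth exp_quot k)) = Abs_fps (\<lambda>k. period ^ k * fps_nth (inverse exp_quot) k)"
    by (rule fps_inverse_unique)
  moreover have "(\<lambda>N. fps_nth (inverse (exp_trunc N)) n) \<longlonglongrightarrow> fps_nth (inverse (Abs_fps (\<lambda>k. period ^ k * fps_nth exp_quot k))) n"
    by (rule fps_inverse_nth_lim) (simp_all add: exp_trunc_nth_lim 0)
  ultimately show ?thesis by (simp add: monic_power_sum[OF assms])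
qed

end

section \<open>The Anderson--Thakur function\<close>

context carlitz_data
begin

definition fps_small :: "'c fps \<Rightarrow> bool" where
  "fps_small f \<longleftrightarrow> (\<forall>k. nm (fps_nth f k) \<le> qinv ^ k)"

lemma fps_small_mult: "fps_small f \<Longrightarrow> fps_small g \<Longrightarrow> fps_small (f * g)"
  unfolding fps_small_def
proof (intro allI)
  fix n assume f: "\<forall>k. nm (fps_nth f k) \<le> qinv ^ k" and g: "\<forall>k. nm (fps_nth g k) \<le> qinv ^ k"
  show "nm (fps_nth (f * g) n) \<le> qinv ^ n"
    unfolding fps_mult_nth
  proof (rule nm_sum_le)
    fix i assume "i \<in> {0..n}"
    then have "qinv ^ n = qinv ^ i * qinv ^ (n - i)"
      by (simp flip: power_add)
    then show "nm (fps_nth f i * fps_nth g (n - i)) \<le> qinv ^ n"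
      using f g by (simp only: nm_mult) (intro mult_mono, auto)
  qed simp
qed

lemma fps_small_1 [simp]: "fps_small 1"
  by (simp add: fps_small_def)

lemma fps_small_prod: "(\<And>i. i \<in> A \<Longrightarrow> fps_small (f i)) \<Longrightarrow> fps_small (prod f A)"
  by (induction A rule: infinite_finite_induct) (auto intro: fps_small_mult)

lemma fps_small_nth_le_1: "fps_small f \<Longrightarrow> nm (fps_nth f k) \<le> 1"
proof -
  assume "fps_small f"
  then have "nm (fps_nth f k) \<le> qinv ^ k" by (simp add: fps_small_def)
  also have "\<dots> \<le> qinv ^ 0" by (rule qinv_power_antimono) simp
  finally show ?thesis by simp
qed

text \<open>
  The limits are taken coefficientwise, because in the \<open>X\<close>-adic metric on power series these products diverge.
\<close>

definition fps_lim :: "(nat \<Rightarrow> 'c fps) \<Rightarrow> 'c fps" where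
  "fps_lim f = Abs_fps (\<lambda>k. lim (\<lambda>N. fps_nth (f N) k))"

lemma fps_prod_lim:
  assumes "\<And>i. fps_small (g i)" "\<And>i k. nm (fps_nth (g i - 1) k) \<le> qinv ^ i"
  shows "(\<lambda>N. fps_nth (\<Prod>i<N. g i) k) \<longlonglongrightarrow> fps_nth (fps_lim (\<lambda>N. \<Prod>i<N. g i)) k"
proof -
  have "convergent (\<lambda>N. fps_nth (\<Prod>i<N. g i) k)"
  proof (rule convergentI, rule lim_null_le)
    fix N
    have "(\<Prod>i<Suc N. g i) - (\<Prod>i<N. g i) = (\<Prod>i<N. g i) * (g N - 1)"
      by (simp add: algebra_simps)
    then have "fps_nth (\<Prod>i<Suc N. g i) k - fps_nth (\<Prod>i<N. g i) k = fps_nth ((\<Prod>i<N. g i) * (g N - 1)) k"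
      by (simp only: fps_sub_nth[symmetric])
    also have "nm \<dots> \<le> qinv ^ N"
      unfolding fps_mult_nth
    proof (rule nm_sum_le)
      fix i
      have "nm (fps_nth (\<Prod>i<N. g i) i) \<le> 1"
        by (intro fps_small_nth_le_1 fps_small_prod assms(1))
      then have "nm (fps_nth (\<Prod>i<N. g i) i) * nm (fps_nth (g N - 1) (k - i)) \<le> 1 * qinv ^ N"
        by (intro mult_mono assms(2)) auto
      then show "nm (fps_nth (\<Prod>i<N. g i) i * fps_nth (g N - 1) (k - i)) \<le> qinv ^ N"
        by (simp add: nm_mult)
    qed simp
    finally show "nm (fps_nth (\<Prod>i<Suc N. g i) k - fps_nth (\<Prod>i<N. g i) k) \<le> qinv ^ N" .
  qed (rule qinv_power_null)
  then show ?thesis by (simp add: fps_lim_def convergent_LIMSEQ_iff)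
qed

lemma fps_small_lim:
  assumes "\<And>k. (\<lambda>N. fps_nth (f N) k) \<longlonglongrightarrow> fps_nth g k" "\<And>N. fps_small (f N)"
  shows "fps_small g"
  using lim_nm_le[OF assms(1)] assms(2) unfolding fps_small_def by blast

text \<open>
  \<open>\<theta>\<^bsup>q^i\<^esup>\<close>, the inverse of \<open>inv_pole i\<close>, is the \<open>i\<close>-th pole of \<open>\<omega>\<close>.
\<close>

definition inv_pole :: "nat \<Rightarrow> 'c" where "inv_pole i = 1 / th ^ (q ^ i)"

lemma nm_inv_pole: "nm (inv_pole i) \<le> qinv ^ Suc i"
proof -
  have "nm (inv_pole i) = qinv ^ (q ^ i)"
    by (simp add: inv_pole_def nm_divide nm_power nm_th power_one_over)
  also have "\<dots> \<le> qinv ^ Suc i"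
    by (rule qinv_power_antimono) (use less_q_power[of i] in linarith)
  finally show ?thesis .
qed

lemma inv_pole_frob: "inv_pole i ^ (q ^ n) = inv_pole (i + n)"
  by (simp add: inv_pole_def power_divide frob_frob)

definition pole_factor :: "nat \<Rightarrow> 'c fps" where "pole_factor i = 1 - fps_const (inv_pole i) * fps_X"

lemma pole_factor_nth: "fps_nth (pole_factor i) k = (if k = 0 then 1 else if k = 1 then - inv_pole i else 0)"
  by (cases k) (auto simp: pole_factor_def)

lemma pole_factor_inverse_nth: "fps_nth (inverse (pole_factor i)) k = inv_pole i ^ k"
  by (simp add: pole_factor_def inverse_one_minus_const_X)

lemma pole_factor_mult_inverse: "pole_factor i * inverse (pole_factor i) = 1"
  by (rule inverse_mult_eq_1') (simp add: pole_factor_nth)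

lemma inv_pole_power_le: "nm (inv_pole i ^ k) \<le> qinv ^ (Suc i * k)"
  unfolding nm_power power_mult using nm_inv_pole by (intro power_mono) auto

lemma fps_small_pole_factor: "fps_small (pole_factor i)"
  unfolding fps_small_def
proof
  fix k
  show "nm (fps_nth (pole_factor i) k) \<le> qinv ^ k"
    using inv_pole_power_le[of i 1] qinv_power_antimono[of 1 "Suc i"] by (auto simp: pole_factor_nth)
qed

lemma fps_small_pole_factor_inverse: "fps_small (inverse (pole_factor i))"
  unfolding fps_small_def pole_factor_inverse_nth
  by (intro allI order_trans[OF inv_pole_power_le] qinv_power_antimono) simp

lemma pole_factor_minus_1_le: "nm (fps_nth (pole_factor i - 1) k) \<le> qinv ^ i"
  using inv_pole_power_le[of i 1] qinv_power_antimono[of i "Suc i"] by (auto simp: pole_factor_nth)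

lemma pole_factor_inverse_minus_1_le: "nm (fps_nth (inverse (pole_factor i) - 1) k) \<le> qinv ^ i"
proof (cases k)
  case (Suc k')
  then show ?thesis
    using order_trans[OF inv_pole_power_le[of i k] qinv_power_antimono[of i]] by (simp add: pole_factor_inverse_nth)
qed (simp add: pole_factor_nth)

text \<open>
  \<open>pole_prod d = \<Prod>\<^sub>i\<^sub>\<ge>\<^sub>d (1 - t / \<theta>\<^bsup>q^i\<^esup>)\<close>, up to a constant the inverse of the twist of \<open>\<omega>\<close> by \<open>q\<^sup>d\<close>. The inverse for
  \<open>d = 0\<close> is defined by its own limit, as in the definition of \<open>\<omega>\<close>.
\<close>

definition pole_prod :: "nat \<Rightarrow> 'c fps" where "pole_prod d = fps_lim (\<lambda>N. \<Prod>i<N. pole_factor (i + d))"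
definition pole_prod_inv :: "'c fps" where "pole_prod_inv = fps_lim (\<lambda>N. \<Prod>i<N. inverse (pole_factor i))"

lemma le_shift: "qinv ^ (i + d) \<le> qinv ^ i"
  by (rule qinv_power_antimono) simp

lemma pole_prod_lim: "(\<lambda>N. fps_nth (\<Prod>i<N. pole_factor (i + d)) k) \<longlonglongrightarrow> fps_nth (pole_prod d) k"
  unfolding pole_prod_def
  by (rule fps_prod_lim) (rule fps_small_pole_factor, rule order_trans[OF pole_factor_minus_1_le le_shift])

lemma pole_prod_inv_lim: "(\<lambda>N. fps_nth (\<Prod>i<N. inverse (pole_factor i)) k) \<longlonglongrightarrow> fps_nth pole_prod_inv k"
  unfolding pole_prod_inv_def
  by (rule fps_prod_lim) (rule fps_small_pole_factor_inverse, rule pole_factor_inverse_minus_1_le)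

lemma fps_small_pole_prod_inv: "fps_small pole_prod_inv"
  by (rule fps_small_lim[OF pole_prod_inv_lim]) (intro fps_small_prod fps_small_pole_factor_inverse)

lemma fps_mult_lim:
  assumes "\<And>k. (\<lambda>N. fps_nth (f N) k) \<longlonglongrightarrow> fps_nth f' k" "\<And>k. (\<lambda>N. fps_nth (g N) k) \<longlonglongrightarrow> fps_nth g' k"
  shows "(\<lambda>N. fps_nth (f N * g N) k) \<longlonglongrightarrow> fps_nth (f' * g' :: 'c fps) k"
  unfolding fps_mult_nth by (intro lim_sum lim_mult assms)

lemma fps_eq_by_lim:
  assumes "\<And>k. (\<lambda>N. fps_nth (f N) k) \<longlonglongrightarrow> fps_nth g k" "\<And>k. (\<lambda>N. fps_nth (f N) k) \<longlonglongrightarrow> fps_nth h k"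
  shows "g = (h :: 'c fps)"
  by (rule fps_ext) (rule LIMSEQ_unique[OF assms])

lemma pole_prod_pole_prod_inv: "pole_prod 0 * pole_prod_inv = 1"
proof (rule fps_eq_by_lim)
  fix k
  show "(\<lambda>N. fps_nth ((\<Prod>i<N. pole_factor (i + 0)) * (\<Prod>i<N. inverse (pole_factor i))) k) \<longlonglongrightarrow> fps_nth (pole_prod 0 * pole_prod_inv) k"
    by (rule fps_mult_lim[OF pole_prod_lim pole_prod_inv_lim])
  show "(\<lambda>N. fps_nth ((\<Prod>i<N. pole_factor (i + 0)) * (\<Prod>i<N. inverse (pole_factor i))) k) \<longlonglongrightarrow> fps_nth 1 k"
    by (simp add: pole_factor_mult_inverse flip: prod.distrib)
qed

lemma frob_fps_prod: "frob_fps n (prod f A) = (\<Prod>i\<in>A. frob_fps n (f i))"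
  by (induction A rule: infinite_finite_induct) (simp_all add: frob_fps_mult)

lemma frob_fps_pole_factor: "frob_fps n (pole_factor i) = pole_factor (i + n)"
  by (rule fps_ext) (simp add: pole_factor_nth frob_minus inv_pole_frob)

lemma frob_pole_prod: "frob_fps d (pole_prod 0) = pole_prod d"
proof (rule fps_eq_by_lim)
  fix k
  have "(\<lambda>N. fps_nth (\<Prod>i<N. pole_factor (i + 0)) k ^ (q ^ d)) \<longlonglongrightarrow> fps_nth (pole_prod 0) k ^ (q ^ d)"
    by (intro lim_power pole_prod_lim)
  then show "(\<lambda>N. fps_nth (frob_fps d (\<Prod>i<N. pole_factor i)) k) \<longlonglongrightarrow> fps_nth (frob_fps d (pole_prod 0)) k"
    by simp
  show "(\<lambda>N. fps_nth (frob_fps d (\<Prod>i<N. pole_factor i)) k) \<longlonglongrightarrow> fps_nth (pole_prod d) k"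
    using pole_prod_lim[of d k] by (simp only: frob_fps_prod frob_fps_pole_factor)
qed

lemma frob_pole_prod_inv: "frob_fps 1 pole_prod_inv = pole_factor 0 * pole_prod_inv"
proof (rule fps_eq_by_lim)
  fix k
  have "(\<lambda>N. fps_nth (\<Prod>i<N. inverse (pole_factor i)) k ^ (q ^ 1)) \<longlonglongrightarrow> fps_nth pole_prod_inv k ^ (q ^ 1)"
    by (intro lim_power pole_prod_inv_lim)
  then show "(\<lambda>N. fps_nth (frob_fps 1 (\<Prod>i<N. inverse (pole_factor i))) k) \<longlonglongrightarrow> fps_nth (frob_fps 1 pole_prod_inv) k"
    by simp
  have "frob_fps 1 (inverse (pole_factor i)) = inverse (pole_factor (Suc i))" for i
  proof (rule fps_ext)
    fix n
    have "(inv_pole i ^ n) ^ (q ^ 1) = (inv_pole i ^ (q ^ 1)) ^ n"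
      by (simp only: power_mult[symmetric] mult.commute)
    then show "fps_nth (frob_fps 1 (inverse (pole_factor i))) n = fps_nth (inverse (pole_factor (Suc i))) n"
      by (simp only: frob_fps_nth pole_factor_inverse_nth inv_pole_frob Suc_eq_plus1)
  qed
  then have "frob_fps 1 (\<Prod>i<N. inverse (pole_factor i)) = pole_factor 0 * (\<Prod>i<Suc N. inverse (pole_factor i))" for N
    unfolding prod.lessThan_Suc_shift frob_fps_prod by (simp add: pole_factor_mult_inverse flip: mult.assoc)
  moreover have "(\<lambda>N. fps_nth (pole_factor 0 * (\<Prod>i<Suc N. inverse (pole_factor i))) k) \<longlonglongrightarrow> fps_nth (pole_factor 0 * pole_prod_inv) k"
    by (rule fps_mult_lim[OF tendsto_const LIMSEQ_Suc[OF pole_prod_inv_lim]])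
  ultimately show "(\<lambda>N. fps_nth (frob_fps 1 (\<Prod>i<N. inverse (pole_factor i))) k) \<longlonglongrightarrow> fps_nth (pole_factor 0 * pole_prod_inv) k"
    by simp
qed

definition omega_fps :: "'c fps" where "omega_fps = omega j lam"

lemma omega_fps_eq: "omega_fps = fps_const lam * pole_prod_inv"
  by (simp add: omega_fps_def omega_def pole_prod_inv_def fps_lim_def pole_factor_def inv_pole_def th_def flip: q_def)

lemma frob_const: "frob_fps n (fps_const c) = fps_const (c ^ (q ^ n))"
  by (rule fps_ext) simp

lemma frob_omega_fps_1: "frob_fps 1 omega_fps = fps_of_poly [:- th, 1:] * omega_fps"
proof -
  have "fps_const (lam ^ q) * pole_factor 0 = fps_of_poly [:- th, 1:] * fps_const lam"
  proof (rule fps_ext)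
    fix k
    have "lam ^ q = lam * - th" by (rule lam_th[symmetric])
    then show "fps_nth (fps_const (lam ^ q) * pole_factor 0) k = fps_nth (fps_of_poly [:- th, 1:] * fps_const lam) k"
      by (cases k) (auto simp: pole_factor_nth inv_pole_def coeff_pCons split: nat.splits)
  qed
  then have "fps_const (lam ^ q) * pole_factor 0 * pole_prod_inv = fps_of_poly [:- th, 1:] * fps_const lam * pole_prod_inv"
    by simp
  then show ?thesis
    unfolding omega_fps_eq frob_fps_mult frob_const frob_pole_prod_inv power_one_right mult.assoc .
qed

text \<open>
  Iterating \<open>\<tau>(\<omega>) = (t - \<theta>) \<omega>\<close>.
\<close>

lemma frob_omega_fps: "frob_fps n omega_fps = fps_of_poly (bp n) * omega_fps"
proof (induction n)
  case 0
  show ?case by (rule fps_ext) simp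
next
  case (Suc n)
  have "frob_fps (Suc n) omega_fps = frob_fps n (frob_fps 1 omega_fps)"
    by (rule fps_ext) (simp only: frob_fps_nth frob_frob plus_1_eq_Suc)
  also have "\<dots> = frob_fps n (fps_of_poly [:- th, 1:]) * (fps_of_poly (bp n) * omega_fps)"
    by (simp only: frob_omega_fps_1 frob_fps_mult Suc)
  also have "frob_fps n (fps_of_poly [:- th, 1:]) = fps_of_poly [:- (th ^ (q ^ n)), 1:]"
    by (rule fps_ext) (simp add: coeff_pCons frob_minus split: nat.splits)
  finally show ?case by (simp only: bp_Suc fps_of_poly_mult mult_ac)
qed

section \<open>The \<open>L\<close>-series and the vanishing of its exponential\<close>

definition L_lim :: "nat \<Rightarrow> (nat \<Rightarrow> nat) \<Rightarrow> 'c" where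
  "L_lim s m = lim (\<lambda>N. \<Sum>d<N. L_part s d m)"

lemma nm_ec_le: "nm (ec c) \<le> 1"
  using nm_embed_const[of c] by (cases "c = 0") (simp_all add: ec_def)

lemma nm_chi_t_le: "nm (chi_t s a m) \<le> 1"
proof -
  have "(\<Prod>i<s. nm (ec (coeff a (m i)))) \<le> (\<Prod>i<s. 1)"
    by (intro prod_mono) (simp add: nm_ec_le)
  then show ?thesis by (simp add: chi_t_def tensor_def nm_prod)
qed

lemma nm_monic: "a \<in> monics d \<Longrightarrow> nm (embed_A j a) = real q ^ d"
  using nm_emb[of a] by (force simp: monics_def)

lemma nm_L_part_le: "nm (L_part s d m) \<le> qinv ^ d"
  unfolding L_part_def
proof (rule nm_sum_le)
  fix a :: "'a poly" assume "a \<in> monics d"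
  then have "nm (1 / embed_A j a * chi_t s a m) = qinv ^ d * nm (chi_t s a m)"
    by (simp add: nm_mult nm_divide nm_monic power_one_over)
  also have "\<dots> \<le> qinv ^ d * 1"
    by (intro mult_left_mono nm_chi_t_le) simp
  finally show "nm (1 / embed_A j a * chi_t s a m) \<le> qinv ^ d" by simp
qed simp

lemma chi_t_eq_0: "i < s \<Longrightarrow> degree a < m i \<Longrightarrow> chi_t s a m = 0"
  by (auto simp: chi_t_def tensor_def intro!: bexI[of _ i] coeff_eq_0)

lemma L_part_eq_0: "i < s \<Longrightarrow> d < m i \<Longrightarrow> L_part s d m = 0"
proof -
  assume i: "i < s" "d < m i"
  have "chi_t s a m = 0" if "a \<in> monics d" for a :: "'a poly"
    by (rule chi_t_eq_0[OF i(1)]) (use that i(2) in \<open>simp add: monics_def\<close>)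
  then show ?thesis by (simp add: L_part_def)
qed

lemma chi_t_outside: "s \<le> i \<Longrightarrow> m i \<noteq> 0 \<Longrightarrow> chi_t s a m = 0"
proof -
  assume i: "s \<le> i" "m i \<noteq> 0"
  have "\<not> (\<forall>i\<ge>s. m i = 0)"
  proof
    assume "\<forall>i\<ge>s. m i = 0"
    with i show False by simp
  qed
  then show ?thesis unfolding chi_t_def tensor_def by (simp only: if_False)
qed

lemma L_part_outside: "s \<le> i \<Longrightarrow> m i \<noteq> 0 \<Longrightarrow> L_part s d m = 0"
proof -
  assume i: "s \<le> i" "m i \<noteq> 0"
  show ?thesis unfolding L_part_def chi_t_outside[where m = m and i = i, OF i] by simp
qed

lemma L_lim_lim: "(\<lambda>N. \<Sum>d<N. L_part s d m) \<longlonglongrightarrow> L_lim s m"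
proof -
  have "convergent (\<lambda>N. \<Sum>d<N. L_part s d m)"
    by (rule convergentI, rule lim_null_le[OF _ qinv_power_null]) (simp add: nm_L_part_le)
  then show ?thesis by (simp add: L_lim_def convergent_LIMSEQ_iff)
qed

lemma L_lim_tail: "nm (L_lim s m - (\<Sum>d<N. L_part s d m)) \<le> qinv ^ N"
proof (rule lim_nm_le)
  show "(\<lambda>k. (\<Sum>d<k + N. L_part s d m) - (\<Sum>d<N. L_part s d m)) \<longlonglongrightarrow> L_lim s m - (\<Sum>d<N. L_part s d m)"
    by (rule lim_diff[OF LIMSEQ_ignore_initial_segment[OF L_lim_lim] tendsto_const])
  fix k
  have "(\<Sum>d<k + N. L_part s d m) = (\<Sum>d<N. L_part s d m) + (\<Sum>d\<in>{..<k + N} - {..<N}. L_part s d m)"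
    by (subst sum.subset_diff[of "{..<N}"]) (auto simp: add.commute)
  then have "(\<Sum>d<k + N. L_part s d m) - (\<Sum>d<N. L_part s d m) = (\<Sum>d\<in>{..<k + N} - {..<N}. L_part s d m)"
    by simp
  also have "nm \<dots> \<le> qinv ^ N"
  proof (rule nm_sum_le)
    fix d assume "d \<in> {..<k + N} - {..<N}"
    then have "N \<le> d" by simp
    then show "nm (L_part s d m) \<le> qinv ^ N"
      by (rule order_trans[OF nm_L_part_le qinv_power_antimono])
  qed simp
  finally show "nm ((\<Sum>d<k + N. L_part s d m) - (\<Sum>d<N. L_part s d m)) \<le> qinv ^ N" .
qed

lemma L_lim_decay: "i < s \<Longrightarrow> nm (L_lim s m) \<le> qinv ^ m i"
  using L_lim_tail[of s m "m i"] by (simp add: L_part_eq_0)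

lemma mult_vars_nm_le:
  assumes "\<And>k. nm (fps_nth g k) \<le> G" "\<And>m. nm (F m :: 'c) \<le> e"
  shows "nm (mult_vars s g F m) \<le> G ^ s * e"
  using assms(2)
proof (induction s arbitrary: F e m)
  case (Suc s)
  have G: "G \<ge> 0" using assms(1)[of 0] nm_nonneg order_trans by blast
  have e: "e \<ge> 0" using Suc.prems[of m] nm_nonneg order_trans by blast
  have "nm (mult_var s g F m) \<le> G * e" for m
    unfolding mult_var_altdef
  proof (rule nm_sum_le)
    fix k
    show "nm (fps_nth g k * F (m(s := m s - k))) \<le> G * e"
      unfolding nm_mult by (intro mult_mono assms(1) Suc.prems G) simp
  qed (use G e in simp)
  then have "nm (mult_vars s g (mult_var s g F) m) \<le> G ^ s * (G * e)" by (rule Suc.IH)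
  then show ?case by (simp add: mult_ac)
qed simp

lemma nm_coeff_bp: "nm (coeff (bp n) k) \<le> real q ^ (q ^ n)"
proof -
  have "nm (coeff (bp n) k) \<le> real q ^ geom n"
  proof (induction n arbitrary: k)
    case (Suc n)
    have eq: "bp (Suc n) = [:0, 1:] * bp n - smult (th ^ (q ^ n)) (bp n)"
      by (simp add: bp_Suc algebra_simps)
    have 1: "nm (coeff ([:0, 1:] * bp n) k) \<le> real q ^ geom (Suc n)"
    proof -
      have "nm (coeff ([:0, 1:] * bp n) k) \<le> real q ^ geom n"
        using Suc by (auto simp: coeff_pCons split: nat.splits)
      also have "\<dots> \<le> real q ^ geom (Suc n)"
        using real_q_ge_2 by (intro power_increasing) (auto simp: geom_Suc')
      finally show ?thesis .
    qed
    have "nm (coeff (smult (th ^ (q ^ n)) (bp n)) k) \<le> real q ^ (q ^ n) * real q ^ geom n"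
      using Suc[of k] by (simp add: nm_mult nm_power nm_th mult_left_mono)
    also have "\<dots> = real q ^ geom (Suc n)" by (simp add: geom_Suc' power_add)
    finally show ?case unfolding eq Polynomial.coeff_diff using 1 by (intro nm_diff_leI)
  qed (auto simp: coeff_1 geom_def)
  also have "\<dots> \<le> real q ^ (q ^ n)"
    using real_q_ge_2 geom_le by (intro power_increasing) auto
  finally show ?thesis .
qed

text \<open>
  The choice of the bound on \<open>F\<close> covers both uses: \<open>F\<close> may be the part of \<open>L\<close> in degree \<open>M - n\<close> or the tail of
  \<open>L\<close> from that degree on.
\<close>

lemma twist_term_le:
  assumes "s \<le> M" "n \<le> M" "\<And>m. nm (F m) \<le> qinv ^ (M - n)"
  shows "nm (1 / dd n * twist s n F m) \<le> qinv ^ (M - s)"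
proof -
  let ?r = "qinv"
  have "nm (twist s n F m) \<le> (real q ^ (q ^ n)) ^ s * (?r ^ (M - n)) ^ (q ^ n)"
    unfolding twist_def
    by (rule mult_vars_nm_le) (auto simp: nm_coeff_bp nm_power intro: power_mono assms(3))
  then have "nm (1 / dd n * twist s n F m) \<le> ?r ^ (n * q ^ n) * ((real q ^ (q ^ n)) ^ s * (?r ^ (M - n)) ^ (q ^ n))"
    unfolding nm_mult nm_divide nm_dd nm_1 power_one_over by (rule mult_left_mono) simp
  also have "\<dots> = (?r ^ n * ?r ^ (M - n) * real q ^ s) ^ (q ^ n)"
    by (simp only: power_mult_distrib power_mult[symmetric] mult.commute[of _ "q ^ n"] mult.assoc mult.commute[of "real q ^ _"])
  also have "?r ^ n * ?r ^ (M - n) = ?r ^ (M - s) * ?r ^ s"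
    using assms by (simp flip: power_add)
  also have "?r ^ (M - s) * ?r ^ s * real q ^ s = ?r ^ (M - s)"
    using real_q_ge_2 by (simp add: power_one_over)
  also have "(?r ^ (M - s)) ^ (q ^ n) \<le> (?r ^ (M - s)) ^ 1"
    by (rule power_decreasing) (use qinv_power_antimono[of 0 "M - s"] in \<open>auto simp: Suc_leI\<close>)
  finally show ?thesis by simp
qed

text \<open>
  The coefficient lies in \<open>A\<close> and has absolute value below \<open>1\<close>.
\<close>

lemma exp_L_coeff_eq_0:
  assumes "M > s" shows "exp_L_coeff s M m = 0"
proof -
  have "nm (exp_L_coeff s M m) \<le> qinv ^ (M - s)"
    unfolding exp_L_coeff_def by (intro nm_sum_le twist_term_le nm_L_part_le) (use assms in auto)
  also have "\<dots> < 1"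
    using assms real_q_ge_2 by (intro power_less_one_iff[THEN iffD2]) auto
  finally have "nm (exp_L_coeff s M m) < 1" .
  moreover obtain a where a: "exp_L_coeff s M m = embed_A j a" using exp_L_coeff_integral[of s M m] by auto
  ultimately have "nm (embed_A j a) < 1" by simp
  then have "a = 0"
    using nm_emb[of a] real_q_ge_2 one_le_power[of "real q" "degree a"] by fastforce
  then show ?thesis by (simp add: a)
qed

lemma twist_L_part: "twist s n (L_part s d) m = (\<Sum>a\<in>monics d. (1 / embed_A j a) ^ (q ^ n) * tensor s (\<lambda>_. fps_of_poly (bp n * tp a)) m)"
  unfolding L_part_def[abs_def] twist_sum twist_chi_t ..

lemma degree_bp_tp: "a \<in> monics d \<Longrightarrow> degree (bp n * tp a) \<le> n + d"
proof -
  assume "a \<in> monics d"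
  then have "degree (tp a) \<le> d"
    by (intro degree_le) (auto simp: monics_def coeff_eq_0)
  moreover have "degree (bp n) \<le> n"
  proof (induction n)
    case (Suc n)
    have "degree (bp (Suc n)) \<le> degree (bp n) + degree [:- (th ^ (q ^ n)), 1:]"
      unfolding bp_Suc by (rule degree_mult_le)
    then show ?case using Suc by simp
  qed simp
  ultimately show ?thesis using degree_mult_le[of "bp n" "tp a"] by linarith
qed

lemma tensor_outside_box:
  assumes "\<And>i. i < s \<Longrightarrow> degree (f i) \<le> D" "m \<notin> box s D"
  shows "tensor s (\<lambda>i. fps_of_poly (f i)) m = (0 :: 'c)"
proof (cases "\<forall>i\<ge>s. m i = 0")
  case True
  with assms(2) obtain i where i: "i < s" "m i > D" by (auto simp: box_def not_le)
  then have "coeff (f i) (m i) = 0" using assms(1)[of i] by (intro coeff_eq_0) simp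
  then have "(\<Prod>i<s. fps_nth (fps_of_poly (f i)) (m i)) = 0" using i(1) by (intro prod_zero) auto
  then show ?thesis by (simp add: tensor_def)
next
  case False
  show ?thesis unfolding tensor_def if_not_P[OF False] ..
qed

lemma exp_L_coeff_outside_box: "m \<notin> box s M \<Longrightarrow> exp_L_coeff s M m = 0"
  unfolding exp_L_coeff_def twist_L_part
proof (intro sum.neutral ballI)
  fix n assume m: "m \<notin> box s M" and n: "n \<in> {..M}"
  have "tensor s (\<lambda>_. fps_of_poly (bp n * tp a)) m = 0" if "a \<in> monics (M - n)" for a :: "'a poly"
    by (rule tensor_outside_box[OF _ m]) (use degree_bp_tp[OF that, of n] n in simp)
  then show "1 / dd n * (\<Sum>a\<in>monics (M - n). (1 / embed_A j a) ^ (q ^ n) * tensor s (\<lambda>_. fps_of_poly (bp n * tp a)) m) = 0"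
    by simp
qed

lemma eval_box_exp_L_coeff:
  assumes "M \<le> D"
  shows "eval_box s D (\<lambda>i. th ^ (q ^ k i)) (exp_L_coeff s M) = (\<Sum>n\<le>M. 1 / dd n * (\<Prod>i<s. poly (bp n) (th ^ (q ^ k i))) *
     (\<Sum>a\<in>monics (M - n). embed_A j a ^ (\<Sum>i<s. q ^ k i) / embed_A j a ^ (q ^ n)))"
proof -
  let ?x = "\<lambda>i. th ^ (q ^ k i)"
  have "eval_box s D ?x (exp_L_coeff s M) = (\<Sum>n\<le>M. 1 / dd n * eval_box s D ?x (twist s n (L_part s (M - n))))"
    unfolding exp_L_coeff_def[abs_def] eval_box_sum ..
  also have "\<dots> = (\<Sum>n\<le>M. 1 / dd n * (\<Prod>i<s. poly (bp n) (?x i)) *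
     (\<Sum>a\<in>monics (M - n). embed_A j a ^ (\<Sum>i<s. q ^ k i) / embed_A j a ^ (q ^ n)))"
  proof (intro sum.cong refl)
    fix n assume n: "n \<in> {..M}"
    have "eval_box s D ?x (twist s n (L_part s (M - n))) = (\<Sum>a\<in>monics (M - n). (1 / embed_A j a) ^ (q ^ n) *
        eval_box s D ?x (tensor s (\<lambda>_. fps_of_poly (bp n * tp a))))"
      unfolding twist_L_part[abs_def] eval_box_sum ..
    also have "\<dots> = (\<Sum>a\<in>monics (M - n). (\<Prod>i<s. poly (bp n) (?x i)) * (embed_A j a ^ (\<Sum>i<s. q ^ k i) / embed_A j a ^ (q ^ n)))"
    proof (intro sum.cong refl)
      fix a :: "'a poly" assume a: "a \<in> monics (M - n)"
      have "eval_box s D ?x (tensor s (\<lambda>_. fps_of_poly (bp n * tp a))) = (\<Prod>i<s. poly (bp n * tp a) (?x i))"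
        by (rule eval_box_tensor_poly) (use degree_bp_tp[OF a, of n] n assms in simp)
      also have "\<dots> = (\<Prod>i<s. poly (bp n) (?x i)) * embed_A j a ^ (\<Sum>i<s. q ^ k i)"
        by (simp add: poly_tp_th prod.distrib power_sum)
      finally show "(1 / embed_A j a) ^ (q ^ n) * eval_box s D ?x (tensor s (\<lambda>_. fps_of_poly (bp n * tp a))) =
          (\<Prod>i<s. poly (bp n) (?x i)) * (embed_A j a ^ (\<Sum>i<s. q ^ k i) / embed_A j a ^ (q ^ n))"
        by (simp add: power_one_over)
    qed
    finally show "1 / dd n * eval_box s D ?x (twist s n (L_part s (M - n))) = 1 / dd n * (\<Prod>i<s. poly (bp n) (?x i)) *
     (\<Sum>a\<in>monics (M - n). embed_A j a ^ (\<Sum>i<s. q ^ k i) / embed_A j a ^ (q ^ n))"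
      by (simp add: sum_distrib_left)
  qed
  finally show ?thesis .
qed

lemma q_minus_1_dvd: "q - 1 dvd q ^ k - 1"
proof (induction k)
  case (Suc k)
  have "q ^ k \<ge> 1" "q \<ge> 1" by (simp_all add: Suc_leI)
  then obtain m n where "q ^ k = Suc m" "q = Suc n" by (metis Suc_pred' less_eq_Suc_le One_nat_def)
  then have "q ^ Suc k - 1 = q * (q ^ k - 1) + (q - 1)" by simp
  then show ?case using Suc by (metis dvd_add dvd_mult dvd_refl)
qed simp

text \<open>
  At \<open>t\<^sub>i = \<theta>\<^bsup>q^k\<^sub>i\<^esup>\<close> the factor \<open>bp n\<close> kills all terms with \<open>n > k\<^sub>i\<close> for some \<open>i\<close>. In the others the exponent
  \<open>w = \<Sum> q\<^bsup>k\<^sub>i\<^esup> - q\<^sup>n\<close> is positive, since \<open>s \<ge> 2\<close>, and divisible by \<open>q - 1\<close>, since \<open>s \<equiv> 1\<close>; so the sum over \<open>a\<close> is a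
  trivial zero once the degrees are large compared with \<open>w\<close>. The value of \<open>K\<close> is chosen to ensure this.
\<close>

lemma eval_box_partial_sums_eq_0:
  assumes s: "s \<ge> 2" "(q - 1) dvd (s - 1)"
    and K: "K = (\<Sum>i<s. q ^ k i) + (\<Sum>i<s. k i) + s" and D: "K \<le> D"
  shows "(\<Sum>M\<le>K. eval_box s D (\<lambda>i. th ^ (q ^ k i)) (exp_L_coeff s M)) = 0"
proof -
  define c where "c n = 1 / dd n * (\<Prod>i<s. poly (bp n) (th ^ (q ^ k i)))" for n
  define h where "h n d = (\<Sum>a\<in>monics d. embed_A j a ^ (\<Sum>i<s. q ^ k i) / embed_A j a ^ (q ^ n))" for n d
  have "(\<Sum>M\<le>K. eval_box s D (\<lambda>i. th ^ (q ^ k i)) (exp_L_coeff s M)) = (\<Sum>M\<le>K. \<Sum>n\<le>M. c n * h n (M - n))"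
    by (intro sum.cong refl) (use D in \<open>simp add: eval_box_exp_L_coeff c_def h_def\<close>)
  also have "\<dots> = (\<Sum>n\<le>K. \<Sum>d\<le>K - n. c n * h n d)"
    by (rule sum_triangle[symmetric])
  also have "\<dots> = (\<Sum>n\<le>K. c n * (\<Sum>d\<le>K - n. h n d))"
    by (simp add: sum_distrib_left)
  also have "\<dots> = 0"
  proof (intro sum.neutral ballI)
    fix n
    show "c n * (\<Sum>d\<le>K - n. h n d) = 0"
    proof (cases "\<exists>i<s. k i < n")
      case True
      then obtain i where "i < s" "k i < n" by blast
      then have "(\<Prod>i<s. poly (bp n) (th ^ (q ^ k i))) = 0"
        by (intro prod_zero bexI[of _ i]) (auto simp: poly_bp_th)
      then show ?thesis by (simp add: c_def)
    next
      case False
      then have n: "\<And>i. i < s \<Longrightarrow> n \<le> k i" by (meson not_less)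
      define W where "W = (\<Sum>i<s. q ^ k i)"
      define w where "w = W - q ^ n"
      have Wge: "s * q ^ n \<le> W"
      proof -
        have "(\<Sum>i<s. q ^ n) \<le> W"
          unfolding W_def
        proof (rule sum_mono)
          fix i assume "i \<in> {..<s}"
          then have "n \<le> k i" using n by simp
          then show "q ^ n \<le> q ^ k i" by (intro power_increasing) (auto simp: Suc_leI)
        qed
        then show ?thesis by simp
      qed
      have "2 * q ^ n \<le> s * q ^ n" using s by (intro mult_right_mono) auto
      then have "2 * q ^ n \<le> W" using Wge by (rule order_trans)
      moreover have "q ^ n > 0" by simp
      ultimately have "q ^ n < W" by linarith
      then have W: "W = w + q ^ n" "w > 0" by (simp_all add: w_def)
      have "(q - 1) dvd w"
      proof -
        have 1: "q ^ k' = (q ^ k' - 1) + 1" for k' by (simp add: Suc_leI)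
        have "W = (\<Sum>i<s. (q ^ k i - 1) + 1)" unfolding W_def using 1 by simp
        also have "\<dots> = (\<Sum>i<s. q ^ k i - 1) + (\<Sum>i<s. 1)" by (rule sum.distrib)
        finally have "W = (\<Sum>i<s. q ^ k i - 1) + s" by simp
        then have "w + (q ^ n - 1) = (\<Sum>i<s. q ^ k i - 1) + (s - 1)"
          using W(1) 1[of n] s by linarith
        moreover have "(q - 1) dvd (\<Sum>i<s. q ^ k i - 1) + (s - 1)"
          by (intro dvd_add dvd_sum s(2) q_minus_1_dvd)
        ultimately show ?thesis using q_minus_1_dvd[of n] by (metis dvd_add_left_iff)
      qed
      moreover have "w < Suc (K - n) * (q - 1)"
      proof -
        have "n \<le> k 0" using n s by simp
        also have "k 0 \<le> (\<Sum>i<s. k i)" by (rule member_le_sum) (use s in auto)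
        finally have "w < Suc (K - n)" using K W(1) by (simp add: W_def[symmetric])
        moreover have "Suc (K - n) * 1 \<le> Suc (K - n) * (q - 1)"
          using q_ge_2 by (intro mult_le_mono) auto
        ultimately show ?thesis unfolding mult_1_right by (rule less_le_trans)
      qed
      ultimately have "(\<Sum>d<Suc (K - n). \<Sum>a\<in>monics d. embed_A j a ^ w) = 0"
        using W(2) by (intro trivial_zero)
      moreover have "h n d = (\<Sum>a\<in>monics d. embed_A j a ^ w)" for d
        unfolding h_def W_def[symmetric]
      proof (intro sum.cong refl)
        fix a :: "'a poly" assume "a \<in> monics d"
        then have "embed_A j a \<noteq> 0" by (auto simp: monics_def)
        then show "embed_A j a ^ W / embed_A j a ^ (q ^ n) = embed_A j a ^ w"
          by (simp add: W(1) power_add)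
      qed
      ultimately show ?thesis by (simp add: lessThan_Suc_atMost)
    qed
  qed
  finally show ?thesis .
qed

text \<open>
  The sum does not depend on \<open>M\<close> from \<open>s\<close> on, so for each point of the grid \<open>M\<close> may be taken as large as needed.
\<close>

lemma sum_exp_L_coeff_eq_0:
  assumes s: "s \<ge> 2" "(q - 1) dvd (s - 1)" and "M \<ge> s"
  shows "(\<Sum>N\<le>M. exp_L_coeff s N m) = 0"
proof -
  define F where "F m = (\<Sum>N\<le>s. exp_L_coeff s N m)" for m
  have stable: "(\<Sum>N\<le>K. exp_L_coeff s N m) = F m" if "K \<ge> s" for K m
    unfolding F_def by (rule sum.mono_neutral_right) (use that in \<open>auto simp: exp_L_coeff_eq_0\<close>)
  have "eval_box s s x F = 0" if x: "\<And>i. x i \<in> range (\<lambda>k. th ^ (q ^ k))" for x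
  proof -
    from x have "\<forall>i. \<exists>k. x i = th ^ (q ^ k)" by blast
    then obtain k where k: "\<And>i. x i = th ^ (q ^ k i)" by metis
    then have x_eq: "x = (\<lambda>i. th ^ (q ^ k i))" by auto
    define K where "K = (\<Sum>i<s. q ^ k i) + (\<Sum>i<s. k i) + s"
    have "F m = 0" if "m \<notin> box s s" for m
      unfolding F_def using that box_mono[of _ s s] by (intro sum.neutral ballI exp_L_coeff_outside_box) auto
    then have "eval_box s s x F = eval_box s K x F"
      by (intro eval_box_mono[symmetric]) (auto simp: K_def)
    also have "\<dots> = eval_box s K x (\<lambda>m. \<Sum>N\<le>K. 1 * exp_L_coeff s N m)"
      by (simp add: stable K_def)
    also have "\<dots> = (\<Sum>N\<le>K. 1 * eval_box s K x (exp_L_coeff s N))" by (rule eval_box_sum)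
    also have "\<dots> = 0"
      unfolding x_eq using eval_box_partial_sums_eq_0[OF s K_def order_refl] by simp
    finally show ?thesis .
  qed
  moreover have "infinite (range (\<lambda>k. th ^ (q ^ k)))"
    using th_frob_inj by (intro range_inj_infinite injI) blast
  ultimately have "\<forall>m\<in>box s s. F m = 0" by (rule eval_box_eq_0_imp_zero[rotated])
  moreover have "F m = 0" if "m \<notin> box s s"
    unfolding F_def using that box_mono[of _ s s] by (intro sum.neutral ballI exp_L_coeff_outside_box) auto
  ultimately show ?thesis using stable[OF assms(3)] by (cases "m \<in> box s s") auto
qed

text \<open>
  Replacing \<open>L\<close> in the \<open>n\<close>-th term by its partial sum up to degree \<open>M - n\<close> turns the sum into a sum of
  \<open>exp_L_coeff\<close>, which is \<open>0\<close>; the error is bounded by \<open>twist_term_le\<close>.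
\<close>

lemma exp_phi_L_eq_0:
  assumes s: "s \<ge> 2" "(q - 1) dvd (s - 1)"
  shows "(\<lambda>M. \<Sum>n\<le>M. 1 / dd n * twist s n (L_lim s) m) \<longlonglongrightarrow> 0"
proof -
  define Lp where "Lp k m = (\<Sum>d<Suc k. 1 * L_part s d m)" for k m
  have "nm (\<Sum>n\<le>M + s. 1 / dd n * twist s n (L_lim s) m) \<le> qinv ^ M" for M
  proof -
    let ?M = "M + s"
    have "(\<Sum>n\<le>?M. 1 / dd n * twist s n (Lp (?M - n)) m) = (\<Sum>n\<le>?M. \<Sum>d\<le>?M - n. 1 / dd n * twist s n (L_part s d) m)"
      unfolding Lp_def[abs_def] twist_sum by (simp add: sum_distrib_left lessThan_Suc_atMost)
    also have "\<dots> = (\<Sum>N\<le>?M. exp_L_coeff s N m)"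
      unfolding exp_L_coeff_def by (rule sum_triangle)
    also have "\<dots> = 0" by (rule sum_exp_L_coeff_eq_0[OF s]) simp
    finally have "(\<Sum>n\<le>?M. 1 / dd n * twist s n (L_lim s) m) =
        (\<Sum>n\<le>?M. 1 / dd n * twist s n (\<lambda>m. L_lim s m - Lp (?M - n) m) m)"
      by (simp add: twist_diff right_diff_distrib sum_subtractf diff_divide_distrib)
    also have "nm \<dots> \<le> qinv ^ (?M - s)"
    proof (intro nm_sum_le twist_term_le)
      fix n m
      show "nm (L_lim s m - Lp (?M - n) m) \<le> qinv ^ (?M - n)"
        using order_trans[OF L_lim_tail[of s m "Suc (?M - n)"] qinv_power_antimono[of "?M - n"]]
        by (simp add: Lp_def)
    qed auto
    finally show ?thesis by simp
  qed
  then have "(\<lambda>M. \<Sum>n\<le>M + s. 1 / dd n * twist s n (L_lim s) m) \<longlonglongrightarrow> 0"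
    by (rule lim_null_le[OF _ qinv_power_null])
  then show ?thesis by (rule LIMSEQ_offset)
qed

section \<open>The series \<open>V\<close> is a polynomial over \<open>A\<close>\<close>

definition V_lim :: "nat \<Rightarrow> (nat \<Rightarrow> nat) \<Rightarrow> 'c" where
  "V_lim s m = inverse period * mult_vars s omega_fps (L_lim s) m"

lemma mult_vars_lim:
  assumes "\<And>k. (\<lambda>N. fps_nth (g N) k) \<longlonglongrightarrow> fps_nth h k" "\<And>m. (\<lambda>N. F N m) \<longlonglongrightarrow> (G m :: 'c)"
  shows "(\<lambda>N. mult_vars s (g N) (F N) m) \<longlonglongrightarrow> mult_vars s h G m"
  using assms(2)
proof (induction s arbitrary: F G m)
  case (Suc s)
  have "(\<lambda>N. mult_var s (g N) (F N) m) \<longlonglongrightarrow> mult_var s h G m" for m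
    unfolding mult_var_altdef by (intro lim_sum lim_mult assms(1) Suc.prems)
  then show ?case by (simp add: Suc.IH)
qed simp

text \<open>
  \<open>bp n \<omega>\<close> is the \<open>q\<^sup>n\<close>-twist of \<open>\<omega>\<close>, so multiplying \<open>exp\<^sub>\<phi>(L) = 0\<close> by \<open>\<Prod>\<^sub>i \<omega>(t\<^sub>i)\<close> gives \<open>exp(\<pi> v) = 0\<close> for
  each coefficient \<open>v\<close> of \<open>V\<close>.
\<close>

lemma V_lim_integral:
  assumes s: "s \<ge> 2" "(q - 1) dvd (s - 1)"
  shows "V_lim s m \<in> range (embed_A j)"
proof (rule exp_zero_imp_integral)
  have pV: "period * V_lim s m = mult_vars s omega_fps (L_lim s) m" by (simp add: V_lim_def)
  have "(period * V_lim s m) ^ (q ^ n) / dd n = 1 / dd n * mult_vars s omega_fps (twist s n (L_lim s)) m" for n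
    unfolding pV mult_vars_frob frob_omega_fps twist_def by (simp add: mult_vars_mult_vars mult.commute)
  then have "(\<Sum>n\<le>M. (period * V_lim s m) ^ (q ^ n) / dd n) = mult_vars s omega_fps (\<lambda>m. \<Sum>n\<le>M. 1 / dd n * twist s n (L_lim s) m) m" for M
    by (simp add: mult_vars_sum del: times_divide_eq_left)
  moreover have "(\<lambda>M. mult_vars s omega_fps (\<lambda>m. \<Sum>n\<le>M. 1 / dd n * twist s n (L_lim s) m) m) \<longlonglongrightarrow> mult_vars s omega_fps (\<lambda>_. 0) m"
    by (intro mult_vars_lim tendsto_const exp_phi_L_eq_0 s)
  moreover have "mult_vars s omega_fps (\<lambda>_. 0) m = 0"
    using mult_vars_cmult[of s omega_fps 0 "\<lambda>_. 0" m] by simp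
  ultimately show "(\<lambda>M. \<Sum>n\<le>M. (period * V_lim s m) ^ (q ^ n) / dd n) \<longlonglongrightarrow> 0" by simp
qed

lemma mult_vars_decay:
  assumes "\<And>k. nm (fps_nth g k) \<le> c * qinv ^ k" "\<And>m. nm (F m :: 'c) \<le> C * qinv ^ m i"
  shows "nm (mult_vars s g F m) \<le> c ^ s * C * qinv ^ m i"
  using assms(2)
proof (induction s arbitrary: F C m)
  case (Suc s)
  let ?r = "qinv"
  have c: "c \<ge> 0" using order_trans[OF nm_nonneg assms(1)[of 0]] by simp
  have C: "C \<ge> 0" using order_trans[OF nm_nonneg Suc.prems[of "\<lambda>_. 0"]] by simp
  have "nm (mult_var s g F m) \<le> (c * C) * ?r ^ m i" for m
    unfolding mult_var_altdef
  proof (rule nm_sum_le)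
    fix k assume k: "k \<in> {..m s}"
    have "nm (fps_nth g k) * nm (F (m(s := m s - k))) \<le> (c * ?r ^ k) * (C * ?r ^ (m(s := m s - k)) i)"
      by (intro mult_mono assms(1) Suc.prems) (use c in auto)
    also have "\<dots> = c * C * ?r ^ (k + (m(s := m s - k)) i)"
      by (simp add: power_add)
    also have "\<dots> \<le> c * C * ?r ^ m i"
      by (intro mult_left_mono qinv_power_antimono) (use k c C in auto)
    finally show "nm (fps_nth g k * F (m(s := m s - k))) \<le> (c * C) * ?r ^ m i"
      by (simp only: nm_mult)
  qed (use c C in simp)
  then have "nm (mult_vars s g (mult_var s g F) m) \<le> c ^ s * (c * C) * ?r ^ m i" by (rule Suc.IH)
  then show ?case by (simp add: mult_ac)
qed simp

lemma V_lim_decay: "i < s \<Longrightarrow> nm (V_lim s m) \<le> inverse (nm period) * (nm lam ^ s * qinv ^ m i)"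
proof -
  assume i: "i < s"
  have "nm (mult_vars s omega_fps (L_lim s) m) \<le> nm lam ^ s * 1 * qinv ^ m i"
  proof (rule mult_vars_decay)
    show "nm (fps_nth omega_fps k) \<le> nm lam * qinv ^ k" for k
      using fps_small_pole_prod_inv by (simp add: omega_fps_eq nm_mult fps_small_def mult_left_mono)
  qed (use L_lim_decay[OF i] in simp)
  then show ?thesis by (simp add: V_lim_def nm_mult nm_inverse mult_left_mono)
qed

lemma mult_vars_outside:
  assumes "\<And>m. m i \<noteq> 0 \<Longrightarrow> F m = 0" "s \<le> i" "m i \<noteq> 0"
  shows "mult_vars s g F m = 0"
  using assms
proof (induction s arbitrary: F m)
  case (Suc s)
  have "mult_var s g F m = 0" if "m i \<noteq> 0" for m
    unfolding mult_var_altdef by (intro sum.neutral ballI) (use that Suc.prems in auto)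
  then show ?case using Suc by simp
qed simp

lemma L_lim_outside: "s \<le> i \<Longrightarrow> m i \<noteq> 0 \<Longrightarrow> L_lim s m = 0"
proof -
  assume "s \<le> i" "m i \<noteq> 0"
  then have "L_part s d m = 0" for d by (rule L_part_outside)
  then have "(\<lambda>N. \<Sum>d<N. L_part s d m) = (\<lambda>_. 0)" by simp
  then show ?thesis using LIMSEQ_unique[OF L_lim_lim[of s m]] by simp
qed

lemma V_lim_outside: "s \<le> i \<Longrightarrow> m i \<noteq> 0 \<Longrightarrow> V_lim s m = 0"
  unfolding V_lim_def using mult_vars_outside[of i "L_lim s" s m omega_fps] L_lim_outside by simp

text \<open>
  The coefficients lie in \<open>A\<close> and decay in the exponents.
\<close>

lemma V_lim_support:
  assumes s: "s \<ge> 2" "(q - 1) dvd (s - 1)"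
  obtains D where "\<And>m. m \<notin> box s D \<Longrightarrow> V_lim s m = 0"
proof -
  define C where "C = inverse (nm period) * nm lam ^ s"
  have "(\<lambda>n. C * qinv ^ n) \<longlonglongrightarrow> C * 0"
    by (intro tendsto_mult tendsto_const qinv_power_null)
  then have "eventually (\<lambda>n. C * qinv ^ n < 1) sequentially"
    by (rule order_tendstoD(2)) simp
  then obtain D where D: "\<And>n. n \<ge> D \<Longrightarrow> C * qinv ^ n < 1" by (auto simp: eventually_sequentially)
  have "V_lim s m = 0" if m: "m \<notin> box s D" for m
  proof (cases "\<exists>i\<ge>s. m i \<noteq> 0")
    case True
    then show ?thesis using V_lim_outside by blast
  next
    case False
    then have "\<forall>i\<ge>s. m i = 0" by blast
    with m obtain i where i: "i < s" "m i > D" by (auto simp: box_def not_le)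
    then have "nm (V_lim s m) < 1"
      using V_lim_decay[OF i(1), of m] D[of "m i"] by (simp add: C_def mult.assoc)
    moreover obtain a where a: "V_lim s m = embed_A j a" using V_lim_integral[OF s, of m] by auto
    ultimately have "nm (embed_A j a) < 1" by simp
    then have "a = 0"
      using nm_emb[of a] real_q_ge_2 one_le_power[of "real q" "degree a"] by fastforce
    then show ?thesis by (simp add: a)
  qed
  then show thesis by (rule that)
qed

end

section \<open>Evaluation of the twisted series at \<open>\<theta>\<close>\<close>

text \<open>
  Monomials are tensors; this reduces statements on polynomials to tensors by linearity.
\<close>

lemma tensor_monomials:
  assumes "m0 \<in> box s D"
  shows "tensor s (\<lambda>i. fps_of_poly (monom 1 (m0 i))) m = (if m = m0 then 1 else (0::'b::comm_ring_1))"
proof (cases "\<forall>i\<ge>s. m i = 0")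
  case True
  show ?thesis
  proof (cases "m = m0")
    case False
    then obtain i where i: "m i \<noteq> m0 i" by auto
    then have "i < s" using True assms by (force simp: box_def not_le[symmetric])
    then have "(\<Prod>i<s. fps_nth (fps_of_poly (monom (1::'b) (m0 i))) (m i)) = 0"
      using i by (intro prod_zero bexI[of _ i]) auto
    then show ?thesis using False by (simp add: tensor_def)
  qed (use True in \<open>simp add: tensor_def\<close>)
next
  case False
  then have "m \<noteq> m0" using assms by (auto simp: box_def)
  then show ?thesis unfolding tensor_def if_not_P[OF False] by simp
qed

lemma eval_box_mult_vars_poly:
  fixes F :: "(nat \<Rightarrow> nat) \<Rightarrow> 'b::field"
  assumes F: "\<And>m. m \<notin> box s D0 \<Longrightarrow> F m = 0" and g: "degree g \<le> E" and D: "D0 + E \<le> D"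
  shows "eval_box s D x (mult_vars s (fps_of_poly g) F) = (\<Prod>i<s. poly g (x i)) * eval_box s D0 x F"
proof -
  define mn where "mn m0 i = monom (1::'b) (m0 i)" for m0 :: "nat \<Rightarrow> nat" and i
  have F_eq: "F = (\<lambda>m. \<Sum>m0\<in>box s D0. F m0 * tensor s (\<lambda>i. fps_of_poly (mn m0 i)) m)"
  proof
    fix m
    have "(\<Sum>m0\<in>box s D0. F m0 * tensor s (\<lambda>i. fps_of_poly (mn m0 i)) m) = (\<Sum>m0\<in>box s D0. if m0 = m then F m0 else 0)"
    proof (intro sum.cong refl)
      fix m0 assume m0: "m0 \<in> box s D0"
      show "F m0 * tensor s (\<lambda>i. fps_of_poly (mn m0 i)) m = (if m0 = m then F m0 else 0)"
        unfolding mn_def tensor_monomials[OF m0] by simp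
    qed
    also have "\<dots> = F m" using F[of m] by simp
    finally show "F m = (\<Sum>m0\<in>box s D0. F m0 * tensor s (\<lambda>i. fps_of_poly (mn m0 i)) m)" by simp
  qed
  have "mult_vars s (fps_of_poly g) F = (\<lambda>m. \<Sum>m0\<in>box s D0. F m0 * tensor s (\<lambda>i. fps_of_poly (g * mn m0 i)) m)"
    by (subst F_eq, rule ext) (simp add: mult_vars_sum mult_vars_tensor fps_of_poly_mult)
  then have "eval_box s D x (mult_vars s (fps_of_poly g) F) =
      (\<Sum>m0\<in>box s D0. F m0 * eval_box s D x (tensor s (\<lambda>i. fps_of_poly (g * mn m0 i))))"
    by (simp add: eval_box_sum)
  also have "\<dots> = (\<Sum>m0\<in>box s D0. F m0 * ((\<Prod>i<s. poly g (x i)) * (\<Prod>i<s. x i ^ m0 i)))"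
  proof (intro sum.cong refl)
    fix m0 assume m0: "m0 \<in> box s D0"
    have "eval_box s D x (tensor s (\<lambda>i. fps_of_poly (g * mn m0 i))) = (\<Prod>i<s. poly (g * mn m0 i) (x i))"
    proof (rule eval_box_tensor_poly)
      fix i assume "i < s"
      then have "m0 i \<le> D0" using m0 by (simp add: box_def)
      moreover have "degree (mn m0 i) \<le> m0 i" unfolding mn_def by (rule degree_monom_le)
      ultimately show "degree (g * mn m0 i) \<le> D"
        using degree_mult_le[of g "mn m0 i"] g D by linarith
    qed
    then show "F m0 * eval_box s D x (tensor s (\<lambda>i. fps_of_poly (g * mn m0 i))) =
        F m0 * ((\<Prod>i<s. poly g (x i)) * (\<Prod>i<s. x i ^ m0 i))"
      by (simp add: mn_def poly_monom prod.distrib)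
  qed
  also have "\<dots> = (\<Prod>i<s. poly g (x i)) * eval_box s D0 x F"
    by (simp add: eval_box_def sum_distrib_left mult_ac)
  finally show ?thesis .
qed

text \<open>
  Rescaling all variables by \<open>x\<close> turns convergence at the point \<open>x\<close> into decay of the coefficients.
\<close>

lemma mult_var_weight:
  assumes "i < S"
  shows "mult_var i g F m * (\<Prod>l<S. x ^ m l) = mult_var i (Abs_fps (\<lambda>k. fps_nth g k * x ^ k)) (\<lambda>m. F m * (\<Prod>l<S. x ^ m l)) m"
proof -
  have i: "i \<in> {..<S}" using assms by simp
  have "(\<Prod>l<S. x ^ m l) = x ^ k * (\<Prod>l<S. x ^ (m(i := m i - k)) l)" if "k \<le> m i" for k
    using that by (simp add: prod.remove[OF _ i] mult.assoc[symmetric] flip: power_add)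
  then show ?thesis
    unfolding mult_var_altdef sum_distrib_right by (intro sum.cong refl) (simp add: mult_ac)
qed

lemma mult_vars_weight:
  assumes "s \<le> S"
  shows "mult_vars s g F m * (\<Prod>l<S. x ^ m l) = mult_vars s (Abs_fps (\<lambda>k. fps_nth g k * x ^ k)) (\<lambda>m. F m * (\<Prod>l<S. x ^ m l)) m"
  using assms
proof (induction s arbitrary: F m)
  case (Suc s)
  have "(\<lambda>m. mult_var s g F m * (\<Prod>l<S. x ^ m l)) = mult_var s (Abs_fps (\<lambda>k. fps_nth g k * x ^ k)) (\<lambda>m. F m * (\<Prod>l<S. x ^ m l))"
    by (rule ext, rule mult_var_weight) (use Suc.prems in simp)
  then show ?case using Suc by simp
qed simp

context carlitz_data
begin

text \<open>
  Termwise convergence with a bound that decays in each exponent, uniformly in \<open>N\<close>: outside a fixed finite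
  box all terms are small.
\<close>

lemma lim_box_sum:
  assumes "\<And>m. (\<lambda>N. f N m) \<longlonglongrightarrow> (0 :: 'c)"
    and "\<And>N m i. i < s \<Longrightarrow> (\<And>i. s \<le> i \<Longrightarrow> m i = 0) \<Longrightarrow> nm (f N m) \<le> C * qinv ^ m i"
  shows "(\<lambda>N. \<Sum>m\<in>box s (E N). f N m) \<longlonglongrightarrow> 0"
  unfolding tendsto_0_nm
proof (rule LIMSEQ_I)
  fix e :: real assume e: "e > 0"
  have "(\<lambda>n. C * qinv ^ n) \<longlonglongrightarrow> C * 0"
    by (intro tendsto_mult tendsto_const qinv_power_null)
  then have "eventually (\<lambda>n. C * qinv ^ n < e / 2) sequentially"
    by (rule order_tendstoD(2)) (use e in simp)
  then obtain T where T: "\<And>n. n \<ge> T \<Longrightarrow> C * qinv ^ n < e / 2" by (auto simp: eventually_sequentially)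
  have "eventually (\<lambda>N. \<forall>m\<in>box s T. nm (f N m) < e / 2) sequentially"
  proof (rule eventually_ball_finite)
    show "\<forall>m\<in>box s T. eventually (\<lambda>N. nm (f N m) < e / 2) sequentially"
    proof
      fix m assume "m \<in> box s T"
      show "eventually (\<lambda>N. nm (f N m) < e / 2) sequentially"
        by (rule order_tendstoD(2)[OF assms(1)[unfolded tendsto_0_nm]]) (use e in simp)
    qed
  qed simp
  then obtain N0 where N0: "\<And>N m. N \<ge> N0 \<Longrightarrow> m \<in> box s T \<Longrightarrow> nm (f N m) < e / 2"
    by (auto simp: eventually_sequentially)
  show "\<exists>N0. \<forall>N\<ge>N0. norm (nm (\<Sum>m\<in>box s (E N). f N m) - 0) < e"
  proof (intro exI[of _ N0] allI impI)
    fix N assume N: "N \<ge> N0"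
    have "nm (\<Sum>m\<in>box s (E N). f N m) \<le> e / 2"
    proof (rule nm_sum_le)
      fix m assume m: "m \<in> box s (E N)"
      show "nm (f N m) \<le> e / 2"
      proof (cases "m \<in> box s T")
        case True
        then show ?thesis using N0[OF N] by (simp add: less_imp_le)
      next
        case False
        have z: "\<And>i. s \<le> i \<Longrightarrow> m i = 0" using m by (simp add: box_def)
        with False obtain i where i: "i < s" "m i > T" by (auto simp: box_def not_le)
        have "nm (f N m) \<le> C * qinv ^ m i"
          by (rule assms(2)[OF i(1)]) (rule z)
        also have "\<dots> \<le> e / 2" using T[of "m i"] i(2) by (simp add: less_imp_le)
        finally show ?thesis .
      qed
    qed (use e in simp)
    then show "norm (nm (\<Sum>m\<in>box s (E N). f N m) - 0) < e" using e by simp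
  qed
qed

lemma L_lim_of_V_lim: "L_lim s m = period * (inverse lam ^ s * mult_vars s (pole_prod 0) (V_lim s) m)"
proof -
  have "period * V_lim s m = mult_vars s omega_fps (L_lim s) m" for m by (simp add: V_lim_def)
  then have "mult_vars s (fps_const (inverse lam) * pole_prod 0) (\<lambda>m. period * V_lim s m) m = mult_vars s (fps_const (inverse lam) * pole_prod 0) (mult_vars s omega_fps (L_lim s)) m"
    by simp
  also have "\<dots> = mult_vars s (fps_const (inverse lam) * pole_prod 0 * (fps_const lam * pole_prod_inv)) (L_lim s) m"
    by (simp only: mult_vars_mult_vars omega_fps_eq)
  also have "fps_const (inverse lam) * pole_prod 0 * (fps_const lam * pole_prod_inv) = fps_const (inverse lam) * fps_const lam * (pole_prod 0 * pole_prod_inv)"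
    by (simp only: mult_ac)
  also have "\<dots> = 1" by (simp add: pole_prod_pole_prod_inv)
  finally show ?thesis by (simp add: mult_vars_const mult_vars_cmult mult_ac)
qed

definition pole_poly :: "nat \<Rightarrow> nat \<Rightarrow> 'c poly" where
  "pole_poly d N = (\<Prod>i<N. [:1, - inv_pole (i + d):])"

lemma fps_of_pole_poly: "fps_of_poly (pole_poly d N) = (\<Prod>i<N. pole_factor (i + d))"
proof -
  have "fps_of_poly [:1, - inv_pole i:] = pole_factor i" for i
    by (rule fps_ext) (simp add: pole_factor_nth coeff_pCons split: nat.splits)
  then show ?thesis by (simp add: pole_poly_def fps_of_poly_prod)
qed

lemma degree_pole_poly: "degree (pole_poly d N) \<le> N"
proof (induction N)
  case (Suc N)
  have "degree (pole_poly d (Suc N)) \<le> degree (pole_poly d N) + degree [:1, - inv_pole (N + d):]"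
    unfolding pole_poly_def prod.lessThan_Suc by (rule degree_mult_le)
  then show ?case using Suc by (simp split: if_splits)
qed (simp add: pole_poly_def)

lemma th_inv_pole: "d > 0 \<Longrightarrow> th * inv_pole (N + d) = unit_term (N + (d - 1))"
proof -
  assume "d > 0"
  then have "q ^ (N + d) = Suc (q ^ Suc (N + (d - 1)) - 1)" by simp
  then have "th ^ (q ^ (N + d)) = th * th ^ (q ^ Suc (N + (d - 1)) - 1)" by (metis power_Suc)
  then show ?thesis by (simp add: inv_pole_def unit_term_def divide_inverse del: power_Suc)
qed

lemma poly_pole_poly_th:
  assumes "d > 0"
  shows "poly (pole_poly d N) th * unit_prod (d - 1) = unit_prod (N + (d - 1))"
proof (induction N)
  case (Suc N)
  have "poly (pole_poly d (Suc N)) th = poly (pole_poly d N) th * (1 - th * inv_pole (N + d))"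
    by (simp add: pole_poly_def algebra_simps)
  then have "poly (pole_poly d (Suc N)) th = poly (pole_poly d N) th * (1 - unit_term (N + (d - 1)))"
    by (simp only: th_inv_pole[OF assms])
  then have "poly (pole_poly d (Suc N)) th * unit_prod (d - 1) = (poly (pole_poly d N) th * unit_prod (d - 1)) * (1 - unit_term (N + (d - 1)))"
    by (simp only: mult_ac)
  then show ?case by (simp only: Suc) (simp add: unit_prod_def)
qed (simp add: pole_poly_def)

lemma nm_pole_poly_scaled:
  assumes "d > 0"
  shows "nm (coeff (pole_poly d N) k * th ^ k) \<le> qinv ^ k"
proof (induction N arbitrary: k)
  case 0
  show ?case by (simp add: pole_poly_def coeff_1)
next
  case (Suc N)
  have c: "nm (inv_pole (N + d) * th) \<le> qinv"
  proof -
    have "nm (inv_pole (N + d) * th) = nm (unit_term (N + (d - 1)))"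
      by (simp only: mult.commute[of _ th] th_inv_pole[OF assms])
    also have "\<dots> \<le> qinv ^ 1"
      by (rule order_trans[OF nm_unit_term qinv_power_antimono]) simp
    finally show ?thesis by simp
  qed
  have eq: "pole_poly d (Suc N) = pole_poly d N - smult (inv_pole (N + d)) ([:0, 1:] * pole_poly d N)"
    by (simp add: pole_poly_def algebra_simps)
  show ?case
  proof (cases k)
    case 0
    then show ?thesis using Suc[of 0] by (simp add: eq)
  next
    case (Suc k')
    have "nm (inv_pole (N + d) * coeff (pole_poly d N) k' * th ^ k) = nm (inv_pole (N + d) * th) * nm (coeff (pole_poly d N) k' * th ^ k')"
      by (simp add: Suc nm_mult)
    also have "\<dots> \<le> qinv * qinv ^ k'"
      by (intro mult_mono c Suc.IH) auto
    finally have 1: "nm (inv_pole (N + d) * coeff (pole_poly d N) k' * th ^ k) \<le> qinv ^ k"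
      by (simp add: Suc)
    have "coeff (pole_poly d (Suc N)) k * th ^ k =
       coeff (pole_poly d N) k * th ^ k - inv_pole (N + d) * coeff (pole_poly d N) k' * th ^ k"
      unfolding eq by (simp add: Suc left_diff_distrib)
    then show ?thesis using nm_diff_leI[OF Suc.IH[of k] 1] by simp
  qed
qed

lemma nm_weight: "nm (\<Prod>i<s. th ^ m i) = real q ^ (\<Sum>i<s. m i)"
  by (simp add: nm_prod nm_power nm_th power_sum)

lemma twisted_L_decay:
  assumes "q ^ d > s" "i < s"
  shows "nm ((\<Sum>e<N. L_part s e m) ^ (q ^ d) * (\<Prod>i<s. th ^ m i)) \<le> qinv ^ m i"
  unfolding frob_sum sum_distrib_right
proof (rule nm_sum_le)
  fix e
  show "nm (L_part s e m ^ (q ^ d) * (\<Prod>i<s. th ^ m i)) \<le> qinv ^ m i"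
  proof (cases "\<exists>l<s. e < m l")
    case True
    then have "L_part s e m = 0" by (auto intro: L_part_eq_0)
    then show ?thesis by simp
  next
    case False
    then have m: "\<And>l. l < s \<Longrightarrow> m l \<le> e" by (meson not_less)
    have "(\<Sum>l<s. m l) \<le> (\<Sum>l<s. e)" by (intro sum_mono) (use m in auto)
    then have "(\<Sum>l<s. m l) \<le> s * e" by simp
    then have "nm (\<Prod>i<s. th ^ m i) \<le> real q ^ (s * e)"
      unfolding nm_weight using real_q_ge_2 by (intro power_increasing) auto
    moreover have "nm (L_part s e m ^ (q ^ d)) \<le> (qinv ^ e) ^ (q ^ d)"
      unfolding nm_power by (intro power_mono nm_L_part_le) simp
    ultimately have "nm (L_part s e m ^ (q ^ d) * (\<Prod>i<s. th ^ m i)) \<le> (qinv ^ e) ^ (q ^ d) * real q ^ (s * e)"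
      unfolding nm_mult by (intro mult_mono) auto
    also have "q ^ d = (q ^ d - s) + s" using assms by simp
    then have "(qinv ^ e) ^ (q ^ d) = (qinv ^ e) ^ (q ^ d - s) * (qinv ^ e) ^ s"
      by (metis power_add)
    also have "(qinv ^ e) ^ (q ^ d - s) * (qinv ^ e) ^ s * real q ^ (s * e) = (qinv ^ e) ^ (q ^ d - s)"
      using real_q_ge_2 by (simp add: power_one_over mult.commute[of s] flip: power_mult)
    also have "\<dots> \<le> (qinv ^ e) ^ 1"
      by (rule power_decreasing) (use assms qinv_power_antimono[of 0 e] in auto)
    also have "\<dots> \<le> qinv ^ m i"
      using qinv_power_antimono[OF m[OF assms(2)]] by simp
    finally show ?thesis .
  qed
qed simp

lemma eval_box_twisted_L:
  assumes "q ^ d > s" "N \<le> D"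
  shows "eval_box s D (\<lambda>_. th) (\<lambda>m. (\<Sum>e<N. L_part s e m) ^ (q ^ d)) = (\<Sum>e<N. \<Sum>a\<in>monics e. 1 / embed_A j a ^ (q ^ d - s))"
proof -
  have "eval_box s D (\<lambda>_. th) (\<lambda>m. (\<Sum>e<N. L_part s e m) ^ (q ^ d)) =
     eval_box s D (\<lambda>_. th) (\<lambda>m. \<Sum>e<N. 1 * (\<Sum>a\<in>monics e. (1 / embed_A j a) ^ (q ^ d) * chi_t s a m))"
    by (simp add: frob_sum L_part_def power_mult_distrib power_divide)
  also have "\<dots> = (\<Sum>e<N. 1 * (\<Sum>a\<in>monics e. (1 / embed_A j a) ^ (q ^ d) * eval_box s D (\<lambda>_. th) (chi_t s a)))"
    unfolding eval_box_sum ..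
  also have "\<dots> = (\<Sum>e<N. \<Sum>a\<in>monics e. 1 / embed_A j a ^ (q ^ d - s))"
    unfolding mult_1_left
  proof (intro sum.cong refl)
    fix e and a :: "'a poly" assume e: "e \<in> {..<N}" and a: "a \<in> monics e"
    then have "degree (tp a) \<le> D"
      using assms(2) by (intro degree_le) (auto simp: monics_def coeff_eq_0)
    then have "eval_box s D (\<lambda>_. th) (chi_t s a) = (\<Prod>i<s. poly (tp a) th)"
      unfolding chi_t_def by (intro eval_box_tensor_poly)
    also have "\<dots> = embed_A j a ^ s" using poly_tp_th[of a 0] by simp
    finally have "eval_box s D (\<lambda>_. th) (chi_t s a) = embed_A j a ^ s" .
    moreover have "embed_A j a \<noteq> 0" using a by (auto simp: monics_def)
    moreover have "embed_A j a ^ (q ^ d) = embed_A j a ^ (q ^ d - s) * embed_A j a ^ s"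
      using assms(1) by (simp flip: power_add)
    ultimately show "(1 / embed_A j a) ^ (q ^ d) * eval_box s D (\<lambda>_. th) (chi_t s a) = 1 / embed_A j a ^ (q ^ d - s)"
      by (simp add: power_one_over)
  qed
  finally show ?thesis .
qed

text \<open>
  \<open>L\<close> is \<open>\<pi> \<Prod>\<^sub>i \<omega>(t\<^sub>i)\<^sup>-\<^sup>1\<close> times the polynomial \<open>V\<close>. After twisting by \<open>q\<^sup>d\<close>, both sides are coefficientwise
  limits of polynomials: partial sums of \<open>L\<close> (called \<open>A N\<close>) and partial products of \<open>1 / \<omega>\<close> times \<open>V\<close> (called
  \<open>B N\<close>). Their coefficients decay fast enough, because \<open>q\<^sup>d > s\<close>, for the values at \<open>\<theta>\<close> to have the same limit. On
  one side that limit is a zeta value, on the other it involves \<open>\<Prod>\<^sub>i\<^sub>\<ge>\<^sub>d (1 - \<theta>\<^bsup>1 - q^i\<^esup>)\<close>, the quotient of the product in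
  \<open>\<pi>\<close> by the one in \<open>l\<^bsub>d-1\<^esub>\<close>.
\<close>

theorem eval_box_twisted_V:
  assumes s: "s \<ge> 2" "(q - 1) dvd (s - 1)" and d: "q ^ d > s"
    and supp: "\<And>m. m \<notin> box s D0 \<Longrightarrow> V_lim s m = 0"
  shows "eval_box s D0 (\<lambda>_. th) (\<lambda>m. V_lim s m ^ (q ^ d)) = (- ll (d - 1)) ^ s * fps_nth (inverse exp_quot) (q ^ d - s)"
proof -
  have dpos: "d > 0" using d s by (cases d) auto
  define Q where "Q = q ^ d"
  define n where "n = Q - s"
  have Q: "Q = n + s" using d by (simp add: n_def Q_def)
  have n: "n > 0" "(q - 1) dvd n"
  proof -
    show "n > 0" using d by (simp add: n_def Q_def)
    have "(q - 1) dvd Q - 1" unfolding Q_def by (rule q_minus_1_dvd)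
    moreover have "Q - 1 = n + (s - 1)" using Q s by simp
    ultimately show "(q - 1) dvd n" using s(2) by (metis dvd_add_left_iff)
  qed
  define W where "W m = (\<Prod>i<s. th ^ m i)" for m :: "nat \<Rightarrow> nat"
  define Vd where "Vd m = V_lim s m ^ Q" for m
  define c0 where "c0 = period ^ Q * (inverse lam ^ s) ^ Q"
  define A where "A N m = (\<Sum>e<N. L_part s e m) ^ Q" for N m
  define B where "B N m = c0 * mult_vars s (fps_of_poly (pole_poly d N)) Vd m" for N m
  define y where "y = eval_box s D0 (\<lambda>_. th) Vd"
  define c where "c = fps_nth (inverse exp_quot) n"
  have Vd_supp: "Vd m = 0" if "m \<notin> box s D0" for m
    using supp[OF that] by (simp add: Vd_def Q_def)
  \<comment> \<open>any finitely supported function decays, with a constant that depends on its support\<close>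
  define C where "C = (\<Sum>m\<in>box s D0. nm (Vd m * W m)) * real q ^ D0"
  have VdW: "nm (Vd m * W m) \<le> C * qinv ^ m i" if "i < s" for m i
  proof (cases "m \<in> box s D0")
    case True
    have "nm (Vd m * W m) \<le> (\<Sum>m\<in>box s D0. nm (Vd m * W m))"
      by (rule member_le_sum[OF True]) auto
    also have "\<dots> = C * qinv ^ D0"
      using real_q_ge_2 by (simp add: C_def power_one_over)
    also have "\<dots> \<le> C * qinv ^ m i"
      using True that by (intro mult_left_mono qinv_power_antimono) (auto simp: box_def C_def intro!: mult_nonneg_nonneg sum_nonneg)
    finally show ?thesis .
  next
    case False
    then show ?thesis by (auto simp: Vd_supp C_def intro!: divide_nonneg_nonneg mult_nonneg_nonneg sum_nonneg)
  qed
  have B_decay: "nm (B N m * W m) \<le> (nm c0 * C) * qinv ^ m i" if "i < s" for N m i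
  proof -
    have "mult_vars s (fps_of_poly (pole_poly d N)) Vd m * W m =
       mult_vars s (Abs_fps (\<lambda>k. fps_nth (fps_of_poly (pole_poly d N)) k * th ^ k)) (\<lambda>m. Vd m * W m) m"
      unfolding W_def by (rule mult_vars_weight) simp
    also have "nm \<dots> \<le> 1 ^ s * C * qinv ^ m i"
      by (rule mult_vars_decay) (use nm_pole_poly_scaled[OF dpos] VdW[OF that] in auto)
    finally show ?thesis
      by (simp add: B_def nm_mult mult.assoc mult_left_mono)
  qed
  have A_lim: "(\<lambda>N. A N m) \<longlonglongrightarrow> L_lim s m ^ Q" for m
    unfolding A_def by (intro lim_power L_lim_lim)
  have "L_lim s m ^ Q = c0 * mult_vars s (pole_prod d) Vd m" for m
    unfolding L_lim_of_V_lim power_mult_distrib c0_def Vd_def[abs_def] Q_def mult_vars_frob frob_pole_prod by simp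
  moreover have "(\<lambda>N. B N m) \<longlonglongrightarrow> c0 * mult_vars s (pole_prod d) Vd m" for m
    unfolding B_def by (intro lim_cmult mult_vars_lim tendsto_const) (simp only: fps_of_pole_poly pole_prod_lim)
  ultimately have B_lim: "(\<lambda>N. B N m) \<longlonglongrightarrow> L_lim s m ^ Q" for m by simp
  have AB: "(\<lambda>N. A N m * W m - B N m * W m) \<longlonglongrightarrow> 0" for m
    using lim_diff[OF lim_mult[OF A_lim tendsto_const] lim_mult[OF B_lim tendsto_const], of m "W m" m "W m"] by simp
  have "(\<lambda>N. \<Sum>m\<in>box s (D0 + N). A N m * W m - B N m * W m) \<longlonglongrightarrow> 0"
  proof (rule lim_box_sum[OF AB])
    fix N i and m :: "nat \<Rightarrow> nat" assume i: "i < s"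
    let ?r = "qinv ^ m i"
    have "nm (A N m * W m) \<le> ?r"
      unfolding A_def W_def Q_def by (rule twisted_L_decay[OF d i])
    then have "nm (A N m * W m) \<le> max 1 (nm c0 * C) * ?r"
      by (rule order_trans) (simp add: mult_le_cancel_right1 divide_right_mono)
    moreover have "nm (B N m * W m) \<le> max 1 (nm c0 * C) * ?r"
      by (rule order_trans[OF B_decay[OF i]]) (intro mult_right_mono, auto)
    ultimately show "nm (A N m * W m - B N m * W m) \<le> max 1 (nm c0 * C) * ?r"
      by (rule nm_diff_leI)
  qed
  moreover have "(\<Sum>m\<in>box s (D0 + N). A N m * W m - B N m * W m) =
      eval_box s (D0 + N) (\<lambda>_. th) (A N) - c0 * (unit_prod (N + (d - 1)) / unit_prod (d - 1)) ^ s * y" for N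
  proof -
    have "eval_box s (D0 + N) (\<lambda>_. th) (B N) = c0 * ((\<Prod>i<s. poly (pole_poly d N) th) * y)"
      unfolding B_def[abs_def] eval_box_cmult y_def
      by (subst eval_box_mult_vars_poly[OF Vd_supp degree_pole_poly order_refl]) auto
    moreover have "poly (pole_poly d N) th = unit_prod (N + (d - 1)) / unit_prod (d - 1)"
      using poly_pole_poly_th[OF dpos, of N] by (simp add: field_simps)
    ultimately show ?thesis by (simp add: eval_box_def W_def sum_subtractf mult.assoc)
  qed
  ultimately have "(\<lambda>N. eval_box s (D0 + N) (\<lambda>_. th) (A N) - c0 * (unit_prod (N + (d - 1)) / unit_prod (d - 1)) ^ s * y) \<longlonglongrightarrow> 0"
    by simp
  moreover have "(\<lambda>N. eval_box s (D0 + N) (\<lambda>_. th) (A N)) \<longlonglongrightarrow> period ^ n * c"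
    using carlitz_zeta[OF n] unfolding A_def[abs_def] Q_def c_def
    by (subst eval_box_twisted_L[OF d]) (auto simp: n_def Q_def)
  moreover have "(\<lambda>N. c0 * (unit_prod (N + (d - 1)) * inverse (unit_prod (d - 1))) ^ s * y) \<longlonglongrightarrow> c0 * (unit_lim * inverse (unit_prod (d - 1))) ^ s * y"
    by (rule lim_mult[OF lim_cmult[OF lim_power[OF lim_mult[OF LIMSEQ_ignore_initial_segment[OF unit_prod_lim] tendsto_const]]] tendsto_const])
  ultimately have eq: "period ^ n * c - c0 * (unit_lim * inverse (unit_prod (d - 1))) ^ s * y = 0"
    using LIMSEQ_unique lim_diff unfolding divide_inverse by blast
  define xi where "xi = period * inverse lam ^ Q * unit_lim * inverse (unit_prod (d - 1))"
  have "c0 = period ^ n * (period ^ s * (inverse lam ^ Q) ^ s)"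
  proof -
    have "(inverse lam ^ s) ^ Q = (inverse lam ^ Q) ^ s"
      by (simp only: power_mult[symmetric] mult.commute)
    moreover have "period ^ Q = period ^ n * period ^ s" by (simp only: Q power_add)
    ultimately show ?thesis by (simp only: c0_def mult.assoc)
  qed
  then have "c0 * (unit_lim * inverse (unit_prod (d - 1))) ^ s * y = period ^ n * (xi ^ s * y)"
    by (simp add: xi_def power_mult_distrib mult_ac)
  with eq have "period ^ n * c = period ^ n * (xi ^ s * y)" by (simp only: right_minus_eq)
  then have c_eq: "c = xi ^ s * y" by simp
  have "- ll (d - 1) * xi = 1"
  proof -
    obtain d' where d': "d = Suc d'" using dpos by (cases d) auto
    have "inverse lam ^ Q = inverse ((- th) ^ geom d * lam)"
      by (simp add: Q_def lam_frob power_inverse)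
    also have "(- th) ^ geom d = (- 1) ^ d * th ^ geom d"
      unfolding power_minus[of th] neg_one_geom ..
    also have "th ^ geom d = th * th ^ (q * geom d')"
      by (simp add: d' geom_Suc)
    finally have "xi = (th * lam) * inverse ((- 1) ^ d * (th * th ^ (q * geom d')) * lam) * inverse (unit_prod d')"
      by (simp add: xi_def period_eq d')
    then show ?thesis by (simp add: ll_formula d' field_simps)
  qed
  then have "(- ll (d - 1)) ^ s * xi ^ s = 1" by (simp flip: power_mult_distrib)
  then have "(- ll (d - 1)) ^ s * c = y" by (simp add: c_eq flip: mult.assoc)
  then show ?thesis by (simp add: y_def c_def n_def Vd_def[abs_def] Q_def)
qed

end

section \<open>The defining series of \<open>V\<close>\<close>

lemma box_zero: "m \<in> box s D \<Longrightarrow> s \<le> i \<Longrightarrow> m i = 0"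
  by (simp add: box_def)

lemma inj_on_lookup: "inj_on lookup A"
  by (rule inj_onI, rule poly_mapping_eqI, rule fun_cong)

lemma finite_splittings: "finite {(a, b). a + b = (m :: nat \<Rightarrow>\<^sub>0 nat)}"
proof -
  define S where "S = {a :: nat \<Rightarrow>\<^sub>0 nat. \<forall>i. lookup a i \<le> lookup m i}"
  obtain s where s: "keys m \<subseteq> {..<s}"
    using finite_nat_set_iff_bounded[of "keys m"] by auto
  obtain D where D: "\<And>i. i < s \<Longrightarrow> lookup m i \<le> D"
    using finite_nat_set_iff_bounded_le[of "lookup m ` {..<s}"] by auto
  have "lookup ` S \<subseteq> box s D"
  proof
    fix f assume "f \<in> lookup ` S"
    then have f: "f i \<le> lookup m i" for i by (auto simp: S_def)
    show "f \<in> box s D"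
      unfolding box_def
    proof (intro CollectI conjI allI impI)
      fix i assume "i < s"
      from f[of i] D[OF this] show "f i \<le> D" by (rule order_trans)
    next
      fix i assume "s \<le> i"
      then have "i \<notin> keys m" using s by auto
      then have "lookup m i = 0" by (simp add: in_keys_iff)
      then show "f i = 0" using f[of i] by simp
    qed
  qed
  then have "finite (lookup ` S)" by (rule finite_subset) simp
  then have "finite S"
    by (rule finite_imageD) (rule inj_on_lookup)
  then have "finite ((\<lambda>a. (a, m - a)) ` S)" by simp
  moreover have "{(a, b). a + b = m} \<subseteq> (\<lambda>a. (a, m - a)) ` S"
    by (auto simp: S_def lookup_add image_iff)
  ultimately show ?thesis by (rule finite_subset[rotated])
qed

text \<open>
  The splittings \<open>m = a + b\<close> in which \<open>b\<close> involves only \<open>t\<^sub>i\<close> are given by the exponent \<open>k\<close> of \<open>t\<^sub>i\<close> in \<open>b\<close>.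
\<close>

lemma mps_mult_of_fps:
  "mps_mult (\<lambda>m. F (lookup m)) (mps_of_fps i g) m = mult_var i g F (lookup m)"
proof -
  define K where "K = lookup m i"
  define sp where "sp k = (m - single i k, single i k)" for k :: nat
  define h where "h = (\<lambda>(a, b). F (lookup a) * mps_of_fps i g b)"
  have le: "lookup (single i k) l \<le> lookup m l" if "k \<le> K" for k l
    using that by (auto simp: lookup_single when_def K_def)
  have sub: "sp ` {..K} \<subseteq> {(a, b). a + b = m}"
  proof
    fix x assume "x \<in> sp ` {..K}"
    then obtain k where k: "x = sp k" "k \<le> K" by auto
    have "m - single i k + single i k = m"
      by (intro poly_mapping_eqI) (simp add: lookup_add lookup_minus le[OF k(2)])
    then show "x \<in> {(a, b). a + b = m}" by (simp add: sp_def k(1))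
  qed
  have zero: "h x = 0" if "x \<in> {(a, b). a + b = m} - sp ` {..K}" for x
  proof -
    obtain a b where ab: "x = (a, b)" by (cases x)
    with that have x: "a + b = m" "(a, b) \<notin> sp ` {..K}" by simp_all
    have "\<not> keys b \<subseteq> {i}"
    proof
      assume b: "keys b \<subseteq> {i}"
      define k where "k = lookup b i"
      have b_eq: "b = single i k"
        using b by (intro poly_mapping_eqI) (auto simp: lookup_single when_def k_def in_keys_iff)
      have "k \<le> K" using x(1) by (auto simp: K_def k_def lookup_add)
      moreover have "a = m - single i k" using x(1) b_eq by auto
      ultimately have "(a, b) \<in> sp ` {..K}" using b_eq by (auto simp: sp_def)
      with x(2) show False by blast
    qed
    then show ?thesis by (simp add: h_def ab mps_of_fps_def)
  qed
  have "mps_mult (\<lambda>m. F (lookup m)) (mps_of_fps i g) m = sum h {(a, b). a + b = m}"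
    by (simp add: mps_mult_def h_def)
  also have "\<dots> = sum h (sp ` {..K})"
    by (rule sum.mono_neutral_right[OF finite_splittings sub]) (use zero in blast)
  also have "\<dots> = (\<Sum>k\<le>K. h (sp k))"
  proof (subst sum.reindex)
    show "inj_on sp {..K}"
      by (rule inj_onI) (metis lookup_single_eq prod.inject sp_def)
  qed simp
  also have "\<dots> = (\<Sum>k\<le>K. fps_nth g k * F ((lookup m)(i := K - k)))"
  proof (intro sum.cong refl)
    fix k
    have "lookup (m - single i k) = (lookup m)(i := K - k)"
      by (rule ext) (simp add: lookup_minus lookup_single when_def K_def)
    then show "h (sp k) = fps_nth g k * F ((lookup m)(i := K - k))"
      by (simp add: h_def sp_def mps_of_fps_def mult.commute)
  qed
  finally show ?thesis by (simp add: mult_var_altdef K_def)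
qed

lemma foldr_mps_mult:
  "foldr (\<lambda>i F. mps_mult F (mps_of_fps i g)) [0..<s] (\<lambda>m. F (lookup m)) =
     (\<lambda>m. mult_vars s g F (lookup m))"
proof (induction s arbitrary: F)
  case (Suc s)
  have "mps_mult (\<lambda>m. F (lookup m)) (mps_of_fps s g) = (\<lambda>m. mult_var s g F (lookup m))"
    by (rule ext) (rule mps_mult_of_fps)
  then show ?case by (simp add: Suc.IH)
qed simp

lemma lookup_prod_chi:
  fixes a :: "'a::finite_field poly"
  shows "lookup (\<Prod>i<s. chi i a) m =
     (if keys m \<subseteq> {..<s} then \<Prod>i<s. coeff a (lookup m i) else 0)"
proof -
  define e where "e f = (\<Sum>i<s. single i (f i))" for f :: "nat \<Rightarrow> nat"
  have e: "lookup (e f) l = (if l < s then f l else 0)" for f l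
    by (simp add: e_def lookup_sum lookup_single when_def)
  have prod_single: "(\<Prod>i\<in>A. single (x i) (c i)) = single (\<Sum>i\<in>A. x i) (\<Prod>i\<in>A. c i)"
    if "finite A" for A and x :: "nat \<Rightarrow> nat \<Rightarrow>\<^sub>0 nat" and c :: "nat \<Rightarrow> 'a"
    using that by (induction A rule: finite_induct) (simp_all add: mult_single)
  let ?P = "PiE {..<s} (\<lambda>_. {..degree a})"
  have "(\<Prod>i<s. chi i a) = (\<Sum>f\<in>?P. \<Prod>i<s. single (single i (f i)) (coeff a (f i)))"
    unfolding chi_def by (rule prod_sum_PiE) auto
  also have "\<dots> = (\<Sum>f\<in>?P. single (e f) (\<Prod>i<s. coeff a (f i)))"
    by (simp add: prod_single e_def)
  finally have eq: "lookup (\<Prod>i<s. chi i a) m = (\<Sum>f\<in>?P. if e f = m then \<Prod>i<s. coeff a (f i) else 0)"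
    by (simp add: lookup_sum lookup_single when_def)
  show ?thesis
  proof (cases "keys m \<subseteq> {..<s}")
    case False
    have "e f \<noteq> m" for f
    proof
      assume "e f = m"
      then have "keys m \<subseteq> {..<s}" using e[of f] by (auto simp: in_keys_iff split: if_splits)
      with False show False by blast
    qed
    then show ?thesis using False by (simp add: eq)
  next
    case True
    define f0 where "f0 = restrict (lookup m) {..<s}"
    have e_iff: "e f = m \<longleftrightarrow> f = f0" if "f \<in> ?P" for f
    proof
      assume ef: "e f = m"
      show "f = f0"
      proof
        fix i
        show "f i = f0 i"
          using ef e[of f i] that by (cases "i < s") (auto simp: f0_def PiE_def extensional_def)
      qed
    next
      assume "f = f0"
      then show "e f = m"
        using True by (intro poly_mapping_eqI) (auto simp: e f0_def in_keys_iff)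
    qed
    have "(\<Sum>f\<in>?P. if e f = m then \<Prod>i<s. coeff a (f i) else 0) =
        (\<Sum>f\<in>?P. if f = f0 then \<Prod>i<s. coeff a (f i) else 0)"
      by (intro sum.cong refl) (simp add: e_iff)
    also have "\<dots> = (if f0 \<in> ?P then \<Prod>i<s. coeff a (f0 i) else 0)"
      by (subst sum.delta) (auto intro!: finite_PiE)
    also have "\<dots> = (\<Prod>i<s. coeff a (lookup m i))"
    proof (cases "f0 \<in> ?P")
      case True
      then show ?thesis by (simp add: f0_def)
    next
      case False
      moreover have "f0 \<in> ?P" if "\<forall>i<s. lookup m i \<le> degree a"
        using that by (auto simp: f0_def)
      ultimately obtain i where "i < s" "degree a < lookup m i"
        by (meson not_le)
      then have "(\<Prod>i<s. coeff a (lookup m i)) = 0"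
        by (intro prod_zero bexI[of _ i]) (auto simp: coeff_eq_0)
      then show ?thesis using False by simp
    qed
    finally show ?thesis using True by (simp add: eq)
  qed
qed

context poly_embedding
begin

lemma chi_t_lookup: "emb [:lookup (\<Prod>i<s. chi i a) m:] = chi_t s a (lookup m)"
proof -
  have keys: "keys m \<subseteq> {..<s} \<longleftrightarrow> (\<forall>i\<ge>s. lookup m i = 0)"
    by (auto simp: in_keys_iff subset_iff not_less[symmetric])
  have "ec (\<Prod>i<s. f i) = (\<Prod>i<s. ec (f i))" for f
    by (induction s) (simp_all add: ec_mult)
  note ec_prod = this
  have "ec (lookup (\<Prod>i<s. chi i a) m) = chi_t s a (lookup m)"
  proof (cases "\<forall>i\<ge>s. lookup m i = 0")
    case False
    show ?thesis
      unfolding lookup_prod_chi chi_t_def tensor_def keys if_not_P[OF False] by simp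
  qed (simp add: lookup_prod_chi chi_t_def tensor_def keys ec_prod)
  then show ?thesis by (simp add: ec_def)
qed

text \<open>
  The extension of \<open>emb\<close> to the field of fractions.
\<close>

definition frac_emb :: "'a poly fract \<Rightarrow> 'b" where
  "frac_emb x = (THE y. \<exists>a b. b \<noteq> 0 \<and> x = to_fract a / to_fract b \<and> y = emb a / emb b)"

lemma frac_emb_divide: "b \<noteq> 0 \<Longrightarrow> frac_emb (to_fract a / to_fract b) = emb a / emb b"
  unfolding frac_emb_def
proof (rule the_equality)
  fix y assume b: "b \<noteq> 0" and "\<exists>a' b'. b' \<noteq> 0 \<and> to_fract a / to_fract b = to_fract a' / to_fract b' \<and> y = emb a' / emb b'"
  then obtain a' b' where *: "b' \<noteq> 0" "to_fract a / to_fract b = to_fract a' / to_fract b'" "y = emb a' / emb b'" by blast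
  then have "to_fract (a * b') = to_fract (a' * b)" using b by (simp add: frac_eq_eq)
  then have "a * b' = a' * b" by (simp only: to_fract_eq_iff)
  then have "emb a * emb b' = emb a' * emb b" by (simp flip: emb_mult)
  then show "y = emb a / emb b" using b * by (simp add: frac_eq_eq)
qed blast

lemma fract_cases: obtains a b :: "'a poly" where "b \<noteq> 0" "x = to_fract a / to_fract b"
  by (cases x) (auto simp: Fract_conv_to_fract)

lemma frac_emb_to_fract: "frac_emb (to_fract a) = emb a"
  using frac_emb_divide[of 1 a] by simp

lemma frac_emb_add: "frac_emb (x + y) = frac_emb x + frac_emb y"
proof -
  obtain a b where 1: "b \<noteq> 0" "x = to_fract a / to_fract b" by (rule fract_cases)
  obtain a' b' where 2: "b' \<noteq> 0" "y = to_fract a' / to_fract b'" by (rule fract_cases)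
  have "x + y = to_fract (a * b' + a' * b) / to_fract (b * b')"
    using 1 2 by (simp add: add_frac_eq)
  moreover have "b * b' \<noteq> 0" using 1 2 by simp
  ultimately have "frac_emb (x + y) = emb (a * b' + a' * b) / emb (b * b')"
    by (metis frac_emb_divide)
  then show ?thesis using 1 2 by (simp add: frac_emb_divide emb_add emb_mult add_frac_eq)
qed

lemma frac_emb_mult: "frac_emb (x * y) = frac_emb x * frac_emb y"
proof -
  obtain a b where 1: "b \<noteq> 0" "x = to_fract a / to_fract b" by (rule fract_cases)
  obtain a' b' where 2: "b' \<noteq> 0" "y = to_fract a' / to_fract b'" by (rule fract_cases)
  have "x * y = to_fract (a * a') / to_fract (b * b')" using 1 2 by simp
  moreover have "b * b' \<noteq> 0" using 1 2 by simp
  ultimately have "frac_emb (x * y) = emb (a * a') / emb (b * b')"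
    by (metis frac_emb_divide)
  then show ?thesis using 1 2 by (simp add: frac_emb_divide emb_mult)
qed

lemma frac_emb_0 [simp]: "frac_emb 0 = 0" and frac_emb_1 [simp]: "frac_emb 1 = 1"
  using frac_emb_to_fract[of 0] frac_emb_to_fract[of 1] by simp_all

lemma frac_emb_sum: "frac_emb (sum f A) = (\<Sum>x\<in>A. frac_emb (f x))"
  by (induction A rule: infinite_finite_induct) (simp_all add: frac_emb_add)

lemma frac_emb_power: "frac_emb (x ^ n) = frac_emb x ^ n"
  by (induction n) (simp_all add: frac_emb_mult)

lemma frac_emb_inj: "frac_emb x = frac_emb y \<Longrightarrow> x = y"
proof -
  assume eq: "frac_emb x = frac_emb y"
  obtain a b where 1: "b \<noteq> 0" "x = to_fract a / to_fract b" by (rule fract_cases)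
  obtain a' b' where 2: "b' \<noteq> 0" "y = to_fract a' / to_fract b'" by (rule fract_cases)
  from eq have "emb (a * b') = emb (a' * b)"
    using 1 2 by (simp add: frac_emb_divide emb_mult frac_eq_eq)
  then have "a * b' = a' * b" by simp
  then have "to_fract a * to_fract b' = to_fract a' * to_fract b" by (simp flip: to_fract_mult)
  then show "x = y" using 1 2 by (simp add: frac_eq_eq)
qed

end

section \<open>Bernoulli--Carlitz fractions\<close>

text \<open>
  \<open>exp(z) / z\<close> over \<open>K\<close>
\<close>

definition exp_quot_K :: "'a::finite_field poly fract fps" where
  "exp_quot_K = Abs_fps (\<lambda>k. \<Sum>n | Suc k = CARD('a) ^ n. 1 / to_fract (carlitz_d n))"

lemma exp_quot_K_nth_0: "fps_nth (exp_quot_K :: 'a::finite_field poly fract fps) 0 = 1"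
proof -
  have "n = 0" if "Suc 0 = CARD('a) ^ n" for n
    using power_gt_expt[of "CARD('a)" n] that card_finite_field_ge_2[where ?'a = 'a] by simp
  then have "{n. Suc 0 = CARD('a) ^ n} = {0}" by auto
  then show ?thesis by (simp add: exp_quot_K_def)
qed

lemma X_over_carlitz_exp: "fps_X / carlitz_exp = inverse (exp_quot_K :: 'a::finite_field poly fract fps)"
proof -
  have exp_eq: "carlitz_exp = fps_X * (exp_quot_K :: 'a poly fract fps)"
  proof (rule fps_ext)
    fix m
    show "fps_nth (carlitz_exp :: 'a poly fract fps) m = fps_nth (fps_X * exp_quot_K) m"
      by (cases m) (simp_all add: carlitz_exp_def exp_quot_K_def)
  qed
  have nz: "exp_quot_K \<noteq> (0 :: 'a poly fract fps)"
    using exp_quot_K_nth_0[where ?'a = 'a] by auto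
  have "exp_quot_K * inverse exp_quot_K = (1 :: 'a poly fract fps)"
    by (rule inverse_mult_eq_1') (simp add: exp_quot_K_nth_0)
  then have "carlitz_exp * inverse exp_quot_K = (fps_X :: 'a poly fract fps)"
    by (simp add: exp_eq mult.assoc)
  then show ?thesis
    using nz by (metis exp_eq fps_X_neq_zero mult_eq_0_iff nonzero_mult_div_cancel_left)
qed

lemma base_expansion_digit:
  fixes q s r :: nat
  assumes "s = (\<Sum>i\<le>r. sd i * q ^ i)" "\<forall>i\<le>r. sd i < q"
  shows "s div q ^ i mod q = (if i \<le> r then sd i else 0)"
  using assms
proof (induction r arbitrary: s sd i)
  case 0
  show ?case
  proof (cases i)
    case (Suc i')
    have "q > 0" using 0 by auto
    then have "q * 1 \<le> q * q ^ i'" by (intro mult_le_mono) (auto simp: Suc_leI)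
    moreover have "s < q" using 0 by simp
    ultimately have "s < q * q ^ i'" by linarith
    then show ?thesis using Suc by simp
  qed (use 0 in simp)
next
  case (Suc r)
  define s' where "s' = (\<Sum>i\<le>r. sd (Suc i) * q ^ i)"
  have "s = sd 0 + q * s'"
    unfolding Suc.prems(1) sum.atMost_Suc_shift s'_def by (simp add: sum_distrib_left mult_ac)
  moreover have "sd 0 < q" using Suc.prems(2) by simp
  ultimately have s: "s div q = s'" "s mod q = sd 0" by simp_all
  show ?case
  proof (cases i)
    case 0
    then show ?thesis using s by simp
  next
    case (Suc i')
    have "s div q ^ i = s' div q ^ i'" using s by (simp add: Suc div_mult2_eq)
    also have "\<dots> mod q = (if i' \<le> r then sd (Suc i') else 0)"
      by (rule Suc.IH[OF s'_def]) (use Suc.prems(2) in auto)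
    finally show ?thesis using Suc by simp
  qed
qed

lemma carlitz_factorial_expansion:
  fixes sd :: "nat \<Rightarrow> nat"
  assumes "s = (\<Sum>i\<le>r. sd i * CARD('a) ^ i)" "\<forall>i\<le>r. sd i < CARD('a)"
  shows "carlitz_factorial s = (\<Prod>i\<le>r. (carlitz_d i :: 'a::finite_field poly) ^ sd i)"
proof -
  define g where "g i = (carlitz_d i :: 'a poly) ^ (s div CARD('a) ^ i mod CARD('a))" for i
  have digit: "s div CARD('a) ^ i mod CARD('a) = (if i \<le> r then sd i else 0)" for i
    by (rule base_expansion_digit[OF assms])
  have "s div CARD('a) ^ i = 0" if "i > s" for i
  proof -
    have "i < CARD('a) ^ i" using card_finite_field_ge_2[where ?'a = 'a] by (intro power_gt_expt) simp
    then show ?thesis using that by simp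
  qed
  then have "prod g {..s} = prod g {..max s r}"
    by (intro prod.mono_neutral_left) (auto simp: g_def)
  also have "\<dots> = prod g {..r}"
    by (intro prod.mono_neutral_right) (auto simp: g_def digit)
  finally show ?thesis by (simp add: carlitz_factorial_def g_def digit)
qed

lemma carlitz_d_nonzero: "carlitz_d n \<noteq> (0 :: 'a::finite_field poly)"
proof -
  interpret poly_embedding "CARD('a)" "to_fract :: 'a poly \<Rightarrow> 'a poly fract"
    by unfold_locales simp_all
  show ?thesis using dd_nonzero[of n] by (simp add: dd_def)
qed

context prime_embedding
begin

text \<open>
  Passing from \<open>i\<close> to \<open>i + 1\<close>, the last factor of \<open>l\<^bsub>d-i-1\<^esub>\<close> contributes
  \<open>\<theta>\<^bsup>q^(i+1)\<^esup> - \<theta>\<^bsup>q^d\<^esup> \<equiv> \<theta>\<^bsup>q^(i+1)\<^esup> - \<theta>\<close>, the factor by which \<open>d\<^bsub>i+1\<^esub>\<close> exceeds \<open>d\<^sub>i\<^sup>q\<close>.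
\<close>

lemma carlitz_l_power_cong:
  "i < d \<Longrightarrow> [carlitz_l (d - 1) ^ (q ^ i) = carlitz_d i * carlitz_l (d - i - 1) ^ (q ^ i)] (mod p)"
proof (induction i)
  case (Suc i)
  have frob_diff_poly: "(x - y) ^ (q ^ n) = x ^ (q ^ n) - y ^ (q ^ n)" for x y :: "'a poly" and n
    using power_card_add[where ?'a = 'a and ?'b = "'a poly" and n = n, of "x - y" y]
    by (simp add: algebra_simps q_def)
  let ?k = "d - Suc i - 1"
  have k: "d - i - 1 = Suc ?k" "Suc ?k + Suc i = d" using Suc.prems by simp_all
  have "carlitz_l (d - i - 1) ^ (q ^ Suc i) = (theta - theta ^ (q ^ Suc ?k)) ^ (q ^ Suc i) * (carlitz_l ?k :: 'a poly) ^ (q ^ Suc i)"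
    unfolding k(1) carlitz_l_Suc q_def power_mult_distrib ..
  also have "(theta - theta ^ (q ^ Suc ?k)) ^ (q ^ Suc i) = theta ^ (q ^ Suc i) - (theta ^ (q ^ d) :: 'a poly)"
    by (simp only: frob_diff_poly power_mult[symmetric] power_add[symmetric] k(2))
  finally have l: "carlitz_l (d - i - 1) ^ (q ^ Suc i) = (theta ^ (q ^ Suc i) - theta ^ (q ^ d) :: 'a poly) * carlitz_l ?k ^ (q ^ Suc i)" .
  have "[(carlitz_l (d - 1) ^ (q ^ i)) ^ q = (carlitz_d i * carlitz_l (d - i - 1) ^ (q ^ i)) ^ q] (mod p)"
    by (rule cong_pow) (use Suc in simp)
  then have "[carlitz_l (d - 1) ^ (q ^ Suc i) = carlitz_d i ^ q * carlitz_l (d - i - 1) ^ (q ^ Suc i)] (mod p)"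
    by (simp only: power_mult_distrib power_mult[symmetric] power_Suc2)
  also have "[carlitz_d i ^ q * carlitz_l (d - i - 1) ^ (q ^ Suc i) =
      carlitz_d i ^ q * ((theta ^ (q ^ Suc i) - theta) * carlitz_l ?k ^ (q ^ Suc i))] (mod p)"
    unfolding l
    by (intro cong_mult cong_refl cong_diff) (simp add: cong_iff_dvd_diff theta_frobenius_cong)
  also have "carlitz_d i ^ q * ((theta ^ (q ^ Suc i) - theta) * carlitz_l ?k ^ (q ^ Suc i) :: 'a poly) =
      carlitz_d (Suc i) * carlitz_l (d - Suc i - 1) ^ (q ^ Suc i)"
    unfolding carlitz_d_Suc q_def by (simp only: mult_ac)
  finally show ?case .
qed simp

lemma carlitz_l_factorial_cong:
  assumes s: "s = (\<Sum>i\<le>r. sd i * q ^ i)" "\<forall>i\<le>r. sd i < q" and d: "q ^ d > s"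
  shows "[carlitz_l (d - 1) ^ s = carlitz_factorial s * (\<Prod>i\<le>r. carlitz_l (d - i - 1) ^ (sd i * q ^ i))] (mod p)"
proof -
  have sd_0: "sd i = 0" if "i \<le> r" "d \<le> i" for i
  proof (rule ccontr)
    assume "sd i \<noteq> 0"
    then have "q ^ i \<le> sd i * q ^ i" by simp
    also have "\<dots> \<le> s" unfolding s(1) by (rule member_le_sum) (use that in auto)
    also have "s < q ^ d" by fact
    also have "\<dots> \<le> q ^ i" using that by (intro power_increasing) (auto simp: Suc_leI)
    finally show False by simp
  qed
  have "carlitz_l (d - 1) ^ s = (\<Prod>i\<le>r. (carlitz_l (d - 1) ^ (q ^ i)) ^ sd i)"
    unfolding s(1) power_sum by (simp add: power_mult[symmetric] mult.commute)
  also have "[\<dots> = (\<Prod>i\<le>r. (carlitz_d i * carlitz_l (d - i - 1) ^ (q ^ i)) ^ sd i)] (mod p)"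
  proof (rule cong_prod)
    fix i assume "i \<in> {..r}"
    show "[(carlitz_l (d - 1) ^ (q ^ i)) ^ sd i = (carlitz_d i * carlitz_l (d - i - 1) ^ (q ^ i)) ^ sd i] (mod p)"
    proof (cases "i < d")
      case True
      then show ?thesis by (intro cong_pow carlitz_l_power_cong)
    next
      case False
      then show ?thesis using \<open>i \<in> {..r}\<close> sd_0[of i] by simp
    qed
  qed
  also have "(\<Prod>i\<le>r. (carlitz_d i * carlitz_l (d - i - 1) ^ (q ^ i)) ^ sd i :: 'a poly) =
      carlitz_factorial s * (\<Prod>i\<le>r. carlitz_l (d - i - 1) ^ (sd i * q ^ i))"
    unfolding carlitz_factorial_expansion[OF s[unfolded q_def]] prod.distrib[symmetric]
    by (intro prod.cong refl) (simp add: power_mult_distrib power_mult[symmetric] mult.commute)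
  finally show ?thesis .
qed

lemma not_dvd_carlitz_factorial:
  assumes "q ^ d > s" shows "\<not> p dvd carlitz_factorial s"
proof
  assume "p dvd carlitz_factorial s"
  then obtain i where i: "i \<le> s" "p dvd carlitz_d i ^ (s div q ^ i mod q)"
    unfolding carlitz_factorial_def q_def by (auto dest!: p_dvd_prodD)
  have "p dvd carlitz_d i" using i(2) by (rule p_dvd_powerD)
  then have "d \<le> i" using not_dvd_carlitz_d[of i] by (meson not_less)
  then have "q ^ d \<le> q ^ i" by (intro power_increasing) (auto simp: Suc_leI)
  then have "s div q ^ i = 0" using assms by simp
  then show False using i(2) p_not_dvd_1 by simp
qed

end

text \<open>
  Below degree \<open>q\<^sup>d - 1\<close>, only the \<open>1 / d\<^sub>i\<close> with \<open>i < d\<close> enter.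
\<close>

lemma exp_quot_K_inverse_integral:
  fixes p :: "'a::finite_field poly"
  assumes "prime_embedding CARD('a) to_fract p d" "k < CARD('a) ^ d - 1"
  shows "fps_nth (inverse exp_quot_K) k \<in> local_ring to_fract p"
proof -
  interpret prime_embedding "CARD('a)" to_fract p d by fact
  have coeff: "fps_nth exp_quot_K k \<in> local_ring to_fract p" if "k < CARD('a) ^ d - 1" for k
    unfolding exp_quot_K_def fps_nth_Abs_fps
  proof (rule Loc_sum)
    fix n assume "n \<in> {n. Suc k = CARD('a) ^ n}"
    then have "CARD('a) ^ n < CARD('a) ^ d" using that by simp
    then have "n < d" using card_finite_field_ge_2[where ?'a = 'a] by (metis power_less_imp_less_exp less_le_trans one_less_numeral_iff semiring_norm(76))
    then show "1 / to_fract (carlitz_d n) \<in> local_ring to_fract p"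
      by (intro Loc_inverse not_dvd_carlitz_d)
  qed
  show ?thesis
    using assms(2)
  proof (induction k rule: less_induct)
    case (less k)
    show ?case
    proof (cases k)
      case 0
      then show ?thesis by (simp add: exp_quot_K_nth_0)
    next
      case (Suc k')
      have "fps_nth (inverse exp_quot_K) k = - (\<Sum>i=1..k. fps_nth exp_quot_K i * fps_nth (inverse exp_quot_K) (k - i))"
        using Suc by (simp add: fps_inverse_def exp_quot_K_nth_0 sum_negf)
      also have "\<dots> \<in> local_ring to_fract p"
        by (intro Loc_minus Loc_sum Loc_mult coeff less.IH) (use less.prems in auto)
      finally show ?thesis .
    qed
  qed
qed

context carlitz_data
begin

lemma frac_emb_exp_frac: "frac_emb (fps_nth exp_quot_K k) = fps_nth exp_quot k"
proof -
  have "frac_emb (1 / to_fract (carlitz_d n)) = 1 / dd n" for n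
    using frac_emb_divide[of "carlitz_d n" 1] carlitz_d_nonzero[where ?'a = 'a] by (simp add: dd_def)
  then show ?thesis by (simp add: exp_quot_K_def exp_quot_def frac_emb_sum flip: q_def)
qed

lemma frac_emb_exp_frac_inverse: "frac_emb (fps_nth (inverse exp_quot_K) k) = fps_nth (inverse exp_quot) k"
proof -
  have "exp_quot * Abs_fps (\<lambda>k. frac_emb (fps_nth (inverse exp_quot_K) k)) = 1"
  proof (rule fps_ext)
    fix k
    have "exp_quot_K * inverse exp_quot_K = (1 :: 'a poly fract fps)"
      by (rule inverse_mult_eq_1') (simp add: exp_quot_K_nth_0)
    then have "frac_emb (fps_nth (exp_quot_K * inverse exp_quot_K) k) = frac_emb (fps_nth (1 :: 'a poly fract fps) k)"
      by (simp only:)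
    then show "fps_nth (exp_quot * Abs_fps (\<lambda>k. frac_emb (fps_nth (inverse exp_quot_K) k))) k = fps_nth 1 k"
      by (simp add: fps_mult_nth frac_emb_sum frac_emb_mult frac_emb_exp_frac)
  qed
  then have "inverse exp_quot = Abs_fps (\<lambda>k. frac_emb (fps_nth (inverse exp_quot_K) k))"
    by (rule fps_inverse_unique)
  then show ?thesis by simp
qed

lemma L_series_eq: "L_series j s m = L_lim s (lookup m)"
proof -
  have "(\<Sum>a\<in>monics d. embed_A j [:lookup (\<Prod>i<s. chi i a) m:] / embed_A j a) = L_part s d (lookup m)" for d
    by (simp add: L_part_def chi_t_lookup)
  moreover have "(\<lambda>d. L_part s d (lookup m)) sums L_lim s (lookup m)"
    unfolding sums_def by (rule L_lim_lim)
  ultimately show ?thesis by (simp add: L_series_def sums_unique[symmetric])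
qed

lemma V_series_eq: "V_series j lam s m = V_lim s (lookup m)"
proof -
  have "L_series j s = (\<lambda>m. L_lim s (lookup m))"
    by (rule ext) (rule L_series_eq)
  then show ?thesis
    by (simp add: V_series_def foldr_mps_mult V_lim_def period_def omega_fps_def)
qed

text \<open>
  The coefficients of \<open>V\<close> lie in \<open>A\<close> and almost all vanish, so the polynomial that \<open>V_poly\<close> describes exists.
\<close>

lemma V_poly_lookup:
  assumes s: "s \<ge> 2" "(q - 1) dvd (s - 1)"
  shows "embed_A j (lookup (V_poly j lam s) m) = V_lim s (lookup m)"
proof -
  have "\<exists>D. \<forall>m. m \<notin> box s D \<longrightarrow> V_lim s m = 0" by (rule V_lim_support[OF s]) blast
  then obtain D where D: "\<And>m. m \<notin> box s D \<Longrightarrow> V_lim s m = 0" by blast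
  define v where "v m = inv_into UNIV (embed_A j) (V_lim s (lookup m))" for m
  have v: "embed_A j (v m) = V_lim s (lookup m)" for m
    unfolding v_def by (rule f_inv_into_f) (rule V_lim_integral[OF s])
  have "finite {m. v m \<noteq> 0}"
  proof -
    have "lookup ` {m. v m \<noteq> 0} \<subseteq> box s D"
    proof
      fix f assume "f \<in> lookup ` {m. v m \<noteq> 0}"
      then obtain m where m: "f = lookup m" "v m \<noteq> 0" by auto
      then have "V_lim s f \<noteq> 0" using v[of m] by (metis emb_eq_0_iff)
      then show "f \<in> box s D" using D by blast
    qed
    then have "finite (lookup ` {m. v m \<noteq> 0})" by (rule finite_subset) simp
    then show ?thesis by (rule finite_imageD) (rule inj_on_lookup)
  qed
  then have lookup: "lookup (Abs_poly_mapping v) = v" by simp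
  have "V_poly j lam s = Abs_poly_mapping v"
    unfolding V_poly_def
  proof (rule the_equality)
    show "\<forall>m. embed_A j (lookup (Abs_poly_mapping v) m) = V_series j lam s m"
      by (simp add: lookup v V_series_eq)
    fix P assume P: "\<forall>m. embed_A j (lookup P m) = V_series j lam s m"
    show "P = Abs_poly_mapping v"
    proof (rule poly_mapping_eqI)
      fix m
      have "embed_A j (lookup P m) = embed_A j (v m)" using P by (simp add: V_series_eq v)
      then show "lookup P m = lookup (Abs_poly_mapping v) m" by (simp add: lookup)
    qed
  qed
  then show ?thesis by (simp add: lookup v)
qed

lemma twisted_V_poly_value:
  assumes s: "s \<ge> 2" "(q - 1) dvd (s - 1)" and d: "q ^ d > s"
  shows "to_fract (\<Sum>m\<in>keys (V_poly j lam s). lookup (V_poly j lam s) m ^ (q ^ d) *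
           (\<Prod>i\<in>keys m. theta ^ lookup m i)) =
     (- to_fract (carlitz_l (d - 1))) ^ s * fps_nth (inverse exp_quot_K) (q ^ d - s)"
proof (rule frac_emb_inj)
  let ?P = "V_poly j lam s"
  have "\<exists>D. \<forall>m. m \<notin> box s D \<longrightarrow> V_lim s m = 0" by (rule V_lim_support[OF s]) blast
  then obtain D where D: "\<And>m. m \<notin> box s D \<Longrightarrow> V_lim s m = 0" by blast
  define h where "h m = V_lim s m ^ (q ^ d) * (\<Prod>i<s. th ^ m i)" for m
  have P: "embed_A j (lookup ?P m) = V_lim s (lookup m)" for m
    by (rule V_poly_lookup[OF s])
  have keys: "m \<in> keys ?P \<longleftrightarrow> V_lim s (lookup m) \<noteq> 0" for m
    unfolding in_keys_iff P[symmetric] by simp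
  have summand: "embed_A j (lookup ?P m ^ (q ^ d) * (\<Prod>i\<in>keys m. theta ^ lookup m i)) = h (lookup m)"
    if "m \<in> keys ?P" for m
  proof -
    have "V_lim s (lookup m) \<noteq> 0" using that keys by blast
    then have "lookup m \<in> box s D" using D by blast
    then have "keys m \<subseteq> {..<s}" by (metis box_zero in_keys_iff lessThan_iff not_le subsetI)
    then have "(\<Prod>i\<in>keys m. th ^ lookup m i) = (\<Prod>i<s. th ^ lookup m i)"
      by (intro prod.mono_neutral_left) (auto simp: in_keys_iff)
    then show ?thesis
      by (simp add: emb_mult emb_power emb_prod P h_def th_def[symmetric])
  qed
  have "embed_A j (\<Sum>m\<in>keys ?P. lookup ?P m ^ (q ^ d) *
           (\<Prod>i\<in>keys m. theta ^ lookup m i)) = (\<Sum>m\<in>keys ?P. h (lookup m))"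
    unfolding emb_sum by (intro sum.cong refl summand)
  also have "\<dots> = sum h (lookup ` keys ?P)"
    by (subst sum.reindex[OF inj_on_lookup]) simp
  also have "\<dots> = sum h (box s D)"
  proof (rule sum.mono_neutral_left)
    show "lookup ` keys ?P \<subseteq> box s D"
      using keys D by blast
    show "\<forall>m\<in>box s D - lookup ` keys ?P. h m = 0"
    proof
      fix m assume m: "m \<in> box s D - lookup ` keys ?P"
      have "finite {i. m i \<noteq> 0}"
      proof (rule finite_subset)
        show "{i. m i \<noteq> 0} \<subseteq> {..<s}"
          using m box_zero[of m s D] by (metis (mono_tags, lifting) DiffD1 lessThan_iff mem_Collect_eq not_le subsetI)
      qed simp
      then have lk: "lookup (Abs_poly_mapping m) = m" by simp
      have "Abs_poly_mapping m \<notin> keys ?P"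
        using m lk by (metis DiffD2 image_eqI)
      then have "V_lim s m = 0" using keys lk by metis
      then show "h m = 0" by (simp add: h_def)
    qed
  qed simp
  also have "\<dots> = eval_box s D (\<lambda>_. th) (\<lambda>m. V_lim s m ^ (q ^ d))"
    by (simp add: eval_box_def h_def)
  also have "\<dots> = (- ll (d - 1)) ^ s * fps_nth (inverse exp_quot) (q ^ d - s)"
    by (rule eval_box_twisted_V[OF s d D])
  also have "\<dots> = frac_emb ((- to_fract (carlitz_l (d - 1))) ^ s * fps_nth (inverse exp_quot_K) (q ^ d - s))"
    unfolding frac_emb_mult frac_emb_power frac_emb_exp_frac_inverse to_fract_uminus[symmetric] frac_emb_to_fract emb_minus ll_def ..
  finally show "frac_emb (to_fract (\<Sum>m\<in>keys ?P. lookup ?P m ^ (q ^ d) *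
           (\<Prod>i\<in>keys m. theta ^ lookup m i))) =
     frac_emb ((- to_fract (carlitz_l (d - 1))) ^ s * fps_nth (inverse exp_quot_K) (q ^ d - s))"
    by (simp only: frac_emb_to_fract)
qed

end

theorem theorem5:
  fixes j :: "'a::finite_field fls alg_closure \<Rightarrow> 'c::{field, complete_space}"
    and lam :: 'c
    and s d r :: nat
    and sd :: "nat \<Rightarrow> nat"
    and p :: "'a poly"
  assumes "C_infinity j"
    and "lam ^ (CARD('a) - 1) = - embed_A j theta"
    and "s \<ge> 2"
    and "[s = 1] (mod (CARD('a) - 1))"
    and "s = (\<Sum>i\<le>r. sd i * CARD('a) ^ i)"
    and "\<forall>i\<le>r. sd i < CARD('a)"
    and "CARD('a) ^ d > s"
    and "Factorial_Ring.irreducible p" and "Polynomial.lead_coeff p = 1" and "Polynomial.degree p = d"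
  shows "cong_localized p (BB j lam s)
    ((-1) ^ s * bernoulli_carlitz (CARD('a) ^ d - s)
       * (\<Prod>i\<le>r. to_fract (carlitz_l (d - i - 1)) ^ (sd i * CARD('a) ^ i))
     / to_fract (carlitz_factorial (CARD('a) ^ d - s)))"
proof -
  interpret C: C_infinity j by fact
  interpret C: poly_embedding "CARD('a)" "embed_A j" by (rule C.poly_embedding_embed_A)
  interpret C: carlitz_data j "CARD('a)" lam by unfold_locales fact
  interpret K: prime_embedding "CARD('a)" to_fract p d
    using assms(8-10) by unfold_locales simp_all
  have s: "s \<ge> 2" "(CARD('a) - 1) dvd (s - 1)"
    using assms(3) cong_to_1_nat[OF assms(4)] by simp_all
  let ?P = "V_poly j lam s"
  define n where "n = CARD('a) ^ d - s"
  define c where "c = fps_nth (inverse exp_quot_K :: 'a poly fract fps) n"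
  define F where "F = (carlitz_factorial s :: 'a poly)"
  define l where "l = (carlitz_l (d - 1) :: 'a poly)"
  define L where "L = (\<Prod>i\<le>r. carlitz_l (d - i - 1) ^ (sd i * CARD('a) ^ i) :: 'a poly)"
  define t where "t m = (\<Prod>i\<in>keys m. theta ^ lookup m i :: 'a poly)" for m :: "nat \<Rightarrow>\<^sub>0 nat"
  define y where "y = (\<Sum>m\<in>keys ?P. lookup ?P m * t m)"
  define y' where "y' = (\<Sum>m\<in>keys ?P. lookup ?P m ^ (CARD('a) ^ d) * t m)"
  have BB: "BB j lam s = to_fract y / to_fract F"
    by (simp add: BB_def mpoly_eval_def y_def t_def F_def)
  have y': "to_fract y' = (- to_fract l) ^ s * c"
    unfolding y'_def t_def l_def c_def n_def by (rule C.twisted_V_poly_value[OF s assms(7)])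
  have "y' - y = (\<Sum>m\<in>keys ?P. (lookup ?P m ^ (CARD('a) ^ d) - lookup ?P m) * t m)"
    by (simp add: y_def y'_def sum_subtractf left_diff_distrib)
  also have "p dvd \<dots>"
    by (intro dvd_sum dvd_mult2 K.frobenius_cong)
  \<comment> \<open>twisting the coefficients of \<open>V\<close> does not change its value at \<open>\<theta>\<close> modulo \<open>p\<close>\<close>
  finally have yy': "to_fract (y' - y) \<in> K.pLoc" by (rule K.pLoc_dvd)
  have c: "c \<in> K.Loc"
    unfolding c_def n_def
    by (rule exp_quot_K_inverse_integral[OF K.prime_embedding_axioms]) (use assms(3,7) in linarith)
  have F: "\<not> p dvd F"
    unfolding F_def using assms(7) by (rule K.not_dvd_carlitz_factorial)
  then have F0: "F \<noteq> 0" by auto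
  \<comment> \<open>the powers of \<open>l\<^bsub>d-1\<^esub>\<close> are absorbed into \<open>\<Pi>(s)\<close> and the product on the right-hand side\<close>
  have lL: "to_fract (l ^ s - F * L) \<in> K.pLoc"
    using K.carlitz_l_factorial_cong[OF assms(5-7)]
    by (intro K.pLoc_dvd) (simp add: cong_iff_dvd_diff l_def F_def L_def)
  have "carlitz_factorial n \<noteq> (0 :: 'a poly)"
    by (simp add: carlitz_factorial_def carlitz_d_nonzero)
  then have rhs: "(-1) ^ s * bernoulli_carlitz n * (\<Prod>i\<le>r. to_fract (carlitz_l (d - i - 1)) ^ (sd i * CARD('a) ^ i))
     / to_fract (carlitz_factorial n) = (- 1) ^ s * c * to_fract L"
    by (simp add: bernoulli_carlitz_def X_over_carlitz_exp c_def L_def K.emb_prod K.emb_power)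
  have F_inv: "1 / to_fract F \<in> K.Loc" by (rule K.Loc_inverse[OF F])
  have "to_fract y / to_fract F - (- 1) ^ s * c * to_fract L =
      1 / to_fract F * ((- 1) ^ s * c * to_fract (l ^ s - F * L) - to_fract (y' - y))"
  proof -
    have "to_fract y' = (- 1) ^ s * c * to_fract l ^ s"
      unfolding y' power_minus[of "to_fract l"] by (simp only: mult_ac)
    then have "to_fract y = (- 1) ^ s * c * to_fract l ^ s - to_fract (y' - y)" by simp
    then show ?thesis
      using F0 by (simp add: K.emb_power right_diff_distrib diff_divide_distrib)
  qed
  also have "\<dots> \<in> K.pLoc"
  proof (intro K.pLoc_mult[OF F_inv] K.pLoc_diff yy')
    show "(- 1) ^ s * c * to_fract (l ^ s - F * L) \<in> K.pLoc"
      by (rule K.pLoc_mult[OF _ lL]) (intro K.Loc_mult K.Loc_power K.Loc_minus K.Loc_1 c)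
  qed
  finally have diff: "to_fract y / to_fract F - (- 1) ^ s * c * to_fract L \<in> K.pLoc" .
  have loc: "localization_at p = K.Loc" by (simp add: localization_at_def local_ring_def)
  have "to_fract y / to_fract F \<in> K.Loc" by (rule K.LocI[OF F])
  moreover have "(- 1) ^ s * c * to_fract L \<in> K.Loc"
    by (intro K.Loc_mult K.Loc_power K.Loc_minus K.Loc_1 c K.emb_in_Loc)
  ultimately have "cong_localized p (to_fract y / to_fract F) ((- 1) ^ s * c * to_fract L)"
    using diff unfolding cong_localized_def loc K.pLoc_def by blast
  then show ?thesis
    unfolding BB n_def[symmetric] rhs .
qed

end
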